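(* Let $f,g\in\mathbb{C}\{x,y\}$ both vanish at the origin and be coprime. Then $$\mu(f,g)=\mu_0(fg)+\sum_{[\alpha:\beta]\in\mathcal{B}(f,g)^{*}}\big(\mu_0(\alpha f+\beta g)-\mu_{gen}(f,g)\big).$$
   Context: For $h\in\mathbb{C}\{x,y\}$, $\mu_0(h)=\dim_{\mathbb{C}}\mathbb{C}\{x,y\}/(h_x,h_y)\in\mathbb{N}_{\ge0}\cup\{\infty\}$ is its Milnor number, and $i_0(\cdot,\cdot)$ denotes the intersection number at $0$. The Milnor number of the pair is $\mu(f,g):=i_0(f_xg-g_xf,\;f_yg-g_yf)$. The map $\mathbb{P}^1\to\mathbb{N}_{\ge0}\cup\{\infty\}$, $[\alpha:\beta]\mapsto\mu_0(\alpha f+\beta g)$, is constant outside a finite set; this constant value is the generic Milnor number $\mu_{gen}(f,g)$, and the bifurcation set $\mathcal{B}(f,g)\subset\mathbb{P}^1$ is the finite set of $[\alpha:\beta]$ with $\mu_0(\alpha f+\beta g)\neq\mu_{gen}(f,g)$ (at these points the value is strictly larger). $\mathcal{B}(f,g)^*:=\mathcal{B}(f,g)\setminus\{[1:0],[0:1]\}$, i.e. the bifurcation set with the points corresponding to $f$ and $g$ removed. *)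

theory Defs
  imports "HOL-Analysis.Analysis" "HOL-Computational_Algebra.Formal_Power_Series"
    "HOL-Library.Extended_Nat"
begin

text \<open>Power series in two variables x, y over the complex numbers, represented as
  power series in y whose coefficients are power series in x.\<close>
type_synonym ps2 = "complex fps fps"

definition coeff2 :: "ps2 \<Rightarrow> nat \<Rightarrow> nat \<Rightarrow> complex" where
  "coeff2 f i j = fps_nth (fps_nth f j) i"

definition convergent2 :: "ps2 \<Rightarrow> bool" where
  "convergent2 f \<longleftrightarrow> (\<exists>r>0. (\<lambda>(i,j). norm (coeff2 f i j) * r ^ (i + j)) summable_on UNIV)"

definition Cxy :: "ps2 set" where
  "Cxy = {f. convergent2 f}"

definition sc :: "complex \<Rightarrow> ps2" where
  "sc c = fps_const (fps_const c)"

definition dx :: "ps2 \<Rightarrow> ps2" where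
  "dx f = Abs_fps (\<lambda>j. fps_deriv (fps_nth f j))"

definition dy :: "ps2 \<Rightarrow> ps2" where
  "dy f = fps_deriv f"

definition ideal2 :: "ps2 \<Rightarrow> ps2 \<Rightarrow> ps2 set" where
  "ideal2 h1 h2 = {a * h1 + b * h2 | a b. a \<in> Cxy \<and> b \<in> Cxy}"

definition quotdim :: "ps2 set \<Rightarrow> enat" where
  "quotdim I = Sup {enat n | n. \<exists>v :: nat \<Rightarrow> ps2. (\<forall>k<n. v k \<in> Cxy) \<and>
      (\<forall>c :: nat \<Rightarrow> complex. (\<Sum>k<n. sc (c k) * v k) \<in> I \<longrightarrow> (\<forall>k<n. c k = 0))}"

definition milnor :: "ps2 \<Rightarrow> enat" where
  "milnor h = quotdim (ideal2 (dx h) (dy h))"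

definition intnum :: "ps2 \<Rightarrow> ps2 \<Rightarrow> enat" where
  "intnum f g = quotdim (ideal2 f g)"

definition milnor_pair :: "ps2 \<Rightarrow> ps2 \<Rightarrow> enat" where
  "milnor_pair f g = intnum (dx f * g - dx g * f) (dy f * g - dy g * f)"

definition unit2 :: "ps2 \<Rightarrow> bool" where
  "unit2 h \<longleftrightarrow> h \<in> Cxy \<and> (\<exists>u\<in>Cxy. h * u = 1)"

definition dvd2 :: "ps2 \<Rightarrow> ps2 \<Rightarrow> bool" where
  "dvd2 h f \<longleftrightarrow> (\<exists>a\<in>Cxy. f = h * a)"

definition coprime2 :: "ps2 \<Rightarrow> ps2 \<Rightarrow> bool" where
  "coprime2 f g \<longleftrightarrow> (\<forall>h\<in>Cxy. dvd2 h f \<and> dvd2 h g \<longrightarrow> unit2 h)"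

text \<open>Generic Milnor number of the pencil. A point [alpha:beta] of P^1 other than
  [0:1] is written [1:t]; since mu_0 of alpha f + beta g depends only on the projective
  point, the value is constant outside a finite set of P^1 iff t \<mapsto> mu_0(f + t g)
  is constant outside a finite subset of C, with the same constant.\<close>
definition mu_gen :: "ps2 \<Rightarrow> ps2 \<Rightarrow> enat" where
  "mu_gen f g = (THE m. finite {t. milnor (f + sc t * g) \<noteq> m})"

text \<open>B(f,g)^* : bifurcation points other than [1:0] and [0:1], i.e. [1:t] with t \<noteq> 0.\<close>
definition bif_star :: "ps2 \<Rightarrow> ps2 \<Rightarrow> complex set" where
  "bif_star f g = {t. t \<noteq> 0 \<and> milnor (f + sc t * g) \<noteq> mu_gen f g}"

end

theory Submission
  imports Defs "HOL-Computational_Algebra.Polynomial_FPS"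
    "HOL-Computational_Algebra.Fundamental_Theorem_Algebra"
begin

text \<open>Intersection numbers may be computed in the ring of formal power series, where they are additive
  and, by the Newton--Puiseux theorem, sums of orders along parametrized branches. With
  \<open>J = f\<^sub>x g\<^sub>y - f\<^sub>y g\<^sub>x\<close> one has Teissier's formula \<open>i(f + t g, J) = \<mu>(f + t g) + i(f, g) - 1\<close>, so the jumps
  of \<open>\<mu>\<close> in the pencil are the jumps of the order of \<open>f + t g\<close> along the branches of \<open>J\<close>; on each
  branch exactly one point of the projective line is special.

  Let \<open>G = f + t\<^sub>1 g\<close> be generic and \<open>D = \<partial>\<^sub>x + a \<partial>\<^sub>y\<close> a generic derivation. On a branch of \<open>J\<close> the order of
  \<open>A = D(G) g - D(g) G\<close> is that of \<open>D(G)\<close> plus the largest order in the pencil (the order of a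
  Wronskian). Writing \<open>B = f\<^sub>y g - g\<^sub>y f\<close>, the pair number is \<open>i(A, B)\<close>, and \<open>B D(G) \<equiv> - G J\<close> modulo \<open>A\<close>
  gives \<open>i(A, B) + i(A, D(G)) = i(A, G) + i(A, J)\<close>, from which \<open>i(A, B)\<close> is read off; compare with
  \<open>\<mu>(f g) = \<mu>(f) + \<mu>(g) + 2 i(f, g) - 1\<close>.\<close>

subsection \<open>Dimension of quotients\<close>

text \<open>Milnor numbers of special members of the pencil may be infinite (for instance when
  \<open>f\<close> is not reduced), and \<open>enat\<close> has no honest subtraction. Identities
  are therefore written additively, with \<open>+ 1\<close> moved to the other side, and a term is
  cancelled only once it is known to be finite. This dictates the auxiliary choices:
  \<open>G\<close> is generic so that \<mu>(G) and i(G, J) are finite, and D is generic so that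
  i(D(G), J) and i(G, y - a x) are finite. With these, i(A, D(G)) = i(D(G), D(g)) + i(D(G), G), i(A,
  G) = i(G, D(G)) + i(f, g) and i(D(G), J) = \<mu>(G) + i(D(G), D(g)), so everything involving D
  drops out and i(A, B) = i(f, g) + \<mu>(G) + i(G, J) + (sum of the jumps). Teissier's formula for
  \<open>G\<close> turns the first three terms into 2 i(f, g) + 2 \<mu>(G) - 1; the jumps at [1:0]
  and [0:1] complete 2 \<mu>(G) to \<mu>(f) + \<mu>(g), which is what \<mu>(f g) contains. The
  passage to formal series is harmless because a quotient of finite dimension sees only a finite
  truncation.\<close>

definition subsp :: "ps2 set \<Rightarrow> bool" where
  "subsp S \<longleftrightarrow> 0 \<in> S \<and> (\<forall>a\<in>S. \<forall>b\<in>S. a + b \<in> S) \<and> (\<forall>c. \<forall>a\<in>S. sc c * a \<in> S)"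

definition indep_mod :: "ps2 set \<Rightarrow> nat \<Rightarrow> (nat \<Rightarrow> ps2) \<Rightarrow> bool" where
  "indep_mod I n v \<longleftrightarrow> (\<forall>c :: nat \<Rightarrow> complex. (\<Sum>k<n. sc (c k) * v k) \<in> I \<longrightarrow> (\<forall>k<n. c k = 0))"

text \<open>A relative form of \<open>quotdim\<close>: additivity of intersection numbers is a
  statement about chains of subspaces, so numerator and denominator both have to vary.\<close>

definition reldim :: "ps2 set \<Rightarrow> ps2 set \<Rightarrow> enat" where
  "reldim K I = Sup {enat n | n. \<exists>v. (\<forall>k<n. v k \<in> K) \<and> indep_mod I n v}"

lemma enat_eqI: "(\<And>n. enat n \<le> a \<longleftrightarrow> enat n \<le> b) \<Longrightarrow> a = b"
proof (rule antisym)
  have le: "x \<le> y" if "\<And>n. enat n \<le> x \<Longrightarrow> enat n \<le> y" for x y :: enat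
  proof (cases y)
    case (enat m)
    then have "\<not> enat (Suc m) \<le> x" using that[of "Suc m"] by auto
    then show ?thesis using enat by (cases x) auto
  qed auto
  assume *: "\<And>n. enat n \<le> a \<longleftrightarrow> enat n \<le> b"
  show "a \<le> b" by (rule le) (simp add: *)
  show "b \<le> a" by (rule le) (simp add: *)
qed

lemma quotdim_eq_reldim: "quotdim I = reldim Cxy I"
  by (simp add: quotdim_def reldim_def indep_mod_def)

lemma sc_simps [simp]: "sc 0 = 0" "sc 1 = 1"
  by (simp_all add: sc_def)

lemma sc_add: "sc (a + b) = sc a + sc b"
  by (simp add: sc_def)

lemma sc_minus: "sc (- a) = - sc a"
  by (simp add: sc_def)

lemma sc_mult: "sc (a * b) = sc a * sc b"
  by (simp add: sc_def)

lemma sc_sum: "sc (\<Sum>i\<in>A. f i) = (\<Sum>i\<in>A. sc (f i))"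
  by (induction A rule: infinite_finite_induct) (auto simp: sc_add)

lemma sc_inverse: "a \<noteq> 0 \<Longrightarrow> sc (inverse a) * sc a = 1"
  by (simp flip: sc_mult)

lemma subspD:
  assumes "subsp S"
  shows "0 \<in> S" "a \<in> S \<Longrightarrow> b \<in> S \<Longrightarrow> a + b \<in> S" "a \<in> S \<Longrightarrow> sc c * a \<in> S"
    "a \<in> S \<Longrightarrow> - a \<in> S" "a \<in> S \<Longrightarrow> b \<in> S \<Longrightarrow> a - b \<in> S"
proof -
  show 0: "0 \<in> S" and add: "\<And>a b. a \<in> S \<Longrightarrow> b \<in> S \<Longrightarrow> a + b \<in> S"
    and s: "\<And>a c. a \<in> S \<Longrightarrow> sc c * a \<in> S"
    using assms by (auto simp: subsp_def)
  show m: "- a \<in> S" if "a \<in> S" for a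
    using s[OF that, of "-1"] by (simp add: sc_minus)
  show "a - b \<in> S" if "a \<in> S" "b \<in> S"
    using add[OF that(1) m[OF that(2)]] by simp
qed

lemma subsp_sum:
  assumes "subsp S" "\<And>k. k \<in> A \<Longrightarrow> v k \<in> S"
  shows "(\<Sum>k\<in>A. v k) \<in> S"
  using assms(2) by (induction A rule: infinite_finite_induct) (auto intro: subspD[OF assms(1)])

lemma subsp_UNIV [simp]: "subsp UNIV"
  by (simp add: subsp_def)

text \<open>A subfamily of an independent family is independent, so the admissible sizes are
  downward closed and every finite lower bound of the supremum is attained. This lets infinite
  dimensions be handled together with finite ones.\<close>

lemma reldim_ge_iff:
  "enat n \<le> reldim K I \<longleftrightarrow> (\<exists>v. (\<forall>k<n. v k \<in> K) \<and> indep_mod I n v)"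
proof -
  define P where "P n \<longleftrightarrow> (\<exists>v. (\<forall>k<n. v k \<in> K) \<and> indep_mod I n v)" for n
  have P0: "P 0"
    by (auto simp: P_def indep_mod_def)
  have down: "P m" if "P n" "m \<le> n" for m n
  proof -
    obtain v where v: "\<forall>k<n. v k \<in> K" "indep_mod I n v"
      using \<open>P n\<close> by (auto simp: P_def)
    have "indep_mod I m v"
      unfolding indep_mod_def
    proof (intro allI impI)
      fix c :: "nat \<Rightarrow> complex" and k
      assume c: "(\<Sum>k<m. sc (c k) * v k) \<in> I" and k: "k < m"
      have "(\<Sum>k<n. sc (if k < m then c k else 0) * v k) = (\<Sum>k<m. sc (c k) * v k)"
        by (rule sum.mono_neutral_cong_right) (use \<open>m \<le> n\<close> in auto)
      then have "\<forall>k<n. (if k < m then c k else 0) = 0"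
        using v(2)[unfolded indep_mod_def, rule_format, of "\<lambda>k. if k < m then c k else 0"] c by simp
      then show "c k = 0"
        using k \<open>m \<le> n\<close> by (metis order_less_le_trans)
    qed
    then show ?thesis
      using v(1) \<open>m \<le> n\<close> unfolding P_def by (intro exI[of _ v]) auto
  qed
  have "P n" if "enat n \<le> Sup {enat n | n. P n}"
  proof (rule ccontr)
    assume "\<not> P n"
    then obtain k where n: "n = Suc k"
      using P0 by (cases n) auto
    have "Sup {enat n | n. P n} \<le> enat k"
    proof (rule Sup_least)
      fix x assume "x \<in> {enat n | n. P n}"
      then obtain m where m: "x = enat m" "P m" by blast
      then have "\<not> n \<le> m" using down[of m n] \<open>\<not> P n\<close> by blast
      then show "x \<le> enat k" using m n by simp
    qed
    then have "enat n \<le> enat k"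
      using that by (rule order_trans[rotated])
    then show False
      using n by simp
  qed
  then show ?thesis
    unfolding reldim_def P_def[symmetric] by (auto intro: Sup_upper)
qed

lemma homogeneous_system:
  fixes a :: "'i \<Rightarrow> nat \<Rightarrow> complex"
  assumes "finite S" "q < card S"
  shows "\<exists>c. (\<exists>i\<in>S. c i \<noteq> 0) \<and> (\<forall>j<q. (\<Sum>i\<in>S. c i * a i j) = 0)"
  using assms
proof (induction q arbitrary: S a)
  case 0
  then have "S \<noteq> {}" by auto
  then show ?case by (intro exI[of _ "\<lambda>_. 1"]) auto
next
  case (Suc q)
  show ?case
  proof (cases "\<forall>i\<in>S. a i q = 0")
    case True
    obtain c where "\<exists>i\<in>S. c i \<noteq> 0" "\<forall>j<q. (\<Sum>i\<in>S. c i * a i j) = 0"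
      using Suc.IH[of S a] Suc.prems by auto
    with True show ?thesis
      by (intro exI[of _ c]) (auto simp: less_Suc_eq)
  next
    case False
    then obtain p where p: "p \<in> S" "a p q \<noteq> 0" by blast
    \<comment> \<open>Gaussian elimination: equation \<open>q\<close> is solved for the unknown
      \<open>p\<close>, whose coefficient there is nonzero, and \<open>b\<close> is the system left
      for the other unknowns.\<close>
    define T where "T = S - {p}"
    define b where "b i j = a i j - a i q / a p q * a p j" for i j
    have T: "finite T" "q < card T" "S = insert p T" "p \<notin> T"
      using Suc.prems p by (auto simp: T_def)
    obtain c where c: "\<exists>i\<in>T. c i \<noteq> 0" "\<forall>j<q. (\<Sum>i\<in>T. c i * b i j) = 0"
      using Suc.IH[OF T(1,2), of b] by blast
    define d where "d i = (if i = p then - (\<Sum>i\<in>T. c i * a i q / a p q) else c i)" for i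
    have sum_d: "(\<Sum>i\<in>S. d i * a i j) = (\<Sum>i\<in>T. c i * b i j)" for j
    proof -
      have "(\<Sum>i\<in>S. d i * a i j) = d p * a p j + (\<Sum>i\<in>T. c i * a i j)"
        unfolding T(3) using T(1,4) by (subst sum.insert) (auto simp: d_def intro!: sum.cong)
      also have "\<dots> = (\<Sum>i\<in>T. c i * b i j)"
        by (simp add: d_def b_def algebra_simps sum_subtractf sum_distrib_left sum_distrib_right)
      finally show ?thesis .
    qed
    have "(\<Sum>i\<in>S. d i * a i j) = 0" if "j < Suc q" for j
    proof (cases "j = q")
      case True
      then show ?thesis using p(2) by (simp add: sum_d b_def)
    next
      case False
      then show ?thesis using that c(2) by (simp add: sum_d)
    qed
    moreover have "\<exists>i\<in>S. d i \<noteq> 0"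
      using c(1) T by (auto simp: d_def)
    ultimately show ?thesis by blast
  qed
qed

definition spanning_mod :: "ps2 set \<Rightarrow> ps2 set \<Rightarrow> nat \<Rightarrow> (nat \<Rightarrow> ps2) \<Rightarrow> bool" where
  "spanning_mod K I n v \<longleftrightarrow> (\<forall>w\<in>K. \<exists>c. w - (\<Sum>k<n. sc (c k) * v k) \<in> I)"

text \<open>The coordinates of \<open>n + 1\<close> elements with respect to \<open>n\<close>
  spanning ones form a homogeneous system with a nontrivial solution, which is a linear relation
  modulo \<open>I\<close>.\<close>

lemma reldim_le_spanning:
  assumes I: "subsp I" and v: "spanning_mod K I n v"
  shows "reldim K I \<le> enat n"
proof (rule ccontr)
  assume "\<not> reldim K I \<le> enat n"
  then have "enat (Suc n) \<le> reldim K I"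
    by (simp add: not_le Suc_ile_eq)
  then obtain w where w: "\<forall>k<Suc n. w k \<in> K" "indep_mod I (Suc n) w"
    unfolding reldim_ge_iff by blast
  have "\<forall>i. \<exists>c. i < Suc n \<longrightarrow> w i - (\<Sum>k<n. sc (c k) * v k) \<in> I"
    using v w(1) unfolding spanning_mod_def by blast
  then obtain a where a: "\<And>i. i < Suc n \<Longrightarrow> w i - (\<Sum>k<n. sc (a i k) * v k) \<in> I"
    by metis
  obtain c where c: "\<exists>i\<in>{..<Suc n}. c i \<noteq> 0" "\<forall>j<n. (\<Sum>i<Suc n. c i * a i j) = 0"
    using homogeneous_system[of "{..<Suc n}" n a] by auto
  have "(\<Sum>i<Suc n. sc (c i) * (w i - (\<Sum>k<n. sc (a i k) * v k))) \<in> I"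
    by (intro subsp_sum I subspD(3)[OF I] a) auto
  also have "(\<Sum>i<Suc n. sc (c i) * (w i - (\<Sum>k<n. sc (a i k) * v k)))
      = (\<Sum>i<Suc n. sc (c i) * w i) - (\<Sum>k<n. sc (\<Sum>i<Suc n. c i * a i k) * v k)"
  proof -
    have "(\<Sum>i<Suc n. sc (c i) * (\<Sum>k<n. sc (a i k) * v k))
        = (\<Sum>i<Suc n. \<Sum>k<n. sc (c i * a i k) * v k)"
      by (simp only: sum_distrib_left sc_mult mult.assoc)
    also have "\<dots> = (\<Sum>k<n. \<Sum>i<Suc n. sc (c i * a i k) * v k)"
      by (rule sum.swap)
    also have "\<dots> = (\<Sum>k<n. sc (\<Sum>i<Suc n. c i * a i k) * v k)"
      by (simp only: sc_sum sum_distrib_right)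
    finally show ?thesis
      by (simp only: right_diff_distrib sum_subtractf)
  qed
  also have "\<dots> = (\<Sum>i<Suc n. sc (c i) * w i)"
    using c(2) by simp
  finally show False
    using w(2) c(1) unfolding indep_mod_def by auto
qed

text \<open>An independent family of maximal size spans: adjoining \<open>w\<close> creates a
  relation modulo \<open>I\<close>, and its coefficient at \<open>w\<close> cannot vanish.\<close>

lemma reldim_basis:
  assumes I: "subsp I" and n: "reldim K I = enat n"
  obtains v where "\<forall>k<n. v k \<in> K" "indep_mod I n v" "spanning_mod K I n v"
proof -
  obtain v where v: "\<forall>k<n. v k \<in> K" "indep_mod I n v"
    using reldim_ge_iff[of n K I] n by auto
  have "spanning_mod K I n v"
    unfolding spanning_mod_def
  proof
    fix w assume w: "w \<in> K"
    let ?v = "v(n := w)"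
    have "\<not> indep_mod I (Suc n) ?v"
    proof
      assume "indep_mod I (Suc n) ?v"
      moreover have "\<forall>k<Suc n. ?v k \<in> K"
        using v w by auto
      ultimately have "enat (Suc n) \<le> reldim K I"
        unfolding reldim_ge_iff by blast
      then show False using n by simp
    qed
    then obtain c where c: "(\<Sum>k<n. sc (c k) * v k) + sc (c n) * w \<in> I" "\<exists>k<Suc n. c k \<noteq> 0"
      by (auto simp: indep_mod_def)
    have cn: "c n \<noteq> 0"
    proof
      assume "c n = 0"
      then have "\<forall>k<n. c k = 0"
        using c(1) v(2) by (auto simp: indep_mod_def)
      then show False using c(2) \<open>c n = 0\<close> by (auto simp: less_Suc_eq)
    qed
    have "sc (inverse (c n)) * ((\<Sum>k<n. sc (c k) * v k) + sc (c n) * w) \<in> I"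
      by (rule subspD(3)[OF I c(1)])
    also have "sc (inverse (c n)) * ((\<Sum>k<n. sc (c k) * v k) + sc (c n) * w)
        = w - (\<Sum>k<n. sc (- (inverse (c n) * c k)) * v k)"
      using sc_inverse[OF cn]
      by (simp add: distrib_left sum_distrib_left sc_mult sc_minus sum_negf flip: mult.assoc)
    finally show "\<exists>c. w - (\<Sum>k<n. sc (c k) * v k) \<in> I"
      by (intro exI[of _ "\<lambda>k. - (inverse (c n) * c k)"])
  qed
  with v show ?thesis using that by blast
qed

lemma reldim_mono:
  assumes "K \<subseteq> K'" "I' \<subseteq> I"
  shows "reldim K I \<le> reldim K' I'"
proof -
  have "indep_mod I' n v" if "indep_mod I n v" for n v
    using that assms(2) unfolding indep_mod_def by blast
  then show ?thesis
    unfolding reldim_def using assms(1) by (intro Sup_subset_mono) blast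
qed

text \<open>Families for the two quotients are concatenated. The lower bound is proved for all
  finite sizes, so it also settles infinite dimensions; only the upper bound needs spanning
  families.\<close>

lemma reldim_add:
  assumes V: "subsp V" and K: "subsp K" and I: "subsp I" and KV: "K \<subseteq> V" and IK: "I \<subseteq> K"
  shows "reldim V I = reldim V K + reldim K I"
proof -
  have split: "(\<Sum>k<n + m. sc (c k) * (if k < n then v k else w (k - n)))
      = (\<Sum>k<n. sc (c k) * v k) + (\<Sum>k<m. sc (c (n + k)) * w k)" for n m :: nat and c :: "nat \<Rightarrow> complex" and v w
    by (induction m) (simp_all add: add.assoc)
  have ge: "enat (n + m) \<le> reldim V I" if n: "enat n \<le> reldim V K" and m: "enat m \<le> reldim K I" for n m
  proof -
    obtain v where v: "\<forall>k<n. v k \<in> V" "indep_mod K n v"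
      using n unfolding reldim_ge_iff by blast
    obtain w where w: "\<forall>k<m. w k \<in> K" "indep_mod I m w"
      using m unfolding reldim_ge_iff by blast
    let ?u = "\<lambda>k. if k < n then v k else w (k - n)"
    have "indep_mod I (n + m) ?u"
      unfolding indep_mod_def split
    proof (intro allI impI)
      fix c :: "nat \<Rightarrow> complex" and k
      assume *: "(\<Sum>k<n. sc (c k) * v k) + (\<Sum>k<m. sc (c (n + k)) * w k) \<in> I" and k: "k < n + m"
      have "(\<Sum>k<m. sc (c (n + k)) * w k) \<in> K"
        using w(1) by (intro subsp_sum K subspD(3)[OF K]) auto
      then have "(\<Sum>k<n. sc (c k) * v k) \<in> K"
        using subspD(5)[OF K, of "(\<Sum>k<n. sc (c k) * v k) + (\<Sum>k<m. sc (c (n + k)) * w k)" "\<Sum>k<m. sc (c (n + k)) * w k"] * IK by auto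
      then have 1: "\<forall>k<n. c k = 0"
        using v(2) by (auto simp: indep_mod_def)
      then have "\<forall>k<m. c (n + k) = 0"
        using * w(2)[unfolded indep_mod_def, rule_format, of "\<lambda>k. c (n + k)"] by simp
      then show "c k = 0"
        using 1 k by (metis le_add_diff_inverse nat_add_left_cancel_less not_less)
    qed
    moreover have "\<forall>k<n + m. ?u k \<in> V"
      using v(1) w(1) KV by auto
    ultimately show ?thesis
      unfolding reldim_ge_iff by (intro exI[of _ ?u] conjI)
  qed
  show ?thesis
  proof (cases "reldim V K = \<infinity> \<or> reldim K I = \<infinity>")
    case True
    have "enat n \<le> reldim V I" for n
      using ge[of n 0] ge[of 0 n] True by (auto simp: zero_enat_def[symmetric])
    then have "reldim V I = \<infinity>"
      by (intro enat_eqI) auto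
    then show ?thesis using True by auto
  next
    case False
    then obtain n m where nm: "reldim V K = enat n" "reldim K I = enat m" by auto
    obtain v where v: "\<forall>k<n. v k \<in> V" "spanning_mod V K n v"
      using reldim_basis[OF K nm(1)] by blast
    obtain w where w: "\<forall>k<m. w k \<in> K" "spanning_mod K I m w"
      using reldim_basis[OF I nm(2)] by blast
    let ?u = "\<lambda>k. if k < n then v k else w (k - n)"
    have "spanning_mod V I (n + m) ?u"
      unfolding spanning_mod_def
    proof
      fix a assume "a \<in> V"
      then obtain c where "a - (\<Sum>k<n. sc (c k) * v k) \<in> K"
        using v unfolding spanning_mod_def by blast
      then obtain d where d: "a - (\<Sum>k<n. sc (c k) * v k) - (\<Sum>k<m. sc (d k) * w k) \<in> I"
        using w unfolding spanning_mod_def by blast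
      show "\<exists>c. a - (\<Sum>k<n + m. sc (c k) * ?u k) \<in> I"
        unfolding split using d
        by (intro exI[of _ "\<lambda>k. if k < n then c k else d (k - n)"]) (simp add: diff_diff_eq)
    qed
    then have "reldim V I \<le> enat (n + m)"
      by (rule reldim_le_spanning[OF I])
    with ge[of n m] nm show ?thesis by simp
  qed
qed

text \<open>The isomorphism theorem, with surjectivity and kernel tested modulo \<open>I'\<close>.
  It is applied to the inclusion of convergent into formal series, to multiplication by a series and
  to a coordinate map.\<close>

lemma reldim_iso:
  assumes lin: "\<And>a b. \<phi> (a + b) = \<phi> a + \<phi> b" "\<And>c a. \<phi> (sc c * a) = sc c * \<phi> a"
    and I': "subsp I'"
    and into: "\<And>v. v \<in> K \<Longrightarrow> \<phi> v \<in> K'"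
    and onto: "\<And>w. w \<in> K' \<Longrightarrow> \<exists>v\<in>K. w - \<phi> v \<in> I'"
    and K: "subsp K"
    and ker: "\<And>v. v \<in> K \<Longrightarrow> \<phi> v \<in> I' \<longleftrightarrow> v \<in> I"
  shows "reldim K I = reldim K' I'"
proof -
  have \<phi>0: "\<phi> 0 = 0" using lin(1)[of 0 0] by simp
  have \<phi>sum: "\<phi> (\<Sum>k<n. sc (c k) * v k) = (\<Sum>k<n. sc (c k) * \<phi> (v k))"
    for n :: nat and c :: "nat \<Rightarrow> complex" and v
    by (induction n) (simp_all add: \<phi>0 lin)
  have "enat n \<le> reldim K' I' \<longleftrightarrow> enat n \<le> reldim K I" for n
  proof
    assume "enat n \<le> reldim K I"
    then obtain v where v: "\<forall>k<n. v k \<in> K" "indep_mod I n v"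
      unfolding reldim_ge_iff by blast
    have "indep_mod I' n (\<lambda>k. \<phi> (v k))"
      unfolding indep_mod_def \<phi>sum[symmetric]
    proof (rule allI, rule impI)
      fix c assume "\<phi> (\<Sum>k<n. sc (c k) * v k) \<in> I'"
      moreover have "(\<Sum>k<n. sc (c k) * v k) \<in> K"
        using v(1) by (intro subsp_sum K subspD(3)[OF K]) auto
      ultimately show "\<forall>k<n. c k = 0"
        using ker v(2) unfolding indep_mod_def by blast
    qed
    then show "enat n \<le> reldim K' I'"
      unfolding reldim_ge_iff using v(1) into by (intro exI[of _ "\<lambda>k. \<phi> (v k)"]) auto
  next
    assume "enat n \<le> reldim K' I'"
    then obtain w where w: "\<forall>k<n. w k \<in> K'" "indep_mod I' n w"
      unfolding reldim_ge_iff by blast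
    have "\<forall>k. \<exists>v. k < n \<longrightarrow> v \<in> K \<and> w k - \<phi> v \<in> I'"
      using onto w(1) by blast
    then obtain v where v: "\<And>k. k < n \<Longrightarrow> v k \<in> K" "\<And>k. k < n \<Longrightarrow> w k - \<phi> (v k) \<in> I'"
      by metis
    have "indep_mod I n v"
      unfolding indep_mod_def
    proof (rule allI, rule impI)
      fix c assume c: "(\<Sum>k<n. sc (c k) * v k) \<in> I"
      have "(\<Sum>k<n. sc (c k) * v k) \<in> K"
        using v(1) by (intro subsp_sum K subspD(3)[OF K]) auto
      then have 1: "(\<Sum>k<n. sc (c k) * \<phi> (v k)) \<in> I'"
        using ker c \<phi>sum by metis
      have "(\<Sum>k<n. sc (c k) * (w k - \<phi> (v k))) \<in> I'"
        using v(2) by (intro subsp_sum I' subspD(3)[OF I']) auto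
      from subspD(2)[OF I' 1 this] have "(\<Sum>k<n. sc (c k) * w k) \<in> I'"
        by (simp add: right_diff_distrib sum_subtractf)
      then show "\<forall>k<n. c k = 0"
        using w(2) unfolding indep_mod_def by blast
    qed
    then show "enat n \<le> reldim K I"
      unfolding reldim_ge_iff using v(1) by blast
  qed
  then show ?thesis
    by (intro enat_eqI) auto
qed

lemma reldim_refl: "subsp I \<Longrightarrow> reldim I I = 0"
proof -
  assume I: "subsp I"
  have "reldim I I \<le> enat 0"
    by (rule reldim_le_spanning[OF I, of _ _ "\<lambda>_. 0"]) (auto simp: spanning_mod_def)
  then show ?thesis by (simp add: zero_enat_def[symmetric])
qed

subsection \<open>Convergent power series\<close>

lemma convolution_le:
  fixes p q :: "nat \<Rightarrow> real"
  assumes "\<And>i. p i \<ge> 0" "\<And>i. q i \<ge> 0"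
  shows "(\<Sum>j\<le>n. \<Sum>l\<le>j. p l * q (j - l)) \<le> (\<Sum>j\<le>n. p j) * (\<Sum>j\<le>n. q j)"
proof -
  have "(\<Sum>j\<le>n. \<Sum>l\<le>j. p l * q (j - l)) = (\<Sum>(i, j)\<in>{(i, j). i + j \<le> n}. p i * q j)"
    by (rule sum.triangle_reindex_eq[symmetric])
  also have "\<dots> \<le> (\<Sum>(i, j)\<in>{..n} \<times> {..n}. p i * q j)"
    by (rule sum_mono2) (use assms in auto)
  also have "\<dots> = (\<Sum>j\<le>n. p j) * (\<Sum>j\<le>n. q j)"
    by (simp add: sum_product sum.cartesian_product)
  finally show ?thesis .
qed

definition wsum :: "real \<Rightarrow> nat \<Rightarrow> complex fps \<Rightarrow> real" where
  "wsum r n a = (\<Sum>i\<le>n. norm (fps_nth a i) * r ^ i)"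

text \<open>Finite partial sums of the majorant norm on the polydisc of radii \<open>r\<close> and
  \<open>s\<close>; convergence becomes a bound uniform in \<open>n\<close>. The radii are separate
  because Weierstrass division needs \<open>r\<close> small compared with a power of
  \<open>s\<close>.\<close>

definition wsum2 :: "real \<Rightarrow> real \<Rightarrow> nat \<Rightarrow> ps2 \<Rightarrow> real" where
  "wsum2 r s n h = (\<Sum>j\<le>n. wsum r n (fps_nth h j) * s ^ j)"

lemma wsum_nonneg [simp]: "r \<ge> 0 \<Longrightarrow> wsum r n a \<ge> 0"
  by (auto simp: wsum_def intro!: sum_nonneg)

lemma wsum2_nonneg: "r \<ge> 0 \<Longrightarrow> s \<ge> 0 \<Longrightarrow> wsum2 r s n a \<ge> 0"
  by (auto simp: wsum2_def intro!: sum_nonneg)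

lemma wsum_mult:
  assumes "r \<ge> 0"
  shows "wsum r n (a * b) \<le> wsum r n a * wsum r n b"
proof -
  have "wsum r n (a * b) \<le> (\<Sum>i\<le>n. \<Sum>l\<le>i. (norm (fps_nth a l) * r ^ l) * (norm (fps_nth b (i - l)) * r ^ (i - l)))"
    unfolding wsum_def
  proof (rule sum_mono)
    fix i
    have "norm (fps_nth (a * b) i) \<le> (\<Sum>l\<le>i. norm (fps_nth a l) * norm (fps_nth b (i - l)))"
      unfolding fps_mult_nth atLeast0AtMost by (rule sum_norm_le) (simp add: norm_mult)
    then have "norm (fps_nth (a * b) i) * r ^ i \<le> (\<Sum>l\<le>i. norm (fps_nth a l) * norm (fps_nth b (i - l))) * r ^ i"
      using assms by (intro mult_right_mono) auto
    also have "\<dots> = (\<Sum>l\<le>i. (norm (fps_nth a l) * r ^ l) * (norm (fps_nth b (i - l)) * r ^ (i - l)))"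
      unfolding sum_distrib_right
      by (intro sum.cong refl) (simp add: power_add[symmetric] mult_ac)
    finally show "norm (fps_nth (a * b) i) * r ^ i \<le> \<dots>" .
  qed
  also have "\<dots> \<le> wsum r n a * wsum r n b"
    unfolding wsum_def using assms by (intro convolution_le) auto
  finally show ?thesis .
qed

lemma wsum_add: "r \<ge> 0 \<Longrightarrow> wsum r n (a + b) \<le> wsum r n a + wsum r n b"
  by (auto simp: wsum_def simp flip: sum.distrib distrib_right intro!: sum_mono mult_right_mono norm_triangle_ineq)

lemma wsum_sum: "r \<ge> 0 \<Longrightarrow> wsum r n (\<Sum>i\<in>A. f i) \<le> (\<Sum>i\<in>A. wsum r n (f i))"
proof (induction A rule: infinite_finite_induct)
  case (insert x F)
  then show ?case using wsum_add[of r n "f x" "\<Sum>i\<in>F. f i"] by auto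
qed (auto simp: wsum_def)

lemma wsum2_mult:
  assumes "r \<ge> 0" "s \<ge> 0"
  shows "wsum2 r s n (a * b) \<le> wsum2 r s n a * wsum2 r s n b"
proof -
  have "wsum2 r s n (a * b) \<le> (\<Sum>i\<le>n. \<Sum>l\<le>i. (wsum r n (fps_nth a l) * s ^ l) * (wsum r n (fps_nth b (i - l)) * s ^ (i - l)))"
    unfolding wsum2_def
  proof (rule sum_mono)
    fix i
    have "wsum r n (fps_nth (a * b) i) \<le> (\<Sum>l\<le>i. wsum r n (fps_nth a l * fps_nth b (i - l)))"
      unfolding fps_mult_nth atLeast0AtMost by (rule wsum_sum[OF assms(1)])
    also have "\<dots> \<le> (\<Sum>l\<le>i. wsum r n (fps_nth a l) * wsum r n (fps_nth b (i - l)))"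
      by (intro sum_mono wsum_mult assms)
    finally have "wsum r n (fps_nth (a * b) i) * s ^ i \<le> (\<Sum>l\<le>i. wsum r n (fps_nth a l) * wsum r n (fps_nth b (i - l))) * s ^ i"
      using assms by (intro mult_right_mono) auto
    also have "\<dots> = (\<Sum>l\<le>i. (wsum r n (fps_nth a l) * s ^ l) * (wsum r n (fps_nth b (i - l)) * s ^ (i - l)))"
      unfolding sum_distrib_right
      by (intro sum.cong refl) (simp add: power_add[symmetric] mult_ac)
    finally show "wsum r n (fps_nth (a * b) i) * s ^ i \<le> \<dots>" .
  qed
  also have "\<dots> \<le> wsum2 r s n a * wsum2 r s n b"
    unfolding wsum2_def using assms by (intro convolution_le) auto
  finally show ?thesis .
qed

lemma wsum2_add:
  assumes "r \<ge> 0" "s \<ge> 0"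
  shows "wsum2 r s n (a + b) \<le> wsum2 r s n a + wsum2 r s n b"
  unfolding wsum2_def sum.distrib[symmetric] distrib_right[symmetric]
  using assms by (auto intro!: sum_mono mult_right_mono wsum_add)

lemma wsum2_alt: "wsum2 r s n h = (\<Sum>(i, j)\<in>{..n} \<times> {..n}. norm (coeff2 h i j) * (r ^ i * s ^ j))"
proof -
  have "wsum2 r s n h = (\<Sum>j\<le>n. \<Sum>i\<le>n. norm (coeff2 h i j) * (r ^ i * s ^ j))"
    by (simp add: wsum2_def wsum_def coeff2_def sum_distrib_left mult_ac)
  also have "\<dots> = (\<Sum>i\<le>n. \<Sum>j\<le>n. norm (coeff2 h i j) * (r ^ i * s ^ j))"
    by (rule sum.swap)
  finally show ?thesis
    by (simp add: sum.cartesian_product)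
qed

lemma coeff2_le_wsum2:
  assumes "r \<ge> 0" "s \<ge> 0" "i \<le> n" "j \<le> n"
  shows "norm (coeff2 h i j) * (r ^ i * s ^ j) \<le> wsum2 r s n h"
  unfolding wsum2_alt
  using member_le_sum[of "(i, j)" "{..n} \<times> {..n}" "\<lambda>(i, j). norm (coeff2 h i j) * (r ^ i * s ^ j)"] assms
  by auto

lemma bounded_imp_Cxy:
  assumes "r > 0" "s > 0" and M: "\<And>n. wsum2 r s n h \<le> M"
  shows "h \<in> Cxy"
proof -
  define t where "t = min r s"
  have t: "t > 0" "t \<le> r" "t \<le> s" using assms by (auto simp: t_def)
  have "(\<lambda>(i, j). norm (coeff2 h i j) * t ^ (i + j)) summable_on UNIV"
  proof (rule nonneg_bdd_above_summable_on)
    show "bdd_above (sum (\<lambda>(i, j). norm (coeff2 h i j) * t ^ (i + j)) ` {F. F \<subseteq> UNIV \<and> finite F})"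
    proof (rule bdd_aboveI2)
      fix F :: "(nat \<times> nat) set" assume "F \<in> {F. F \<subseteq> UNIV \<and> finite F}"
      then have "finite F" by auto
      define n where "n = Max (insert 0 (fst ` F \<union> snd ` F))"
      have "F \<subseteq> {..n} \<times> {..n}"
        unfolding n_def using \<open>finite F\<close> by (auto intro!: Max_ge simp: rev_image_eqI)
      then have "sum (\<lambda>(i, j). norm (coeff2 h i j) * t ^ (i + j)) F
          \<le> (\<Sum>(i, j)\<in>{..n} \<times> {..n}. norm (coeff2 h i j) * t ^ (i + j))"
        using t by (intro sum_mono2) auto
      also have "\<dots> \<le> wsum2 r s n h"
        unfolding wsum2_alt power_add
        using t by (intro sum_mono) (auto intro!: mult_left_mono mult_mono power_mono)
      finally show "sum (\<lambda>(i, j). norm (coeff2 h i j) * t ^ (i + j)) F \<le> M"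
        using M[of n] by linarith
    qed
  qed (use t in auto)
  then show ?thesis
    using t by (auto simp: Cxy_def convergent2_def)
qed

lemma Cxy_imp_bounded:
  assumes "h \<in> Cxy"
  obtains R where "R > 0" "\<And>r s. 0 < r \<Longrightarrow> r \<le> R \<Longrightarrow> 0 < s \<Longrightarrow> s \<le> R \<Longrightarrow> \<exists>M>0. \<forall>n. wsum2 r s n h \<le> M"
proof -
  obtain R where R: "R > 0" and sm: "(\<lambda>(i, j). norm (coeff2 h i j) * R ^ (i + j)) summable_on UNIV"
    using assms by (auto simp: Cxy_def convergent2_def)
  define M where "M = infsum (\<lambda>(i, j). norm (coeff2 h i j) * R ^ (i + j)) UNIV"
  have "\<exists>M>0. \<forall>n. wsum2 r s n h \<le> M" if "0 < r" "r \<le> R" "0 < s" "s \<le> R" for r s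
  proof (intro exI conjI allI)
    fix n
    have "wsum2 r s n h \<le> (\<Sum>(i, j)\<in>{..n} \<times> {..n}. norm (coeff2 h i j) * R ^ (i + j))"
      unfolding wsum2_alt power_add
      using that by (intro sum_mono) (auto intro!: mult_left_mono mult_mono power_mono)
    also have "\<dots> \<le> M"
      unfolding M_def by (rule finite_sum_le_infsum[OF sm]) (use R in auto)
    finally show "wsum2 r s n h \<le> max M 1" by simp
  qed simp
  with R show ?thesis using that by blast
qed

lemma Cxy_common_radius:
  assumes "h \<in> Cxy" "k \<in> Cxy"
  obtains r M where "r > 0" "M > 0" "\<And>n. wsum2 r r n h \<le> M" "\<And>n. wsum2 r r n k \<le> M"
proof -
  obtain R1 where R1: "R1 > 0" "\<And>r s. 0 < r \<Longrightarrow> r \<le> R1 \<Longrightarrow> 0 < s \<Longrightarrow> s \<le> R1 \<Longrightarrow> \<exists>M>0. \<forall>n. wsum2 r s n h \<le> M"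
    using Cxy_imp_bounded[OF assms(1)] by blast
  obtain R2 where R2: "R2 > 0" "\<And>r s. 0 < r \<Longrightarrow> r \<le> R2 \<Longrightarrow> 0 < s \<Longrightarrow> s \<le> R2 \<Longrightarrow> \<exists>M>0. \<forall>n. wsum2 r s n k \<le> M"
    using Cxy_imp_bounded[OF assms(2)] by blast
  define r where "r = min R1 R2"
  obtain M1 where M1: "M1 > 0" "\<forall>n. wsum2 r r n h \<le> M1"
    using R1(2)[of r r] R1(1) R2(1) by (auto simp: r_def)
  obtain M2 where M2: "M2 > 0" "\<forall>n. wsum2 r r n k \<le> M2"
    using R2(2)[of r r] R1(1) R2(1) by (auto simp: r_def)
  show ?thesis
    by (rule that[of r "max M1 M2"]) (use M1 M2 R1(1) R2(1) in \<open>auto simp: r_def le_max_iff_disj\<close>)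
qed

lemma Cxy_iff_coeff_bound:
  "h \<in> Cxy \<longleftrightarrow> (\<exists>C R. C \<ge> 0 \<and> R > 0 \<and> (\<forall>i j. norm (coeff2 h i j) \<le> C * R ^ (i + j)))"
proof
  assume "h \<in> Cxy"
  then obtain r M where r: "r > 0" "M > 0" "\<And>n. wsum2 r r n h \<le> M"
    using Cxy_common_radius[of h h] by metis
  have "norm (coeff2 h i j) \<le> M * inverse r ^ (i + j)" for i j
    using coeff2_le_wsum2[of r r i "max i j" j h] r(1) r(3)[of "max i j"]
    by (simp add: field_simps power_add)
  then show "\<exists>C R. C \<ge> 0 \<and> R > 0 \<and> (\<forall>i j. norm (coeff2 h i j) \<le> C * R ^ (i + j))"
    using r by (intro exI[of _ M] exI[of _ "inverse r"]) auto
next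
  assume "\<exists>C R. C \<ge> 0 \<and> R > 0 \<and> (\<forall>i j. norm (coeff2 h i j) \<le> C * R ^ (i + j))"
  then obtain C R where C: "C \<ge> 0" "R > 0" "\<And>i j. norm (coeff2 h i j) \<le> C * R ^ (i + j)" by blast
  \<comment> \<open>Half of \<open>1 / R\<close>, so that both geometric series have ratio 1/2 and
    partial sums at most 2.\<close>
  define r where "r = inverse (2 * R)"
  have r: "r > 0" "R * r = 1 / 2" using C by (auto simp: r_def field_simps)
  have geo: "(\<Sum>i\<le>n. (1 / 2 :: real) ^ i) \<le> 2" for n
    unfolding lessThan_Suc_atMost[symmetric] by (subst sum_gp_strict) auto
  show "h \<in> Cxy"
  proof (rule bounded_imp_Cxy[OF r(1) r(1)])
    fix n
    have "wsum2 r r n h \<le> (\<Sum>(i, j)\<in>{..n} \<times> {..n}. C * ((1 / 2) ^ i * (1 / 2) ^ j))"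
      unfolding wsum2_alt
    proof (rule sum_mono, clarify)
      fix i j
      have "norm (coeff2 h i j) * (r ^ i * r ^ j) \<le> C * R ^ (i + j) * (r ^ i * r ^ j)"
        using C r by (intro mult_right_mono) auto
      also have "\<dots> = C * ((R * r) ^ i * (R * r) ^ j)"
        by (simp add: power_add power_mult_distrib)
      finally show "norm (coeff2 h i j) * (r ^ i * r ^ j) \<le> C * ((1 / 2) ^ i * (1 / 2) ^ j)"
        by (simp add: r(2))
    qed
    also have "\<dots> = C * ((\<Sum>i\<le>n. (1 / 2) ^ i) * (\<Sum>i\<le>n. (1 / 2) ^ i))"
      unfolding sum_product sum.cartesian_product by (simp add: sum_distrib_left case_prod_unfold)
    also have "\<dots> \<le> C * (2 * 2)"
      using C geo by (intro mult_left_mono mult_mono) (auto intro: sum_nonneg)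
    finally show "wsum2 r r n h \<le> C * (2 * 2)" .
  qed
qed

text \<open>The factor \<open>S ^ (i + j)\<close> absorbs the polynomial factors produced by
  derivatives; \<open>a\<close> and \<open>b\<close> account for the index shift.\<close>

lemma Cxy_dominated:
  assumes "h \<in> Cxy" "c \<ge> 0" "S > 0"
    and dom: "\<And>i j. norm (coeff2 k i j) \<le> c * S ^ (i + j) * norm (coeff2 h (i + a) (j + b))"
  shows "k \<in> Cxy"
proof -
  obtain C R where C: "C \<ge> 0" "R > 0" "\<And>i j. norm (coeff2 h i j) \<le> C * R ^ (i + j)"
    using assms(1) unfolding Cxy_iff_coeff_bound by blast
  have "norm (coeff2 k i j) \<le> (c * C * R ^ (a + b)) * (S * R) ^ (i + j)" for i j
  proof -
    have "norm (coeff2 k i j) \<le> c * S ^ (i + j) * (C * R ^ ((i + a) + (j + b)))"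
      using dom[of i j] C(3)[of "i + a" "j + b"] assms(2,3)
      by (meson mult_left_mono order_trans mult_nonneg_nonneg zero_le_power less_imp_le)
    also have "\<dots> = (c * C * R ^ (a + b)) * (S * R) ^ (i + j)"
      by (simp add: power_add power_mult_distrib)
    finally show ?thesis .
  qed
  then show ?thesis
    unfolding Cxy_iff_coeff_bound using C assms(2,3)
    by (intro exI[of _ "c * C * R ^ (a + b)"] exI[of _ "S * R"]) auto
qed

lemma Cxy_add: "h \<in> Cxy \<Longrightarrow> k \<in> Cxy \<Longrightarrow> h + k \<in> Cxy"
proof -
  assume "h \<in> Cxy" "k \<in> Cxy"
  then obtain r M where r: "r > 0" "M > 0" "\<And>n. wsum2 r r n h \<le> M" "\<And>n. wsum2 r r n k \<le> M"
    using Cxy_common_radius by metis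
  show ?thesis
  proof (rule bounded_imp_Cxy[OF r(1) r(1)])
    fix n
    show "wsum2 r r n (h + k) \<le> M + M"
      using wsum2_add[of r r n h k] r(1) r(3,4)[of n] by linarith
  qed
qed

lemma Cxy_mult: "h \<in> Cxy \<Longrightarrow> k \<in> Cxy \<Longrightarrow> h * k \<in> Cxy"
proof -
  assume "h \<in> Cxy" "k \<in> Cxy"
  then obtain r M where r: "r > 0" "M > 0" "\<And>n. wsum2 r r n h \<le> M" "\<And>n. wsum2 r r n k \<le> M"
    using Cxy_common_radius by metis
  show ?thesis
  proof (rule bounded_imp_Cxy[OF r(1) r(1)])
    fix n
    have "wsum2 r r n (h * k) \<le> wsum2 r r n h * wsum2 r r n k"
      using r(1) by (intro wsum2_mult) auto
    also have "\<dots> \<le> M * M"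
      using r by (intro mult_mono wsum2_nonneg) auto
    finally show "wsum2 r r n (h * k) \<le> M * M" .
  qed
qed

lemma coeff2_simps [simp]:
  "coeff2 0 i j = 0" "coeff2 (h + k) i j = coeff2 h i j + coeff2 k i j"
  "coeff2 (h - k) i j = coeff2 h i j - coeff2 k i j" "coeff2 (- h) i j = - coeff2 h i j"
  "coeff2 (sc c * h) i j = c * coeff2 h i j"
  "coeff2 (sc c) i j = (if i = 0 \<and> j = 0 then c else 0)"
  "coeff2 1 i j = (if i = 0 \<and> j = 0 then 1 else 0)"
  "coeff2 (fps_X ^ n) i j = (if i = 0 \<and> j = n then 1 else 0)"
  "coeff2 (fps_const fps_X) i j = (if i = 1 \<and> j = 0 then 1 else 0)"
  "coeff2 (dx h) i j = of_nat (i + 1) * coeff2 h (i + 1) j"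
  "coeff2 (dy h) i j = of_nat (j + 1) * coeff2 h i (j + 1)"
proof -
  show "coeff2 (dy h) i j = of_nat (j + 1) * coeff2 h i (j + 1)"
    unfolding coeff2_def dy_def fps_deriv_nth fps_of_nat[symmetric] fps_mult_left_const_nth ..
qed (auto simp: coeff2_def sc_def dx_def fps_X_power_nth)

lemma ps2_eqI: "(\<And>i j. coeff2 h i j = coeff2 k i j) \<Longrightarrow> h = k"
  by (simp add: coeff2_def fps_eq_iff)

lemma Cxy_simps [simp]:
  "0 \<in> Cxy" "1 \<in> Cxy" "sc c \<in> Cxy" "fps_X \<in> Cxy" "fps_const fps_X \<in> Cxy"
proof -
  show "sc c \<in> Cxy" for c
    unfolding Cxy_iff_coeff_bound
    by (intro exI[of _ "norm c"] exI[of _ 1]) auto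
  from this[of 0] this[of 1] show "0 \<in> Cxy" "1 \<in> Cxy" by simp_all
  show "fps_X \<in> Cxy"
    unfolding Cxy_iff_coeff_bound
    using coeff2_simps(8)[of 1] by (intro exI[of _ 1] exI[of _ 1]) auto
  show "fps_const fps_X \<in> Cxy"
    unfolding Cxy_iff_coeff_bound
    by (intro exI[of _ 1] exI[of _ 1]) auto
qed

lemma Cxy_uminus: "h \<in> Cxy \<Longrightarrow> - h \<in> Cxy"
  by (rule Cxy_dominated[of h 1 1 _ 0 0]) auto

lemma Cxy_diff: "h \<in> Cxy \<Longrightarrow> k \<in> Cxy \<Longrightarrow> h - k \<in> Cxy"
  using Cxy_add[of h "- k"] Cxy_uminus by simp

lemma Cxy_power: "h \<in> Cxy \<Longrightarrow> h ^ n \<in> Cxy"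
  by (induction n) (auto intro: Cxy_mult)

lemma Suc_le_two_power: "real (Suc i) \<le> 2 ^ (i + j)"
proof -
  have "real (Suc i) \<le> 2 ^ i"
    by (induction i) auto
  also have "\<dots> \<le> 2 ^ (i + j)" by (intro power_increasing) auto
  finally show ?thesis .
qed

lemma Cxy_dx: "h \<in> Cxy \<Longrightarrow> dx h \<in> Cxy"
  by (rule Cxy_dominated[of h 1 2 _ 1 0])
     (use Suc_le_two_power in \<open>auto simp: norm_mult simp del: of_nat_Suc intro!: mult_right_mono\<close>)

lemma Cxy_dy: "h \<in> Cxy \<Longrightarrow> dy h \<in> Cxy"
proof (rule Cxy_dominated[of h 1 2 _ 0 1])
  fix i j :: nat
  show "norm (coeff2 (dy h) i j) \<le> 1 * 2 ^ (i + j) * norm (coeff2 h (i + 0) (j + 1))"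
    using mult_right_mono[OF Suc_le_two_power[of j i], of "norm (coeff2 h i (Suc j))"]
    by (simp add: norm_mult add.commute del: of_nat_Suc)
qed auto

lemmas Cxy_intros = Cxy_add Cxy_mult Cxy_diff Cxy_uminus Cxy_power Cxy_dx Cxy_dy Cxy_simps

lemma subsp_Cxy [simp]: "subsp Cxy"
  by (auto simp: subsp_def intro: Cxy_intros)

subsection \<open>Weierstrass division\<close>

text \<open>Regularity in \<open>y\<close> in the sense of Weierstrass: \<open>f(0, y)\<close> has
  order exactly \<open>d\<close>.\<close>

definition yreg :: "nat \<Rightarrow> ps2 \<Rightarrow> bool" where
  "yreg d f \<longleftrightarrow> (\<forall>j<d. coeff2 f 0 j = 0) \<and> coeff2 f 0 d \<noteq> 0"

lemma coeff2_mult: "coeff2 (a * b) i j = (\<Sum>l\<le>j. \<Sum>k\<le>i. coeff2 a k l * coeff2 b (i - k) (j - l))"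
  by (simp add: coeff2_def fps_mult_nth atLeast0AtMost fps_sum_nth)

lemma coeff2_shift [simp]: "coeff2 (fps_shift d h) i j = coeff2 h i (j + d)"
  by (simp add: coeff2_def)

text \<open>The weight \<open>(d + 1) i + j\<close> makes the iteration \<open>w \<mapsto> g - high (w K)\<close> contracting for formal
  power series; the bound on \<open>wsum2\<close> makes it contracting for convergent ones.\<close>

lemma weierstrass_weight:
  assumes K: "\<And>j. j \<le> d \<Longrightarrow> coeff2 K 0 j = 0"
    and h: "\<And>i j. (d + 1) * i + j < n \<Longrightarrow> coeff2 h i j = 0"
    and ij: "(d + 1) * i + j < Suc n"
  shows "coeff2 (fps_shift d (h * K)) i j = 0"
proof -
  \<comment> \<open>For \<open>k = i\<close> only \<open>K(0, y)\<close> enters, whose order exceeds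
    \<open>d\<close>, so \<open>l < j\<close> and the weight drops. For \<open>k < i\<close> the
    weight drops by at least \<open>d + 1\<close> through \<open>x\<close>, which outweighs the
    \<open>d\<close> that division by \<open>y^d\<close> can add.\<close>
  have "coeff2 h k l * coeff2 K (i - k) (j + d - l) = 0" if "k \<le> i" "l \<le> j + d" for k l
  proof (cases "k = i")
    case True
    show ?thesis
    proof (cases "j \<le> l")
      case False
      then have "coeff2 h k l = 0" using ij True by (intro h) auto
      then show ?thesis by simp
    qed (use True K in auto)
  next
    case False
    then obtain e where e: "i = k + Suc e" using \<open>k \<le> i\<close> by (metis add_Suc_right le_neq_implies_less less_iff_Suc_add)
    have "(d + 1) * k + l < n"
      using ij e that(2) by (simp add: algebra_simps)
    then show ?thesis using h by simp
  qed
  then show ?thesis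
    by (auto simp: coeff2_mult intro!: sum.neutral)
qed

lemma wsum2_shift:
  assumes "r \<ge> 0" "s > 0"
  shows "wsum2 r s n (fps_shift d h) * s ^ d \<le> wsum2 r s (n + d) h"
proof -
  have "wsum2 r s n (fps_shift d h) * s ^ d
      = (\<Sum>(i, j)\<in>{..n} \<times> {..n}. norm (coeff2 h i (j + d)) * (r ^ i * s ^ (j + d)))"
    unfolding wsum2_alt by (simp add: sum_distrib_left power_add mult_ac case_prod_unfold)
  also have "\<dots> = (\<Sum>(i, j)\<in>(\<lambda>(i, j). (i, j + d)) ` ({..n} \<times> {..n}). norm (coeff2 h i j) * (r ^ i * s ^ j))"
    by (subst sum.reindex) (auto simp: inj_on_def intro!: sum.cong)
  also have "\<dots> \<le> wsum2 r s (n + d) h"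
    unfolding wsum2_alt using assms by (intro sum_mono2) auto
  finally show ?thesis .
qed

text \<open>With \<open>f = y^d + K\<close>, the terms of \<open>y\<close>-degree at least
  \<open>d\<close> in \<open>g - w f\<close> vanish iff \<open>w\<close> solves this equation, since
  \<open>fps_shift d\<close> divides those terms by \<open>y^d\<close>. Formal and convergent
  solutions come from the same iteration.\<close>

lemma weierstrass_fixed_point:
  assumes K: "\<And>j. j \<le> d \<Longrightarrow> coeff2 K 0 j = 0"
  shows "\<exists>w. w + fps_shift d (w * K) = fps_shift d g \<and> (K \<in> Cxy \<longrightarrow> g \<in> Cxy \<longrightarrow> w \<in> Cxy)"
proof -
  define G where "G = fps_shift d g"
  define W where "W n = ((\<lambda>w. G - fps_shift d (w * K)) ^^ n) 0" for n
  have W_Suc: "W (Suc n) = G - fps_shift d (W n * K)" and W_0: "W 0 = 0" for n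
    by (simp_all add: W_def)
  have step: "coeff2 (W (Suc n) - W n) i j = 0" if "(d + 1) * i + j < n" for i j n
    using that
  proof (induction n arbitrary: i j)
    case (Suc n)
    have "W (Suc (Suc n)) - W (Suc n) = - fps_shift d ((W (Suc n) - W n) * K)"
      by (simp add: W_Suc[of "Suc n"] W_Suc[of n] left_diff_distrib fps_shift_diff)
    moreover have "coeff2 (fps_shift d ((W (Suc n) - W n) * K)) i j = 0"
      by (rule weierstrass_weight[OF K Suc.IH Suc.prems])
    ultimately show ?case by simp
  qed simp
  \<comment> \<open>Each coefficient is constant along the iteration from index
    \<open>(d + 1) * i + j + 1\<close> on, so the limit can be taken coefficientwise.\<close>
  define w :: ps2 where "w = Abs_fps (\<lambda>j. Abs_fps (\<lambda>i. coeff2 (W (Suc ((d + 1) * i + j))) i j))"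
  have w_eq: "coeff2 w i j = coeff2 (W m) i j" if "(d + 1) * i + j < m" for i j m
    using that
  proof (induction m)
    case (Suc m)
    show ?case
    proof (cases "(d + 1) * i + j < m")
      case True
      then show ?thesis using Suc.IH step[OF True] by simp
    next
      case False
      then have "m = (d + 1) * i + j" using Suc.prems by simp
      then show ?thesis by (simp add: w_def coeff2_def)
    qed
  qed simp
  have "w + fps_shift d (w * K) = G"
  proof (rule ps2_eqI)
    fix i j
    define m where "m = Suc ((d + 1) * i + j)"
    have "coeff2 (fps_shift d ((w - W m) * K)) i j = 0"
      by (rule weierstrass_weight[OF K, where n = m]) (use w_eq in \<open>auto simp: m_def\<close>)
    moreover have "coeff2 w i j = coeff2 (W (Suc m)) i j"
      by (rule w_eq) (simp add: m_def)
    ultimately show "coeff2 (w + fps_shift d (w * K)) i j = coeff2 G i j"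
      by (simp add: W_Suc left_diff_distrib fps_shift_diff)
  qed
  moreover have "w \<in> Cxy" if KC: "K \<in> Cxy" and gC: "g \<in> Cxy"
  proof -
    have "G \<in> Cxy"
      unfolding G_def by (rule Cxy_dominated[OF gC, of 1 1 _ 0 d]) auto
    obtain R1 where R1: "R1 > 0" "\<And>r s. 0 < r \<Longrightarrow> r \<le> R1 \<Longrightarrow> 0 < s \<Longrightarrow> s \<le> R1 \<Longrightarrow> \<exists>M>0. \<forall>n. wsum2 r s n G \<le> M"
      using Cxy_imp_bounded[OF \<open>G \<in> Cxy\<close>] by blast
    obtain \<rho> B where \<rho>: "\<rho> > 0" "B > 0" "\<And>n. wsum2 \<rho> \<rho> n K \<le> B"
      using Cxy_common_radius[OF KC KC] by metis
    \<comment> \<open>The target is \<open>wsum2 r s n K \<le> s ^ d / 2\<close>, which offsets the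
      factor \<open>s ^ d\<close> lost in dividing by \<open>y^d\<close>. Terms without
      \<open>x\<close> have \<open>y\<close>-order at least \<open>d + 1\<close>, so their spare
      factor \<open>s\<close> is made small first; terms with \<open>x\<close> are then made small
      by choosing \<open>r\<close> depending on \<open>s\<close>.\<close>
    define s where "s = min (min R1 \<rho>) (\<rho> ^ (d + 1) / (2 * B))"
    have s: "s > 0" "s \<le> R1" "s \<le> \<rho>" "s \<le> \<rho> ^ (d + 1) / (2 * B)"
      using R1 \<rho> by (auto simp: s_def)
    define r where "r = min (min R1 \<rho>) (\<rho> * (s ^ d / (2 * B)))"
    have r: "r > 0" "r \<le> R1" "r \<le> \<rho>" "r \<le> \<rho> * (s ^ d / (2 * B))"
      using R1 \<rho> s by (auto simp: r_def)
    have Kb: "wsum2 r s n K \<le> s ^ d / 2" for n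
    proof -
      have term_le: "norm (coeff2 K i j) * (r ^ i * s ^ j) \<le> s ^ d / (2 * B) * (norm (coeff2 K i j) * (\<rho> ^ i * \<rho> ^ j))" for i j
      proof (cases "i = 0")
        case True
        show ?thesis
        proof (cases "j \<le> d")
          case False
          then obtain e where e: "j = e + (d + 1)"
            by (metis Suc_eq_plus1 add.commute less_eqE not_less_eq_eq)
          have "s ^ j = s ^ e * (s ^ d * s)"
            by (simp add: e power_add)
          also have "\<dots> \<le> \<rho> ^ e * (s ^ d * (\<rho> ^ (d + 1) / (2 * B)))"
            using s \<rho> by (intro mult_mono power_mono) auto
          also have "\<dots> = s ^ d / (2 * B) * \<rho> ^ j"
            by (simp add: e power_add)
          finally have "norm (coeff2 K i j) * s ^ j \<le> norm (coeff2 K i j) * (s ^ d / (2 * B) * \<rho> ^ j)"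
            by (rule mult_left_mono) simp
          then show ?thesis
            using True by (simp only: power_0 mult_1 mult.left_commute)
        qed (use True K in auto)
      next
        case False
        then obtain e where e: "i = Suc e" by (cases i) auto
        have "r ^ i * s ^ j = r * r ^ e * s ^ j" by (simp add: e)
        also have "\<dots> \<le> (\<rho> * (s ^ d / (2 * B))) * \<rho> ^ e * \<rho> ^ j"
          using r s \<rho> by (intro mult_mono power_mono) auto
        also have "\<dots> = s ^ d / (2 * B) * (\<rho> ^ i * \<rho> ^ j)"
          by (simp add: e)
        finally have "norm (coeff2 K i j) * (r ^ i * s ^ j)
            \<le> norm (coeff2 K i j) * (s ^ d / (2 * B) * (\<rho> ^ i * \<rho> ^ j))"
          by (rule mult_left_mono) simp
        then show ?thesis
          by (simp only: mult.left_commute)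
      qed
      have "wsum2 r s n K \<le> s ^ d / (2 * B) * wsum2 \<rho> \<rho> n K"
        unfolding wsum2_alt sum_distrib_left using term_le by (intro sum_mono) auto
      also have "\<dots> \<le> s ^ d / (2 * B) * B"
        using \<rho> s by (intro mult_left_mono) auto
      finally show ?thesis using \<rho> by simp
    qed
    obtain M where M: "M > 0" "\<And>n. wsum2 r s n G \<le> M"
      using R1(2)[of r s] r s by blast
    \<comment> \<open>The bound \<open>2 * M\<close> reproduces itself: an iteration step gives at
      most \<open>M\<close> from \<open>G\<close> plus half of \<open>2 * M\<close>.\<close>
    have Wb: "wsum2 r s n (W m) \<le> 2 * M" for m n
    proof (induction m arbitrary: n)
      case 0
      then show ?case using M by (simp add: W_0 wsum2_alt)
    next
      case (Suc m)
      have "wsum2 r s n (fps_shift d (W m * K)) * s ^ d \<le> wsum2 r s (n + d) (W m * K)"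
        using r s by (intro wsum2_shift) auto
      also have "\<dots> \<le> wsum2 r s (n + d) (W m) * wsum2 r s (n + d) K"
        using r s by (intro wsum2_mult) auto
      also have "\<dots> \<le> (2 * M) * (s ^ d / 2)"
        using Suc.IH Kb M r s by (intro mult_mono wsum2_nonneg) auto
      also have "\<dots> = M * s ^ d" by simp
      finally have 1: "wsum2 r s n (fps_shift d (W m * K)) \<le> M"
        using s by simp
      have "wsum2 r s n (W (Suc m)) \<le> wsum2 r s n G + wsum2 r s n (- fps_shift d (W m * K))"
        unfolding W_Suc diff_conv_add_uminus using r s by (intro wsum2_add) auto
      also have "wsum2 r s n (- fps_shift d (W m * K)) = wsum2 r s n (fps_shift d (W m * K))"
        by (simp add: wsum2_alt)
      finally show ?case using 1 M(2)[of n] by linarith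
    qed
    show ?thesis
    proof (rule bounded_imp_Cxy[OF r(1) s(1)])
      fix n
      \<comment> \<open>All indices in the box have weight at most \<open>(d + 1) * n + n\<close>,
        so this one iterate agrees with the limit there.\<close>
      have "wsum2 r s n w = wsum2 r s n (W (Suc ((d + 1) * n + n)))"
        unfolding wsum2_alt
      proof (rule sum.cong[OF refl], clarify)
        fix i j assume "i \<le> n" "j \<le> n"
        then have "coeff2 w i j = coeff2 (W (Suc ((d + 1) * n + n))) i j"
          by (intro w_eq) (auto intro!: le_imp_less_Suc add_mono mult_le_mono simp del: mult_Suc)
        then show "norm (coeff2 w i j) * (r ^ i * s ^ j) = norm (coeff2 (W (Suc ((d + 1) * n + n))) i j) * (r ^ i * s ^ j)"
          by simp
      qed
      also have "\<dots> \<le> 2 * M" by (rule Wb)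
      finally show "wsum2 r s n w \<le> 2 * M" .
    qed
  qed
  ultimately show ?thesis unfolding G_def by blast
qed

theorem weierstrass_division:
  assumes "yreg d f"
  obtains q where "\<And>j. j \<ge> d \<Longrightarrow> fps_nth (g - q * f) j = 0" "f \<in> Cxy \<Longrightarrow> g \<in> Cxy \<Longrightarrow> q \<in> Cxy"
proof -
  define c where "c = coeff2 f 0 d"
  have c: "c \<noteq> 0" "\<And>j. j < d \<Longrightarrow> coeff2 f 0 j = 0" using assms by (auto simp: yreg_def c_def)
  \<comment> \<open>Normalizing the coefficient of \<open>y^d\<close> to 1 leaves a \<open>K\<close>
    whose restriction to \<open>x = 0\<close> has order greater than \<open>d\<close>.\<close>
  define K where "K = sc (inverse c) * f - fps_X ^ d"
  have K: "coeff2 K 0 j = 0" if "j \<le> d" for j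
    using c that by (cases "j = d") (auto simp: K_def c_def)
  obtain w where w: "w + fps_shift d (w * K) = fps_shift d g" "K \<in> Cxy \<longrightarrow> g \<in> Cxy \<longrightarrow> w \<in> Cxy"
    using weierstrass_fixed_point[of d K g, OF K] by blast
  have "fps_shift d (g - sc (inverse c) * w * f) = 0"
  proof -
    have "sc (inverse c) * w * f = w * K + w * fps_X ^ d"
      by (simp add: K_def algebra_simps)
    then show ?thesis
      using w(1) by (simp add: fps_shift_diff fps_shift_add algebra_simps)
  qed
  then have "fps_nth (g - sc (inverse c) * w * f) j = 0" if "j \<ge> d" for j
    using that by (metis fps_shift_nth fps_zero_nth le_add_diff_inverse2)
  moreover have "sc (inverse c) * w \<in> Cxy" if "f \<in> Cxy" "g \<in> Cxy"
    using w(2) that unfolding K_def by (auto intro!: Cxy_intros)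
  ultimately show ?thesis using that by blast
qed

text \<open>Division of 1 by a series of \<open>y\<close>-order 0 has no remainder, and Weierstrass
  division supplies the convergence of the inverse.\<close>

lemma ps2_inverse:
  assumes "coeff2 f 0 0 \<noteq> 0"
  obtains u where "f * u = 1" "f \<in> Cxy \<longrightarrow> u \<in> Cxy"
proof -
  have "yreg 0 f" using assms by (simp add: yreg_def)
  then obtain q where q: "\<And>j. j \<ge> 0 \<Longrightarrow> fps_nth (1 - q * f) j = 0" "f \<in> Cxy \<Longrightarrow> 1 \<in> Cxy \<Longrightarrow> q \<in> Cxy"
    using weierstrass_division[where g = 1 and d = 0 and f = f] by metis
  have "1 - q * f = 0" using q(1) by (simp add: fps_eq_iff)
  then have "f * q = 1" by (simp add: mult.commute)
  then show ?thesis using that q(2) by simp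
qed

subsection \<open>Intersection numbers of formal power series\<close>

definition xx :: ps2 where "xx = fps_const fps_X"
abbreviation yy :: ps2 where "yy \<equiv> fps_X"

definition idl :: "ps2 set \<Rightarrow> ps2 \<Rightarrow> ps2 \<Rightarrow> ps2 set" where
  "idl R h k = {a * h + b * k | a b. a \<in> R \<and> b \<in> R}"

definition inum :: "ps2 \<Rightarrow> ps2 \<Rightarrow> enat" where
  "inum h k = reldim UNIV (idl UNIV h k)"

text \<open>What formal and convergent series have in common, so that the finiteness arguments run
  once for both rings.\<close>

definition local_ring :: "ps2 set \<Rightarrow> bool" where
  "local_ring R \<longleftrightarrow> subsp R \<and> 1 \<in> R \<and> (\<forall>a\<in>R. \<forall>b\<in>R. a * b \<in> R) \<and>
     (\<forall>a\<in>R. coeff2 a 0 0 \<noteq> 0 \<longrightarrow> (\<exists>u\<in>R. a * u = 1))"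

lemma local_ring_UNIV [simp]: "local_ring UNIV"
  unfolding local_ring_def by (auto intro: ps2_inverse)

lemma local_ring_Cxy [simp]: "local_ring Cxy"
  unfolding local_ring_def by (auto intro: Cxy_mult ps2_inverse)

lemma local_ringD:
  assumes "local_ring R"
  shows "subsp R" "1 \<in> R" "a \<in> R \<Longrightarrow> b \<in> R \<Longrightarrow> a * b \<in> R"
    "a \<in> R \<Longrightarrow> coeff2 a 0 0 \<noteq> 0 \<Longrightarrow> \<exists>u\<in>R. a * u = 1"
    "0 \<in> R" "a \<in> R \<Longrightarrow> b \<in> R \<Longrightarrow> a + b \<in> R" "sc c \<in> R"
proof -
  show 1: "subsp R" "1 \<in> R" "a \<in> R \<Longrightarrow> b \<in> R \<Longrightarrow> a * b \<in> R"
    "a \<in> R \<Longrightarrow> coeff2 a 0 0 \<noteq> 0 \<Longrightarrow> \<exists>u\<in>R. a * u = 1"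
    using assms by (auto simp: local_ring_def)
  show "0 \<in> R" "a \<in> R \<Longrightarrow> b \<in> R \<Longrightarrow> a + b \<in> R" "sc c \<in> R"
    using subspD[OF 1(1)] 1(2) subspD(3)[OF 1(1,2), of c] by auto
qed

lemma local_ring_power: "local_ring R \<Longrightarrow> a \<in> R \<Longrightarrow> a ^ n \<in> R"
  by (induction n) (auto intro: local_ringD)

lemma idlI: "a \<in> R \<Longrightarrow> b \<in> R \<Longrightarrow> w = a * h + b * k \<Longrightarrow> w \<in> idl R h k"
  unfolding idl_def by blast

lemma idl_add: "local_ring R \<Longrightarrow> v \<in> idl R h k \<Longrightarrow> w \<in> idl R h k \<Longrightarrow> v + w \<in> idl R h k"
proof -
  assume R: "local_ring R" and "v \<in> idl R h k" "w \<in> idl R h k"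
  then obtain a b c d where "v = a * h + b * k" "w = c * h + d * k" "a \<in> R" "b \<in> R" "c \<in> R" "d \<in> R"
    unfolding idl_def by blast
  then show ?thesis
    by (intro idlI[of "a + c" _ "b + d"] local_ringD[OF R]) (auto simp: algebra_simps)
qed

lemma idl_mult: "local_ring R \<Longrightarrow> r \<in> R \<Longrightarrow> v \<in> idl R h k \<Longrightarrow> r * v \<in> idl R h k"
proof -
  assume R: "local_ring R" and r: "r \<in> R" and "v \<in> idl R h k"
  then obtain a b where "v = a * h + b * k" "a \<in> R" "b \<in> R"
    unfolding idl_def by blast
  with r show ?thesis
    by (intro idlI[of "r * a" _ "r * b"] local_ringD[OF R]) (auto simp: algebra_simps)
qed

lemma idl_gen: "local_ring R \<Longrightarrow> h \<in> idl R h k" "local_ring R \<Longrightarrow> k \<in> idl R h k"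
  by (rule idlI[of 1 _ 0] idlI[of 0 _ 1]; auto intro: local_ringD)+

lemma subsp_idl: "local_ring R \<Longrightarrow> subsp (idl R h k)"
  unfolding subsp_def
proof (intro conjI ballI allI)
  assume R: "local_ring R"
  show "0 \<in> idl R h k" by (rule idlI[of 0 _ 0]) (auto intro: local_ringD[OF R])
  show "a + b \<in> idl R h k" if "a \<in> idl R h k" "b \<in> idl R h k" for a b
    using R that by (rule idl_add)
  show "sc c * a \<in> idl R h k" if "a \<in> idl R h k" for a c
    using R local_ringD(7)[OF R] that by (rule idl_mult)
qed

lemma idl_diff: "local_ring R \<Longrightarrow> v \<in> idl R h k \<Longrightarrow> w \<in> idl R h k \<Longrightarrow> v - w \<in> idl R h k"
  using subspD(5)[OF subsp_idl] by blast

lemma idl_subset: "local_ring R \<Longrightarrow> h' \<in> idl R h k \<Longrightarrow> k' \<in> idl R h k \<Longrightarrow> idl R h' k' \<subseteq> idl R h k"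
  by (auto simp: idl_def[of R h' k'] intro: idl_add idl_mult)

lemma idl_commute: "idl R h k = idl R k h"
  unfolding idl_def by (auto simp: add.commute) (metis add.commute)+

lemma ideal2_eq_idl: "ideal2 h k = idl Cxy h k"
  by (simp add: ideal2_def idl_def)

lemma coeff2_mult_00 [simp]: "coeff2 (a * b) 0 0 = coeff2 a 0 0 * coeff2 b 0 0"
  by (simp add: coeff2_mult)

lemma coeff2_power_00 [simp]: "coeff2 (a ^ n) 0 0 = coeff2 a 0 0 ^ n"
  by (induction n) auto

lemma coeff2_sum: "coeff2 (\<Sum>k\<in>A. f k) i j = (\<Sum>k\<in>A. coeff2 (f k) i j)"
  by (induction A rule: infinite_finite_induct) auto

section \<open>Comparison of formal and convergent intersection numbers\<close>

lemma unit_cancel: "v * u = 1 \<Longrightarrow> u * (z * v) = z" for u v z :: ps2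
proof -
  assume "v * u = 1"
  moreover have "u * (z * v) = z * (v * u)" by (simp only: mult_ac)
  ultimately show ?thesis by simp
qed

text \<open>The powers \<open>1, z, ..., z^n\<close> satisfy a relation modulo the ideal. Since
  \<open>z\<close> vanishes at the origin, the relation is the lowest power occurring in it times a
  unit.\<close>

lemma finite_dim_imp_power:
  assumes R: "local_ring R" and fin: "reldim R (idl R h k) \<noteq> \<infinity>" and z: "z \<in> R" "coeff2 z 0 0 = 0"
  obtains p where "z ^ p \<in> idl R h k"
proof -
  obtain n where n: "reldim R (idl R h k) = enat n" using fin by auto
  have "\<not> enat (Suc n) \<le> reldim R (idl R h k)" by (simp add: n)
  moreover have "\<forall>k<Suc n. z ^ k \<in> R" using z by (auto intro: local_ring_power[OF R])
  ultimately have "\<not> indep_mod (idl R h k) (Suc n) (\<lambda>k. z ^ k)"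
    unfolding reldim_ge_iff by metis
  then obtain c where c: "(\<Sum>i<Suc n. sc (c i) * z ^ i) \<in> idl R h k" "\<exists>i<Suc n. c i \<noteq> 0"
    unfolding indep_mod_def by blast
  define m where "m = (LEAST i. c i \<noteq> 0)"
  have m: "c m \<noteq> 0" "\<And>i. i < m \<Longrightarrow> c i = 0"
    unfolding m_def using c(2) LeastI[of "\<lambda>i. c i \<noteq> 0"] not_less_Least[of _ "\<lambda>i. c i \<noteq> 0"] by blast+
  have "m < Suc n" using c(2) m(2) by (meson not_less order.strict_trans1 linorder_cases)
  define v where "v = (\<Sum>i<Suc n - m. sc (c (i + m)) * z ^ i)"
  have "(\<Sum>i<Suc n. sc (c i) * z ^ i) = (\<Sum>i\<in>{m..<Suc n}. sc (c i) * z ^ i)"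
    using m(2) by (intro sum.mono_neutral_right) auto
  also have "\<dots> = (\<Sum>i\<in>{0..<Suc n - m}. sc (c (i + m)) * z ^ (i + m))"
    using sum.shift_bounds_nat_ivl[of "\<lambda>i. sc (c i) * z ^ i" 0 m "Suc n - m"] \<open>m < Suc n\<close> by simp
  also have "\<dots> = z ^ m * v"
    by (simp add: v_def sum_distrib_left power_add mult_ac atLeast0LessThan)
  finally have eq: "(\<Sum>i<Suc n. sc (c i) * z ^ i) = z ^ m * v" .
  have "v \<in> R"
    unfolding v_def using z by (intro subsp_sum local_ringD[OF R] local_ring_power[OF R]) auto
  moreover have "coeff2 v 0 0 \<noteq> 0"
  proof -
    have "coeff2 v 0 0 = (\<Sum>i<Suc n - m. c (i + m) * 0 ^ i)"
      by (simp add: v_def coeff2_sum z(2))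
    also have "\<dots> = (\<Sum>i\<in>{0}. c (i + m) * 0 ^ i)"
      using \<open>m < Suc n\<close> by (intro sum.mono_neutral_right) auto
    also have "\<dots> = c m" by simp
    finally show ?thesis using m(1) by simp
  qed
  ultimately obtain u where u: "u \<in> R" "v * u = 1"
    using local_ringD(4)[OF R] by blast
  have "u * (z ^ m * v) \<in> idl R h k"
    using idl_mult[OF R u(1)] c(1) eq by metis
  moreover have "u * (z ^ m * v) = z ^ m"
    by (rule unit_cancel[OF u(2)])
  ultimately show ?thesis using that by metis
qed

lemma coeff2_xpow_mult: "coeff2 (xx ^ n * u) i j = (if i < n then 0 else coeff2 u (i - n) j)"
  by (simp add: coeff2_def xx_def fps_X_power_mult_nth)

lemma coeff2_ypow_mult: "coeff2 (yy ^ n * u) i j = (if j < n then 0 else coeff2 u i (j - n))"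
  by (simp add: coeff2_def fps_X_power_mult_nth)

lemma xx_neq_0 [simp]: "xx \<noteq> 0" by (simp add: xx_def)

lemma xx_Cxy [simp]: "xx \<in> Cxy" by (simp add: xx_def)

lemma coeff2_xx_yy_00 [simp]: "coeff2 xx 0 0 = 0" "coeff2 yy 0 0 = 0"
  by (simp_all add: coeff2_def xx_def)

definition ps2_of :: "(nat \<Rightarrow> nat \<Rightarrow> complex) \<Rightarrow> ps2" where
  "ps2_of c = Abs_fps (\<lambda>j. Abs_fps (\<lambda>i. c i j))"

lemma coeff2_ps2_of [simp]: "coeff2 (ps2_of c) i j = c i j"
  by (simp add: coeff2_def ps2_of_def)

lemma xpow_dvd:
  assumes "\<And>i j. i < n \<Longrightarrow> coeff2 h i j = 0"
  obtains u where "h = xx ^ n * u" "h \<in> Cxy \<longrightarrow> u \<in> Cxy"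
proof -
  define u where "u = ps2_of (\<lambda>i j. coeff2 h (i + n) j)"
  have "h = xx ^ n * u"
    by (rule ps2_eqI) (use assms in \<open>auto simp: u_def coeff2_xpow_mult\<close>)
  moreover have "u \<in> Cxy" if "h \<in> Cxy"
    by (rule Cxy_dominated[OF that, of 1 1 _ n 0]) (auto simp: u_def)
  ultimately show ?thesis using that by blast
qed

lemma box_decompose:
  assumes "\<And>i j. i < n \<Longrightarrow> j < n \<Longrightarrow> coeff2 h i j = 0"
  obtains u w where "h = xx ^ n * u + yy ^ n * w" "h \<in> Cxy \<longrightarrow> u \<in> Cxy" "h \<in> Cxy \<longrightarrow> w \<in> Cxy"
proof -
  define w where "w = ps2_of (\<lambda>i j. coeff2 h i (j + n))"
  have w: "w \<in> Cxy" if "h \<in> Cxy"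
    by (rule Cxy_dominated[OF that, of 1 1 _ 0 n]) (auto simp: w_def)
  obtain u where u: "h - yy ^ n * w = xx ^ n * u" "h - yy ^ n * w \<in> Cxy \<longrightarrow> u \<in> Cxy"
    by (rule xpow_dvd[of n "h - yy ^ n * w"]) (use assms in \<open>auto simp: coeff2_ypow_mult w_def\<close>)
  show ?thesis
  proof (rule that[of u w])
    show "h = xx ^ n * u + yy ^ n * w" using u(1) by (simp add: algebra_simps)
    show "h \<in> Cxy \<longrightarrow> u \<in> Cxy" using u(2) w by (blast intro: Cxy_intros)
  qed (use w in blast)
qed

lemma coeff2_box_mult:
  assumes "i < n" "j < n" "\<And>i j. i < n \<Longrightarrow> j < n \<Longrightarrow> coeff2 a i j = 0"
  shows "coeff2 (a * h) i j = 0"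
  using assms by (auto simp: coeff2_mult intro!: sum.neutral)

definition trunc :: "nat \<Rightarrow> ps2 \<Rightarrow> ps2" where
  "trunc n h = ps2_of (\<lambda>i j. if i < n \<and> j < n then coeff2 h i j else 0)"

lemma trunc_Cxy [intro]: "trunc n h \<in> Cxy"
  unfolding Cxy_iff_coeff_bound
proof (intro exI conjI allI)
  fix i j
  define C where "C = (\<Sum>(i, j)\<in>{..<n} \<times> {..<n}. norm (coeff2 h i j))"
  have "C \<ge> 0" unfolding C_def by (intro sum_nonneg) auto
  then show "norm (coeff2 (trunc n h) i j) \<le> C * 1 ^ (i + j)"
    using member_le_sum[of "(i, j)" "{..<n} \<times> {..<n}" "\<lambda>(i, j). norm (coeff2 h i j)"]
    by (auto simp: trunc_def C_def)
  show "C \<ge> 0" by fact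
qed simp

lemma coeff2_diff_trunc: "i < n \<Longrightarrow> j < n \<Longrightarrow> coeff2 (h - trunc n h) i j = 0"
  by (simp add: trunc_def)

lemma power_mem_idl_le:
  assumes "local_ring R" "z \<in> R" "z ^ p \<in> idl R h k" "p \<le> q"
  shows "z ^ q \<in> idl R h k"
proof -
  have "z ^ (q - p) * z ^ p \<in> idl R h k"
    by (intro idl_mult local_ring_power assms)
  then show ?thesis using assms(4) by (simp flip: power_add)
qed

text \<open>Truncating the formal cofactors makes them polynomials, and the error has no
  coefficients in the \<open>n\<close> by \<open>n\<close> box, hence lies in
  \<open>(x^n, y^n)\<close> with convergent cofactors.\<close>

lemma formal_ideal_approx:
  assumes "v \<in> Cxy" "h \<in> Cxy" "k \<in> Cxy" "v \<in> idl UNIV h k"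
  obtains i u w where "i \<in> idl Cxy h k" "u \<in> Cxy" "w \<in> Cxy" "v = i + xx ^ n * u + yy ^ n * w"
proof -
  obtain a b where v: "v = a * h + b * k" using assms(4) unfolding idl_def by blast
  define i where "i = trunc n a * h + trunc n b * k"
  have i: "i \<in> idl Cxy h k" unfolding i_def by (rule idlI) auto
  have "i \<in> Cxy" unfolding i_def by (intro Cxy_add Cxy_mult trunc_Cxy assms)
  have "v - i = (a - trunc n a) * h + (b - trunc n b) * k"
    by (simp add: v i_def algebra_simps)
  then have "coeff2 (v - i) r s = 0" if "r < n" "s < n" for r s
    using coeff2_box_mult[OF that coeff2_diff_trunc] that by (simp del: coeff2_simps(3))
  then obtain u w where "v - i = xx ^ n * u + yy ^ n * w" "v - i \<in> Cxy \<longrightarrow> u \<in> Cxy" "v - i \<in> Cxy \<longrightarrow> w \<in> Cxy"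
    by (rule box_decompose)
  moreover have "v - i \<in> Cxy" using assms(1) \<open>i \<in> Cxy\<close> by (rule Cxy_diff)
  ultimately show ?thesis using that[OF i, of u w] by (simp add: algebra_simps)
qed

text \<open>Nakayama's lemma for the two generators \<open>x\<^sup>p\<close>, \<open>y\<^sup>p\<close>.\<close>
lemma formal_powers_imp_convergent:
  assumes hk: "h \<in> Cxy" "k \<in> Cxy" and x: "xx ^ p \<in> idl UNIV h k" and y: "yy ^ p \<in> idl UNIV h k"
  shows "xx ^ p \<in> idl Cxy h k" "yy ^ p \<in> idl Cxy h k"
proof -
  obtain i1 u1 w1 where 1: "i1 \<in> idl Cxy h k" "u1 \<in> Cxy" "w1 \<in> Cxy"
    "xx ^ p = i1 + xx ^ Suc p * u1 + yy ^ Suc p * w1"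
    using formal_ideal_approx[OF _ hk x] by (metis xx_Cxy Cxy_power)
  obtain i2 u2 w2 where 2: "i2 \<in> idl Cxy h k" "u2 \<in> Cxy" "w2 \<in> Cxy"
    "yy ^ p = i2 + xx ^ Suc p * u2 + yy ^ Suc p * w2"
    using formal_ideal_approx[OF _ hk y] by (metis Cxy_simps(4) Cxy_power)
  \<comment> \<open>The powers \<open>x^p\<close> and \<open>y^p\<close> solve a linear system with
    right-hand sides \<open>i1\<close> and \<open>i2\<close> in the ideal; \<open>D\<close> is its
    determinant, a unit with constant term 1, and Cramer's rule gives both claims.\<close>
  define D where "D = (1 - xx * u1) * (1 - yy * w2) - (yy * w1) * (xx * u2)"
  have C: "1 - xx * u1 \<in> Cxy" "1 - yy * w2 \<in> Cxy" "yy * w1 \<in> Cxy" "xx * u2 \<in> Cxy" "D \<in> Cxy"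
    unfolding D_def by (intro Cxy_diff Cxy_mult Cxy_simps xx_Cxy 1(2,3) 2(2,3))+
  have "coeff2 D 0 0 \<noteq> 0" by (simp add: D_def)
  then obtain u where u: "D * u = 1" "D \<in> Cxy \<longrightarrow> u \<in> Cxy" by (rule ps2_inverse)
  have i1: "i1 = xx ^ p * (1 - xx * u1) - yy ^ p * (yy * w1)"
    using 1(4) by (simp add: algebra_simps)
  have i2: "i2 = yy ^ p * (1 - yy * w2) - xx ^ p * (xx * u2)"
    using 2(4) by (simp add: algebra_simps)
  have "u * ((1 - yy * w2) * i1 + (yy * w1) * i2) \<in> idl Cxy h k"
    by (intro idl_mult idl_add local_ring_Cxy 1(1) 2(1) C u(2)[rule_format, OF C(5)])
  moreover have "(1 - yy * w2) * i1 + (yy * w1) * i2 = D * xx ^ p"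
    unfolding i1 i2 D_def by (simp add: algebra_simps)
  moreover have "u * (D * xx ^ p) = xx ^ p"
    using unit_cancel[OF u(1), of "xx ^ p"] by (simp only: mult.commute)
  ultimately show "xx ^ p \<in> idl Cxy h k" by metis
  have "u * ((xx * u2) * i1 + (1 - xx * u1) * i2) \<in> idl Cxy h k"
    by (intro idl_mult idl_add local_ring_Cxy 1(1) 2(1) C u(2)[rule_format, OF C(5)])
  moreover have "(xx * u2) * i1 + (1 - xx * u1) * i2 = D * yy ^ p"
    unfolding i1 i2 D_def by (simp add: algebra_simps)
  moreover have "u * (D * yy ^ p) = yy ^ p"
    using unit_cancel[OF u(1), of "yy ^ p"] by (simp only: mult.commute)
  ultimately show "yy ^ p \<in> idl Cxy h k" by metis
qed

lemma finite_dim_imp_powers: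
  assumes R: "local_ring R" "xx \<in> R" "yy \<in> R" and fin: "reldim R (idl R h k) \<noteq> \<infinity>"
  obtains p where "xx ^ p \<in> idl R h k" "yy ^ p \<in> idl R h k"
proof -
  obtain p where p: "xx ^ p \<in> idl R h k"
    using finite_dim_imp_power[OF R(1) fin R(2)] by auto
  obtain q where q: "yy ^ q \<in> idl R h k"
    using finite_dim_imp_power[OF R(1) fin R(3)] by auto
  show ?thesis
    by (rule that[of "max p q"]) (rule power_mem_idl_le[OF R(1,2) p] power_mem_idl_le[OF R(1,3) q]; simp)+
qed

text \<open>As soon as one of the two dimensions is finite, both ideals contain powers of
  \<open>x\<close> and \<open>y\<close>. Then every class has a polynomial representative, and
  formal membership of a convergent series implies convergent membership. Otherwise both numbers are
  infinite.\<close>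

theorem intnum_eq_inum:
  assumes hk: "h \<in> Cxy" "k \<in> Cxy"
  shows "intnum h k = inum h k"
proof -
  have eq: "reldim Cxy (idl Cxy h k) = reldim UNIV (idl UNIV h k)"
    if x: "xx ^ p \<in> idl Cxy h k" and y: "yy ^ p \<in> idl Cxy h k" for p
  proof (rule reldim_iso[where \<phi> = "\<lambda>x. x"])
    have sub: "idl Cxy h k \<subseteq> idl UNIV h k" unfolding idl_def by blast
    show "\<exists>v\<in>Cxy. w - v \<in> idl UNIV h k" for w
    proof (rule bexI[OF _ trunc_Cxy])
      obtain a b where ab: "w - trunc p w = xx ^ p * a + yy ^ p * b"
        using box_decompose[OF coeff2_diff_trunc] by metis
      have "a * xx ^ p + b * yy ^ p \<in> idl UNIV h k"
        using x y sub by (intro idl_add idl_mult) auto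
      then show "w - trunc p w \<in> idl UNIV h k"
        by (simp add: ab mult.commute)
    qed
    show "v \<in> idl UNIV h k \<longleftrightarrow> v \<in> idl Cxy h k" if v: "v \<in> Cxy" for v
    proof
      assume "v \<in> idl UNIV h k"
      then obtain i u w where "i \<in> idl Cxy h k" "u \<in> Cxy" "w \<in> Cxy" "v = i + xx ^ p * u + yy ^ p * w"
        using formal_ideal_approx[OF v hk] by metis
      moreover from this have "i + u * xx ^ p + w * yy ^ p \<in> idl Cxy h k"
        using x y by (intro idl_add idl_mult) auto
      ultimately show "v \<in> idl Cxy h k"
        by (simp add: mult.commute)
    qed (use sub in auto)
  qed (auto intro: subsp_idl)
  show ?thesis
  proof (cases "reldim Cxy (idl Cxy h k) = \<infinity> \<and> inum h k = \<infinity>")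
    case False
    then consider "reldim Cxy (idl Cxy h k) \<noteq> \<infinity>" | "reldim UNIV (idl UNIV h k) \<noteq> \<infinity>"
      by (auto simp: inum_def)
    then obtain p where "xx ^ p \<in> idl Cxy h k" "yy ^ p \<in> idl Cxy h k"
    proof cases
      case 1
      then show ?thesis using finite_dim_imp_powers[of Cxy h k] that by auto
    next
      case 2
      then obtain p where "xx ^ p \<in> idl UNIV h k" "yy ^ p \<in> idl UNIV h k"
        using finite_dim_imp_powers[of UNIV h k] by auto
      then show ?thesis using formal_powers_imp_convergent[OF hk] that by blast
    qed
    then show ?thesis
      using eq by (simp add: intnum_def quotdim_eq_reldim ideal2_eq_idl inum_def)
  qed (simp add: intnum_def quotdim_eq_reldim ideal2_eq_idl)
qed

section \<open>Additivity and first values of the intersection number\<close>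

lemma inum_commute: "inum h k = inum k h"
  by (simp add: inum_def idl_commute)

lemma inum_antimono: "h' \<in> idl UNIV h k \<Longrightarrow> k' \<in> idl UNIV h k \<Longrightarrow> inum h k \<le> inum h' k'"
  unfolding inum_def by (intro reldim_mono idl_subset) auto

lemma inum_cong: "h' \<in> idl UNIV h k \<Longrightarrow> k' \<in> idl UNIV h k \<Longrightarrow> h \<in> idl UNIV h' k' \<Longrightarrow> k \<in> idl UNIV h' k' \<Longrightarrow> inum h k = inum h' k'"
  by (intro antisym inum_antimono)

lemma inum_add_multiple: "inum h (k + c * h) = inum h k"
  by (rule inum_cong) (auto intro: idlI[of 0 _ 1] idlI[of 1 _ 0] idlI[of c _ 1] idlI[of "- c" _ 1])

text \<open>In other words, \<open>a\<close> is not a zero divisor modulo \<open>h\<close>. Unique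
  factorization is avoided: \<open>x^p z = P h\<close> and \<open>y^p z = Q h\<close> give
  \<open>y^p P = x^p Q\<close>, and comparing coefficients shows that \<open>x^p\<close> divides
  \<open>P\<close>.\<close>

lemma colon_principal:
  assumes fin: "inum h a \<noteq> \<infinity>" and eq: "a * z = \<alpha> * h"
  obtains \<gamma> where "z = \<gamma> * h"
proof -
  obtain p where x: "xx ^ p \<in> idl UNIV h a" and y: "yy ^ p \<in> idl UNIV h a"
    using finite_dim_imp_powers[of UNIV h a] fin by (auto simp: inum_def)
  have mem: "\<exists>q. w * z = q * h" if "w \<in> idl UNIV h a" for w
  proof -
    obtain b c where "w = b * h + c * a" using \<open>w \<in> _\<close> unfolding idl_def by blast
    then have "w * z = (b * z + c * \<alpha>) * h" using eq by (simp add: algebra_simps)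
    then show ?thesis by blast
  qed
  obtain P where P: "xx ^ p * z = P * h" using mem[OF x] by blast
  obtain Q where Q: "yy ^ p * z = Q * h" using mem[OF y] by blast
  show ?thesis
  proof (cases "h = 0")
    case True
    with P have "z = 0" by simp
    then show ?thesis using that[of 0] by simp
  next
    case False
    have "(yy ^ p * P) * h = (xx ^ p * Q) * h"
      unfolding mult.assoc P[symmetric] Q[symmetric] by (simp only: mult.left_commute)
    then have "yy ^ p * P = xx ^ p * Q" using False by simp
    then have "coeff2 P i j = 0" if "i < p" for i j
      using that coeff2_ypow_mult[of p P i "j + p"] coeff2_xpow_mult[of p Q i "j + p"] by simp
    then obtain \<gamma> where "P = xx ^ p * \<gamma>" by (rule xpow_dvd) blast+
    then have "xx ^ p * z = xx ^ p * (\<gamma> * h)" using P by (simp add: mult.assoc)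
    then have "z = \<gamma> * h" by simp
    then show ?thesis by (rule that)
  qed
qed

text \<open>Multiplication by \<open>a\<close> maps the ring modulo \<open>(h, b)\<close>
  isomorphically onto \<open>(h, a)\<close> modulo \<open>(h, a b)\<close>, injectivity being
  \<open>colon_principal\<close>. If i(h, a) is infinite, so is the left side by
  monotonicity.\<close>

theorem inum_mult: "inum h (a * b) = inum h a + inum h b"
proof -
  have "inum h a \<le> inum h (a * b)"
    by (rule inum_antimono) (auto intro: idlI[of 1 _ 0] idlI[of 0 _ b])
  moreover have "inum h b \<le> inum h (a * b)"
    by (rule inum_antimono) (auto intro: idlI[of 1 _ 0] idlI[of 0 _ a])
  moreover have "inum h (a * b) = inum h a + inum h b" if fin: "inum h a \<noteq> \<infinity>"
  proof -
    have "inum h (a * b) = inum h a + reldim (idl UNIV h a) (idl UNIV h (a * b))"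
      unfolding inum_def
    proof (rule reldim_add)
      show "idl UNIV h (a * b) \<subseteq> idl UNIV h a"
        by (intro idl_subset idl_gen idlI[of 0 _ b]) auto
    qed (auto intro: subsp_idl)
    also have "reldim (idl UNIV h a) (idl UNIV h (a * b)) = inum h b"
      unfolding inum_def
    proof (rule reldim_iso[symmetric, where \<phi> = "\<lambda>v. a * v"])
      show "a * v \<in> idl UNIV h a" for v by (rule idlI[of 0 _ v]) auto
      show "\<exists>v\<in>UNIV. w - a * v \<in> idl UNIV h (a * b)" if w: "w \<in> idl UNIV h a" for w
      proof -
        obtain c v where "w = c * h + v * a" using w unfolding idl_def by blast
        then have "w - a * v = c * h + 0 * (a * b)" by (simp add: algebra_simps)
        then show ?thesis by (intro bexI[of _ v] idlI[of c _ 0]) auto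
      qed
      show "a * v \<in> idl UNIV h (a * b) \<longleftrightarrow> v \<in> idl UNIV h b" for v
      proof
        assume "a * v \<in> idl UNIV h (a * b)"
        then obtain c d where "a * v = c * h + d * (a * b)" unfolding idl_def by blast
        then have "a * (v - d * b) = c * h" by (simp add: algebra_simps)
        then obtain \<gamma> where "v - d * b = \<gamma> * h" using colon_principal[OF fin] by blast
        then show "v \<in> idl UNIV h b" by (intro idlI[of \<gamma> _ d]) (auto simp: algebra_simps)
      next
        assume "v \<in> idl UNIV h b"
        then obtain c d where "v = c * h + d * b" unfolding idl_def by blast
        then show "a * v \<in> idl UNIV h (a * b)" by (intro idlI[of "a * c" _ d]) (auto simp: algebra_simps)
      qed
    qed (auto intro: subsp_idl simp: algebra_simps)
    finally show ?thesis .
  qed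
  ultimately show ?thesis by (cases "inum h a = \<infinity>") auto
qed

lemma inum_mult_left: "inum (a * b) h = inum a h + inum b h"
  using inum_mult[of h a b] by (simp add: inum_commute)

lemma inum_unit: "coeff2 u 0 0 \<noteq> 0 \<Longrightarrow> inum h u = 0"
proof -
  assume "coeff2 u 0 0 \<noteq> 0"
  then obtain v where v: "u * v = 1" by (rule ps2_inverse)
  have "idl UNIV h u = UNIV"
  proof safe
    fix w show "w \<in> idl UNIV h u"
      by (rule idlI[of 0 _ "w * v"]) (use unit_cancel[OF v, of w] in \<open>auto simp: mult_ac\<close>)
  qed auto
  then show ?thesis using reldim_refl[of UNIV] by (simp add: inum_def)
qed

lemma inum_mult_unit: "coeff2 u 0 0 \<noteq> 0 \<Longrightarrow> inum h (u * k) = inum h k"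
  by (simp add: inum_mult inum_unit)

lemma inum_power: "inum h (k ^ n) = enat n * inum h k"
proof (induction n)
  case 0
  show ?case by (simp add: inum_unit zero_enat_def[symmetric])
next
  case (Suc n)
  then show ?case
    by (cases "inum h k") (auto simp: inum_mult times_enat_def algebra_simps split: if_splits)
qed

lemma mem_max_ideal:
  assumes "coeff2 h 0 0 = 0"
  shows "h \<in> idl UNIV xx yy"
proof -
  have "coeff2 h i j = 0" if "i < 1" "j < 1" for i j
    using assms that by simp
  then obtain u w where "h = xx ^ 1 * u + yy ^ 1 * w"
    by (rule box_decompose)
  then show ?thesis by (intro idlI[of u _ w]) (auto simp: mult.commute)
qed

lemma inum_xx_yy: "inum xx yy = 1"
proof -
  have "inum xx yy \<le> enat 1"
    unfolding inum_def
  proof (rule reldim_le_spanning[OF subsp_idl], simp)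
    show "spanning_mod UNIV (idl UNIV xx yy) 1 (\<lambda>_. 1)"
      unfolding spanning_mod_def
      by (intro ballI exI[of _ "\<lambda>_. coeff2 w 0 0" for w] mem_max_ideal) simp
  qed
  moreover have "indep_mod (idl UNIV xx yy) 1 (\<lambda>_. 1)"
    unfolding indep_mod_def
  proof (intro allI impI)
    fix c :: "nat \<Rightarrow> complex" and k :: nat
    assume "(\<Sum>k<1. sc (c k) * 1) \<in> idl UNIV xx yy" "k < 1"
    then obtain a b where "sc (c 0) = a * xx + b * yy" "k = 0" unfolding idl_def by auto
    then have "coeff2 (sc (c 0)) 0 0 = coeff2 (a * xx + b * yy) 0 0" by metis
    then show "c k = 0" using \<open>k = 0\<close> by simp
  qed
  then have "enat 1 \<le> inum xx yy"
    unfolding inum_def reldim_ge_iff by (intro exI[of _ "\<lambda>_. 1"]) auto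
  ultimately show ?thesis by (simp add: one_enat_def)
qed

lemma inum_ge_1:
  assumes "coeff2 h 0 0 = 0" "coeff2 k 0 0 = 0"
  shows "inum h k \<ge> 1"
proof -
  have "inum xx yy \<le> inum h k"
    using assms by (intro inum_antimono mem_max_ideal)
  then show ?thesis by (simp add: inum_xx_yy)
qed

text \<open>A single non-unit cannot divide both \<open>x^p\<close> and \<open>y^p\<close>: the
  coefficient comparison of \<open>colon_principal\<close> would exhibit an inverse of
  \<open>h\<close>.\<close>

lemma inum_0_right:
  assumes "coeff2 h 0 0 = 0"
  shows "inum h 0 = \<infinity>"
proof (rule ccontr)
  assume "inum h 0 \<noteq> \<infinity>"
  then obtain p where p: "xx ^ p \<in> idl UNIV h 0" "yy ^ p \<in> idl UNIV h 0"
    using finite_dim_imp_powers[of UNIV h 0] by (auto simp: inum_def)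
  then obtain a b where ab: "xx ^ p = a * h" "yy ^ p = b * h" unfolding idl_def by auto
  have "xx ^ p \<noteq> 0" by simp
  then have "h \<noteq> 0" using ab by force
  have "(yy ^ p * a) * h = (xx ^ p * b) * h" using ab by (simp add: algebra_simps)
  then have "yy ^ p * a = xx ^ p * b" using \<open>h \<noteq> 0\<close> by simp
  then have "coeff2 a i j = 0" if "i < p" for i j
    using that coeff2_ypow_mult[of p a i "j + p"] coeff2_xpow_mult[of p b i "j + p"] by simp
  then obtain c where c: "a = xx ^ p * c" by (rule xpow_dvd) blast+
  have "xx ^ p * 1 = xx ^ p * (c * h)"
    by (subst mult.assoc[symmetric], subst c[symmetric]) (simp add: ab(1))
  then have "1 = c * h" by (subst (asm) mult_left_cancel) simp_all
  then have "coeff2 1 0 0 = coeff2 (c * h) 0 0" by metis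
  then show False using assms by simp
qed

section \<open>Finiteness for coprime germs\<close>

lemma powers_imp_inum_finite:
  assumes "xx ^ p \<in> idl UNIV h k" "yy ^ q \<in> idl UNIV h k"
  shows "inum h k \<noteq> \<infinity>"
proof -
  have "inum h k \<le> inum (xx ^ p) (yy ^ q)"
    by (rule inum_antimono) (use assms in auto)
  also have "inum (xx ^ p) (yy ^ q) = enat q * (enat p * 1)"
    by (simp only: inum_power inum_commute[of "xx ^ p"] inum_commute[of yy] inum_xx_yy)
  finally show ?thesis by (auto simp: one_enat_def dest: enat_ile)
qed

text \<open>Splitting off the largest power of \<open>x\<close> makes any nonzero series regular in
  \<open>y\<close>, so no change of coordinates is needed. The last conclusion preserves bounds on
  the \<open>y\<close>-degree.\<close>

lemma xx_part:
  assumes "r \<noteq> 0"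
  obtains k r1 e where "r = xx ^ k * r1" "yreg e r1" "r \<in> Cxy \<longrightarrow> r1 \<in> Cxy"
    "\<And>j. fps_nth r j = 0 \<Longrightarrow> fps_nth r1 j = 0"
proof -
  have "\<exists>k j. coeff2 r k j \<noteq> 0" using assms ps2_eqI[of r 0] by auto
  define k where "k = (LEAST k. \<exists>j. coeff2 r k j \<noteq> 0)"
  have k: "\<exists>j. coeff2 r k j \<noteq> 0" "\<And>i j. i < k \<Longrightarrow> coeff2 r i j = 0"
    unfolding k_def using LeastI_ex[OF \<open>\<exists>k j. coeff2 r k j \<noteq> 0\<close>] not_less_Least by blast+
  obtain r1 where r1: "r = xx ^ k * r1" "r \<in> Cxy \<longrightarrow> r1 \<in> Cxy"
    using xpow_dvd[of k r] k(2) by metis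
  have cf: "coeff2 r1 i j = coeff2 r (i + k) j" for i j
    by (subst r1(1)) (simp add: coeff2_xpow_mult)
  define e where "e = (LEAST e. coeff2 r1 0 e \<noteq> 0)"
  have "\<exists>j. coeff2 r1 0 j \<noteq> 0" using k(1) by (simp add: cf)
  then have "yreg e r1"
    unfolding yreg_def e_def using LeastI_ex[of "\<lambda>e. coeff2 r1 0 e \<noteq> 0"] not_less_Least by blast
  moreover have "fps_nth r1 j = 0" if "fps_nth r j = 0" for j
  proof (rule fps_ext)
    fix i show "fps_nth (fps_nth r1 j) i = fps_nth 0 i"
      using cf[of i j] that by (simp add: coeff2_def)
  qed
  ultimately show ?thesis using r1 that by blast
qed

text \<open>The ideal \<open>S\<close> of all \<open>h\<close> with \<open>x\<^sup>k h \<in> (f, g)\<close> for some \<open>k\<close> is principal: an element of least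
  \<open>y\<close>-order divides all others by Weierstrass division.\<close>
lemma coprime_imp_xpow:
  assumes f: "f \<in> Cxy" "yreg d f" and g: "g \<in> Cxy" and cop: "coprime2 f g"
  obtains k where "xx ^ k \<in> idl Cxy f g"
proof -
  define S where "S = {h \<in> Cxy. \<exists>k. xx ^ k * h \<in> idl Cxy f g}"
  have fS: "f \<in> S" and gS: "g \<in> S"
    using f g idl_gen[of Cxy] by (auto simp: S_def intro!: exI[of _ 0])
  define e where "e = (LEAST e. \<exists>p\<in>S. yreg e p)"
  have ex: "\<exists>e. \<exists>p\<in>S. yreg e p" using fS f(2) by blast
  obtain p where p: "p \<in> S" "yreg e p" using LeastI_ex[OF ex] unfolding e_def by blast
  have least: "\<not> yreg e' p'" if "p' \<in> S" "e' < e" for p' e'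
    using that not_less_Least unfolding e_def by blast
  have dvd: "dvd2 p h" if h: "h \<in> S" for h
  proof -
    have C: "p \<in> Cxy" "h \<in> Cxy" using p h by (auto simp: S_def)
    obtain q where q: "\<And>j. j \<ge> e \<Longrightarrow> fps_nth (h - q * p) j = 0" "q \<in> Cxy"
      using weierstrass_division[OF p(2), of h] C by metis
    define r where "r = h - q * p"
    have "r \<in> Cxy" unfolding r_def using C q(2) by (auto intro!: Cxy_intros)
    obtain k where k: "xx ^ k * r \<in> idl Cxy f g"
    proof -
      obtain k1 k2 where k12: "xx ^ k1 * h \<in> idl Cxy f g" "xx ^ k2 * p \<in> idl Cxy f g"
        using p h by (auto simp: S_def)
      have "xx ^ k2 * (xx ^ k1 * h) - (q * xx ^ k1) * (xx ^ k2 * p) \<in> idl Cxy f g"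
        by (intro idl_diff idl_mult[OF _ _ k12(1)] idl_mult[OF _ _ k12(2)]) (auto intro!: Cxy_intros q(2))
      moreover have "xx ^ k2 * (xx ^ k1 * h) - (q * xx ^ k1) * (xx ^ k2 * p) = xx ^ (k1 + k2) * r"
        by (simp add: r_def algebra_simps power_add)
      ultimately show ?thesis using that by metis
    qed
    \<comment> \<open>The remainder has \<open>y\<close>-degree less than \<open>e\<close>; stripped
      of powers of \<open>x\<close> it would be an element of \<open>S\<close> of
      \<open>y\<close>-order below the minimum.\<close>
    have "r = 0"
    proof (rule ccontr)
      assume "r \<noteq> 0"
      then obtain m r1 e' where r1: "r = xx ^ m * r1" "yreg e' r1" "r1 \<in> Cxy"
        "\<And>j. fps_nth r j = 0 \<Longrightarrow> fps_nth r1 j = 0"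
        using xx_part[of r] \<open>r \<in> Cxy\<close> by metis
      have "e' < e"
      proof (rule ccontr)
        assume "\<not> e' < e"
        then have "fps_nth r1 e' = 0" using q(1) r1(4) by (simp add: r_def)
        then show False using r1(2) by (simp add: yreg_def coeff2_def)
      qed
      moreover have "xx ^ (k + m) * r1 \<in> idl Cxy f g"
        using k r1(1) by (simp add: power_add mult.assoc)
      ultimately show False using least[of r1 e'] r1(2,3) by (auto simp: S_def)
    qed
    then have "h = p * q" by (simp add: r_def mult.commute)
    then show ?thesis using q(2) by (auto simp: dvd2_def)
  qed
  have pC: "p \<in> Cxy" using p by (simp add: S_def)
  then have "unit2 p"
    using cop dvd[OF fS] dvd[OF gS] by (auto simp: coprime2_def)
  then obtain u where u: "u \<in> Cxy" "p * u = 1" by (auto simp: unit2_def)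
  obtain k where "xx ^ k * p \<in> idl Cxy f g" using p(1) by (auto simp: S_def)
  then have "u * (xx ^ k * p) \<in> idl Cxy f g" by (rule idl_mult[OF local_ring_Cxy u(1)])
  moreover have "u * (xx ^ k * p) = xx ^ k" by (rule unit_cancel[OF u(2)])
  ultimately show ?thesis using that by metis
qed

text \<open>Modulo \<open>f\<close>, the power \<open>y^d\<close> is divisible by \<open>x\<close>;
  hence a power of \<open>x\<close> in an ideal containing \<open>f\<close> yields a power of
  \<open>y\<close>.\<close>

lemma yreg_ypow:
  assumes "yreg d f"
  obtains a u where "yy ^ d = u * f + xx * a"
proof -
  have "coeff2 (fps_shift d f) 0 0 \<noteq> 0" using assms by (simp add: yreg_def)
  then obtain u where u: "fps_shift d f * u = 1" by (rule ps2_inverse)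
  have "coeff2 (f - yy ^ d * fps_shift d f) i j = 0" if "i < 1" for i j
    using assms that by (auto simp: coeff2_ypow_mult yreg_def)
  then obtain b where b: "f - yy ^ d * fps_shift d f = xx ^ 1 * b" by (rule xpow_dvd) blast+
  then have e: "yy ^ d * fps_shift d f = f - xx * b" by (simp add: algebra_simps)
  have "yy ^ d = (yy ^ d * fps_shift d f) * u" using u by (simp add: mult.assoc)
  also have "\<dots> = (f - xx * b) * u" by (simp only: e)
  also have "\<dots> = u * f + xx * (- b * u)" by (simp add: algebra_simps)
  finally show ?thesis by (rule that)
qed

lemma coprime_yreg_imp_finite:
  assumes f: "f \<in> Cxy" "yreg d f" and g: "g \<in> Cxy" and cop: "coprime2 f g"
  shows "inum f g \<noteq> \<infinity>"
proof -
  obtain k where "xx ^ k \<in> idl Cxy f g" using coprime_imp_xpow[OF assms] by blast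
  then have k: "xx ^ k \<in> idl UNIV f g" unfolding idl_def by blast
  obtain a u where au: "yy ^ d = u * f + xx * a" using yreg_ypow[OF f(2)] by blast
  have "yy ^ d - xx * a dvd (yy ^ d) ^ k - (xx * a) ^ k"
    by (metis dvdI power_diff_sumr2)
  then obtain b where "(yy ^ d) ^ k - (xx * a) ^ k = u * f * b"
    unfolding au by (auto simp: dvd_def)
  then have "yy ^ (d * k) = (u * b) * f + a ^ k * xx ^ k"
    by (simp add: power_mult power_mult_distrib algebra_simps)
  then have "yy ^ (d * k) \<in> idl UNIV f g"
    using k by (auto intro!: idl_add idl_mult idl_gen)
  with k show ?thesis by (rule powers_imp_inum_finite)
qed

text \<open>Two series that both fail to be regular in \<open>y\<close> share the factor
  \<open>x\<close>, whence the second conclusion. It provides the regular member from which the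
  Jacobian is shown to be nonzero.\<close>

theorem coprime_imp_inum_finite:
  assumes f: "f \<in> Cxy" "coeff2 f 0 0 = 0" and g: "g \<in> Cxy" "coeff2 g 0 0 = 0" and cop: "coprime2 f g"
  shows "inum f g \<noteq> \<infinity>" "(\<exists>d. yreg d f) \<or> (\<exists>d. yreg d g)"
proof -
  have reg: "\<exists>d. yreg d h" if "\<not> (\<forall>j. coeff2 h 0 j = 0)" for h
  proof
    show "yreg (LEAST j. coeff2 h 0 j \<noteq> 0) h"
      unfolding yreg_def using that LeastI_ex[of "\<lambda>e. coeff2 h 0 e \<noteq> 0"] not_less_Least by blast
  qed
  have xdvd: "dvd2 xx h" if "\<forall>j. coeff2 h 0 j = 0" "h \<in> Cxy" for h
  proof -
    have "coeff2 h i j = 0" if "i < 1" for i j using \<open>\<forall>j. _\<close> that by simp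
    then obtain u where "h = xx ^ 1 * u" "h \<in> Cxy \<longrightarrow> u \<in> Cxy" by (rule xpow_dvd) blast+
    then show ?thesis using that(2) by (auto simp: dvd2_def)
  qed
  show *: "(\<exists>d. yreg d f) \<or> (\<exists>d. yreg d g)"
  proof (rule ccontr)
    assume "\<not> ?thesis"
    then have "dvd2 xx f" "dvd2 xx g" using reg xdvd f g by blast+
    then have "unit2 xx" using cop by (simp add: coprime2_def)
    then obtain u where "xx * u = 1" by (auto simp: unit2_def)
    then have "coeff2 (xx * u) 0 0 = coeff2 1 0 0" by simp
    then show False by simp
  qed
  have cop': "coprime2 g f" using cop by (auto simp: coprime2_def)
  from * show "inum f g \<noteq> \<infinity>"
    using coprime_yreg_imp_finite[OF f(1) _ g(1) cop] coprime_yreg_imp_finite[OF g(1) _ f(1) cop']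
    by (auto simp: inum_commute)
qed

subsection \<open>Evaluation along curves\<close>

definition ford :: "complex fps \<Rightarrow> enat" where
  "ford a = (if a = 0 then \<infinity> else enat (subdegree a))"

lemma dx_simps:
  "dx (a + b) = dx a + dx b" "dx (a - b) = dx a - dx b" "dx (- a) = - dx a"
  "dx (a * b) = dx a * b + a * dx b" "dx (fps_const c) = fps_const (fps_deriv c)" "dx yy = 0"
proof -
  show "dx (a * b) = dx a * b + a * dx b"
    by (rule fps_ext) (simp add: dx_def fps_mult_nth fps_deriv_sum sum.distrib add.commute)
qed (auto simp: dx_def fps_eq_iff algebra_simps)

lemma dy_simps:
  "dy (a + b) = dy a + dy b" "dy (a - b) = dy a - dy b" "dy (- a) = - dy a"
  "dy (a * b) = dy a * b + a * dy b" "dy (fps_const c) = 0" "dy yy = 1"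
  by (simp_all add: dy_def add.commute)

lemma dx_sc [simp]: "dx (sc c) = 0" and dy_sc [simp]: "dy (sc c) = 0"
  by (simp_all add: sc_def dx_simps dy_simps)

text \<open>Restriction to the line \<open>x = 0\<close>, the only branch that is not a graph over
  \<open>x\<close> or over a root of \<open>x\<close>.\<close>

definition ev0 :: "ps2 \<Rightarrow> complex fps" where
  "ev0 h = Abs_fps (\<lambda>j. coeff2 h 0 j)"

lemma ev0_nth [simp]: "fps_nth (ev0 h) j = coeff2 h 0 j"
  by (simp add: ev0_def)

lemma ev0_simps: "ev0 (a + b) = ev0 a + ev0 b" "ev0 (a * b) = ev0 a * ev0 b"
  "ev0 (sc c) = fps_const c" "ev0 xx = 0" "ev0 yy = fps_X" "fps_deriv (ev0 h) = ev0 (dy h)"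
  by (rule fps_ext; simp add: coeff2_mult fps_mult_nth atLeast0AtMost;
      simp add: coeff2_def xx_def fps_X_def)+

lemma yreg_iff_ev0: "yreg e h \<longleftrightarrow> ev0 h \<noteq> 0 \<and> subdegree (ev0 h) = e"
proof
  assume *: "yreg e h"
  then have "ev0 h \<noteq> 0" by (auto simp: yreg_def fps_eq_iff)
  moreover have "subdegree (ev0 h) = e" using * by (intro subdegreeI) (auto simp: yreg_def)
  ultimately show "ev0 h \<noteq> 0 \<and> subdegree (ev0 h) = e" ..
next
  assume *: "ev0 h \<noteq> 0 \<and> subdegree (ev0 h) = e"
  then show "yreg e h"
    unfolding yreg_def using nth_subdegree_nonzero[of "ev0 h"] nth_less_subdegree_zero[of _ "ev0 h"]
    by (metis ev0_nth)
qed

lemma yreg_mult: "yreg a f \<Longrightarrow> yreg b g \<Longrightarrow> yreg (a + b) (f * g)"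
  by (auto simp: yreg_iff_ev0 ev0_simps)

lemma mult_ypow_nth_eq_0:
  fixes Y :: "complex fps"
  assumes "fps_nth Y 0 = 0" "n < j"
  shows "fps_nth (a * Y ^ j) n = 0"
proof -
  have "Y = fps_X * fps_shift 1 Y"
    using assms(1) by (auto simp: fps_eq_iff)
  then have "Y ^ j = fps_X ^ j * fps_shift 1 Y ^ j"
    by (metis power_mult_distrib)
  then have "a * Y ^ j = fps_X ^ j * (a * fps_shift 1 Y ^ j)"
    by (simp only: mult.left_commute)
  then show ?thesis using assms(2) by (simp only: fps_X_power_mult_nth) simp
qed

text \<open>Substitution of \<open>Y(x)\<close> for \<open>y\<close>. Cutting the sum at
  \<open>n\<close> loses nothing when \<open>Y\<close> has no constant term, since then
  \<open>Y ^ j\<close> has order at least \<open>j\<close>.\<close>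

definition evy :: "complex fps \<Rightarrow> ps2 \<Rightarrow> complex fps" where
  "evy Y h = Abs_fps (\<lambda>n. \<Sum>j\<le>n. fps_nth (fps_nth h j * Y ^ j) n)"

lemma evy_nth:
  assumes "fps_nth Y 0 = 0" "n \<le> m"
  shows "fps_nth (evy Y h) n = (\<Sum>j\<le>m. fps_nth (fps_nth h j * Y ^ j) n)"
proof -
  have "(\<Sum>j\<le>m. fps_nth (fps_nth h j * Y ^ j) n) = (\<Sum>j\<le>n. fps_nth (fps_nth h j * Y ^ j) n)"
    using assms mult_ypow_nth_eq_0[OF assms(1)] by (intro sum.mono_neutral_right) auto
  then show ?thesis by (simp add: evy_def)
qed

lemma evy_rec:
  assumes Y: "fps_nth Y 0 = 0"
  shows "evy Y h = fps_nth h 0 + Y * evy Y (fps_shift 1 h)"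
proof (rule fps_ext)
  fix n
  have "fps_nth (Y * evy Y (fps_shift 1 h)) n
      = (\<Sum>l=0..n. fps_nth Y l * (\<Sum>j\<le>n. fps_nth (fps_nth h (Suc j) * Y ^ j) (n - l)))"
    by (simp add: fps_mult_nth[of Y] evy_nth[OF Y, of _ n])
  also have "\<dots> = (\<Sum>j\<le>n. fps_nth (Y * (fps_nth h (Suc j) * Y ^ j)) n)"
    unfolding sum_distrib_left by (subst sum.swap) (simp add: fps_mult_nth[of Y])
  also have "\<dots> = (\<Sum>j\<le>n. fps_nth (fps_nth h (Suc j) * Y ^ Suc j) n)"
    by (simp only: power_Suc mult.left_commute)
  finally show "fps_nth (evy Y h) n = fps_nth (fps_nth h 0 + Y * evy Y (fps_shift 1 h)) n"
    using evy_nth[OF Y, of n "Suc n" h] by (simp only: sum.atMost_Suc_shift) simp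
qed

text \<open>The value is the remainder of division by \<open>y - Y\<close>; together with
  \<open>evy_unique\<close> this yields the homomorphism laws and the chain rule without coefficient
  computations.\<close>

lemma evy_division:
  assumes Y: "fps_nth Y 0 = 0"
  obtains q where "h = (yy - fps_const Y) * q + fps_const (evy Y h)"
proof (rule that, rule fps_ext)
  define q where "q = Abs_fps (\<lambda>j. evy Y (fps_shift (Suc j) h))"
  fix j
  have rec: "evy Y (fps_shift j h) = fps_nth h j + Y * evy Y (fps_shift (Suc j) h)"
  proof -
    have "fps_shift 1 (fps_shift j h) = fps_shift (Suc j) h" by (simp add: fps_eq_iff)
    then show ?thesis using evy_rec[OF Y, of "fps_shift j h"] by simp
  qed
  show "fps_nth h j = fps_nth ((yy - fps_const Y) * q + fps_const (evy Y h)) j"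
    using rec by (cases j) (auto simp: q_def left_diff_distrib)
qed

text \<open>Two remainders differ by some \<open>d = (y - Y) r\<close> free of \<open>y\<close>.
  Then each coefficient of \<open>r\<close> is \<open>Y\<close> times the next one, so
  \<open>d\<close> is divisible by every power of \<open>Y\<close> and vanishes.\<close>

lemma evy_unique:
  assumes Y: "fps_nth Y 0 = 0" and h: "h = (yy - fps_const Y) * q + fps_const c"
  shows "evy Y h = c"
proof -
  obtain q' where q': "h = (yy - fps_const Y) * q' + fps_const (evy Y h)"
    by (rule evy_division[OF Y])
  define r where "r = q - q'"
  define d where "d = evy Y h - c"
  have eq: "(yy - fps_const Y) * r = fps_const d"
  proof -
    have "P * q + C = P * q' + E \<Longrightarrow> P * (q - q') = E - C" for P C E :: ps2
      by (simp add: algebra_simps)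
    from this[OF h[symmetric, THEN trans, OF q']]
    show ?thesis by (simp add: r_def d_def)
  qed
  have rj: "fps_nth r i = Y * fps_nth r (Suc i)" for i
    using arg_cong[OF eq, of "\<lambda>h. fps_nth h (Suc i)"] by (simp add: left_diff_distrib)
  have r0: "fps_nth r 0 = Y ^ i * fps_nth r i" for i
  proof (induction i)
    case (Suc i)
    show ?case unfolding Suc.IH rj[of i] by (simp add: mult_ac)
  qed simp
  have d0: "d = - (Y * fps_nth r 0)"
    using arg_cong[OF eq, of "\<lambda>h. fps_nth h 0"] by (simp add: left_diff_distrib)
  have "d = 0"
  proof (rule fps_ext)
    fix n
    have "d = - (fps_nth r n * Y ^ Suc n)"
      using d0 r0[of n] by (simp add: mult_ac)
    moreover have "fps_nth (fps_nth r n * Y ^ Suc n) n = 0"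
      by (rule mult_ypow_nth_eq_0[OF Y]) simp
    ultimately show "fps_nth d n = fps_nth 0 n" by (simp only: fps_neg_nth) simp
  qed
  then show ?thesis by (simp add: d_def)
qed

context
  fixes Y :: "complex fps"
  assumes Y: "fps_nth Y 0 = 0"
begin

lemma evy_const: "evy Y (fps_const c) = c"
  by (rule evy_unique[OF Y, of _ 0]) simp

lemma evy_yy: "evy Y yy = Y"
  by (rule evy_unique[OF Y, of _ 1]) simp

lemma evy_add: "evy Y (a + b) = evy Y a + evy Y b"
proof -
  obtain p where p: "a = (yy - fps_const Y) * p + fps_const (evy Y a)" by (rule evy_division[OF Y])
  obtain q where q: "b = (yy - fps_const Y) * q + fps_const (evy Y b)" by (rule evy_division[OF Y])
  show ?thesis
    by (rule evy_unique[OF Y, of _ "p + q"], subst p, subst q)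
       (simp add: algebra_simps flip: fps_const_add)
qed

lemma evy_mult: "evy Y (a * b) = evy Y a * evy Y b"
proof -
  obtain p where p: "a = (yy - fps_const Y) * p + fps_const (evy Y a)" by (rule evy_division[OF Y])
  obtain q where q: "b = (yy - fps_const Y) * q + fps_const (evy Y b)" by (rule evy_division[OF Y])
  have "(P * p + A) * (P * q + B) = P * (p * (P * q) + p * B + A * q) + A * B" for P A B :: ps2
    by (simp add: algebra_simps)
  then show ?thesis
    by (intro evy_unique[OF Y, of _ "p * ((yy - fps_const Y) * q) + p * fps_const (evy Y b) + fps_const (evy Y a) * q"])
       (metis p q fps_const_mult)
qed

lemma evy_deriv: "fps_deriv (evy Y h) = evy Y (dx h) + evy Y (dy h) * fps_deriv Y"
proof -
  obtain q where q: "h = (yy - fps_const Y) * q + fps_const (evy Y h)" by (rule evy_division[OF Y])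
  have "dx h + dy h * fps_const (fps_deriv Y)
      = (yy - fps_const Y) * (dx q + dy q * fps_const (fps_deriv Y)) + fps_const (fps_deriv (evy Y h))"
    by (subst (1 2) q) (simp only: dx_simps dy_simps, simp add: algebra_simps del: fps_const_neg)
  then have "evy Y (dx h + dy h * fps_const (fps_deriv Y)) = fps_deriv (evy Y h)"
    by (rule evy_unique[OF Y])
  then show ?thesis by (simp add: evy_add evy_mult evy_const)
qed

lemma evy_nth_0: "fps_nth (evy Y h) 0 = coeff2 h 0 0"
  by (simp add: evy_def coeff2_def)

text \<open>Modulo \<open>y - Y\<close> the series \<open>h\<close> becomes
  \<open>h(x, Y(x))\<close>, which is zero or a unit times a power of \<open>x\<close>, and the
  graph meets \<open>x = 0\<close> with multiplicity one.\<close>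

lemma inum_graph: "inum h (yy - fps_const Y) = ford (evy Y h)"
proof -
  let ?p = "yy - fps_const Y"
  obtain q where q: "h = ?p * q + fps_const (evy Y h)" by (rule evy_division[OF Y])
  have "fps_const Y = xx * fps_const (fps_shift 1 Y)"
    unfolding xx_def fps_const_mult using Y by (auto simp: fps_eq_iff)
  then have "?p = yy + (- fps_const (fps_shift 1 Y)) * xx"
    by (simp add: mult.commute del: fps_const_neg)
  then have 1: "inum xx ?p = 1"
    using inum_add_multiple[of xx yy "- fps_const (fps_shift 1 Y)"] inum_xx_yy by metis
  have "inum ?p h = inum ?p (fps_const (evy Y h))"
    using inum_add_multiple[of ?p "fps_const (evy Y h)" q] q by (metis add.commute mult.commute)
  also have "\<dots> = ford (evy Y h)"
  proof (cases "evy Y h = 0")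
    case True
    have "coeff2 ?p 0 0 = 0" using Y by (simp add: coeff2_def)
    then show ?thesis using True by (simp add: ford_def inum_0_right)
  next
    case False
    define c where "c = evy Y h"
    define n where "n = subdegree c"
    define u where "u = fps_shift n c"
    have "c \<noteq> 0" using False by (simp add: c_def)
    have "c = fps_X ^ n * u"
      unfolding u_def n_def using subdegree_decompose[of c] by (simp add: mult.commute)
    then have "fps_const c = fps_const u * xx ^ n"
      by (simp add: xx_def mult.commute)
    moreover have "coeff2 (fps_const u) 0 0 \<noteq> 0"
      using \<open>c \<noteq> 0\<close> by (simp add: coeff2_def u_def n_def)
    ultimately have "inum ?p (fps_const c) = enat n * inum ?p xx"
      by (simp add: inum_mult_unit inum_power)
    then show ?thesis
      using 1 False by (simp add: inum_commute[of ?p xx] ford_def c_def n_def)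
  qed
  finally show ?thesis by (simp add: inum_commute)
qed

end

lemma inum_xx: "inum h xx = ford (ev0 h)"
proof (cases "ev0 h = 0")
  case True
  have "coeff2 h i j = 0" if "i < 1" for i j
    using arg_cong[OF True, of "\<lambda>a. fps_nth a j"] that by simp
  then obtain u where "h = xx ^ 1 * u" by (rule xpow_dvd)
  then have "h = 0 + u * xx" by simp
  then have "inum xx h = inum xx 0" by (metis inum_add_multiple)
  then show ?thesis using True by (simp add: ford_def inum_0_right inum_commute[of h])
next
  case False
  define d where "d = subdegree (ev0 h)"
  have "yreg d h" using False by (simp add: yreg_iff_ev0 d_def)
  have "coeff2 (h - yy ^ d * fps_shift d h) i j = 0" if "i < 1" for i j
    using \<open>yreg d h\<close> that by (auto simp: coeff2_ypow_mult yreg_def)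
  then obtain b where "h - yy ^ d * fps_shift d h = xx ^ 1 * b" by (rule xpow_dvd)
  then have "h = fps_shift d h * yy ^ d + b * xx" by (simp add: algebra_simps)
  then have "inum xx h = inum xx (fps_shift d h * yy ^ d)" by (metis inum_add_multiple)
  also have "\<dots> = enat d * inum xx yy"
    using \<open>yreg d h\<close> by (simp add: inum_mult_unit yreg_def inum_power)
  finally show ?thesis
    using False by (simp add: inum_commute[of h] inum_xx_yy ford_def d_def)
qed

subsection \<open>The covering \<open>x = s\<^sup>N\<close>\<close>

text \<open>The substitution \<open>x = s^N\<close>, with the new parameter again written
  \<open>x\<close>.\<close>

definition stretch :: "nat \<Rightarrow> ps2 \<Rightarrow> ps2" where
  "stretch N h = Abs_fps (\<lambda>j. fps_nth h j oo fps_X ^ N)"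

lemma compose_xpow_nth:
  fixes a :: "complex fps"
  assumes "N > 0"
  shows "fps_nth (a oo fps_X ^ N) n = (if N dvd n then fps_nth a (n div N) else 0)"
proof -
  have eq: "fps_nth (a oo fps_X ^ N) n = (\<Sum>i=0..n. if n = N * i then fps_nth a i else 0)"
    unfolding fps_compose_nth by (intro sum.cong refl) (auto simp: power_mult[symmetric] fps_X_power_nth)
  show ?thesis
  proof (cases "N dvd n")
    case True
    then obtain k where k: "n = N * k" by auto
    have "(\<Sum>i=0..n. if n = N * i then fps_nth a i else 0) = (\<Sum>i=0..n. if i = k then fps_nth a i else 0)"
      using assms k by (intro sum.cong) auto
    then show ?thesis using eq assms k True by simp
  next
    case False
    then have "(\<Sum>i=0..n. if n = N * i then fps_nth a i else 0) = 0"
      by (intro sum.neutral) auto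
    then show ?thesis using eq False by simp
  qed
qed

lemma coeff2_stretch: "N > 0 \<Longrightarrow> coeff2 (stretch N h) i j = (if N dvd i then coeff2 h (i div N) j else 0)"
  by (simp add: coeff2_def stretch_def compose_xpow_nth)

context
  fixes N :: nat
  assumes N: "N > 0"
begin

lemma xpow_0 [simp]: "fps_nth (fps_X ^ N :: complex fps) 0 = 0"
  using N by (simp add: fps_X_power_nth)

lemma stretch_simps:
  "stretch N (a + b) = stretch N a + stretch N b" "stretch N (a - b) = stretch N a - stretch N b"
  "stretch N (a * b) = stretch N a * stretch N b"
  "stretch N (fps_const c) = fps_const (c oo fps_X ^ N)" "stretch N yy = yy" "stretch N (sc t) = sc t"
  "stretch N 0 = 0"
proof -
  show "stretch N (a * b) = stretch N a * stretch N b"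
    by (rule fps_ext) (simp add: stretch_def fps_mult_nth fps_compose_sum_distrib fps_compose_mult_distrib N)
  show "stretch N (sc t) = sc t"
    using N by (intro ps2_eqI) (auto simp: coeff2_stretch)
qed (rule fps_ext; simp add: stretch_def fps_compose_add_distrib fps_compose_sub_distrib fps_X_def)+

lemma dx_stretch: "dx (stretch N h) = stretch N (dx h) * fps_const (fps_deriv (fps_X ^ N))"
  by (rule fps_ext) (simp add: dx_def stretch_def fps_compose_deriv N)

lemma dy_stretch: "dy (stretch N h) = stretch N (dy h)"
  using N by (intro ps2_eqI) (simp add: coeff2_stretch)

definition component :: "nat \<Rightarrow> ps2 \<Rightarrow> ps2" where
  "component i h = ps2_of (\<lambda>k j. coeff2 h (N * k + i) j)"

lemma component_add: "component i (a + b) = component i a + component i b" and component_sc: "component i (sc c * a) = sc c * component i a"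
  by (rule ps2_eqI; simp add: component_def)+

text \<open>Exponents of \<open>x\<close> in a stretched series are multiples of \<open>N\<close>,
  so multiplication by it preserves residue classes modulo \<open>N\<close>: the coordinates are
  linear over the smaller ring.\<close>

lemma component_mult_stretch:
  assumes i: "i < N"
  shows "component i (a * stretch N b) = component i a * b"
proof (rule ps2_eqI)
  fix k j
  have "(\<Sum>m\<le>N * k + i. coeff2 a (N * k + i - m) r * coeff2 (stretch N b) m s)
      = (\<Sum>m\<le>k. coeff2 a (N * (k - m) + i) r * coeff2 b m s)" for r s
  proof -
    have "(\<Sum>m\<le>N * k + i. coeff2 a (N * k + i - m) r * coeff2 (stretch N b) m s)
        = (\<Sum>m\<in>(\<lambda>m. N * m) ` {..k}. coeff2 a (N * k + i - m) r * coeff2 (stretch N b) m s)"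
    proof (rule sum.mono_neutral_right)
      show "\<forall>m\<in>{..N * k + i} - (*) N ` {..k}. coeff2 a (N * k + i - m) r * coeff2 (stretch N b) m s = 0"
      proof
        fix m assume m: "m \<in> {..N * k + i} - (*) N ` {..k}"
        have "\<not> N dvd m"
        proof
          assume "N dvd m"
          then obtain l where l: "m = N * l" by auto
          have "N * l < N * Suc k" using m i l by simp
          then have "l < Suc k" by (simp only: nat_mult_less_cancel1[OF N])
          then show False using m l by auto
        qed
        then show "coeff2 a (N * k + i - m) r * coeff2 (stretch N b) m s = 0"
          by (simp add: coeff2_stretch N)
      qed
    qed (auto intro: trans_le_add1)
    also have "\<dots> = (\<Sum>m\<le>k. coeff2 a (N * k + i - N * m) r * coeff2 (stretch N b) (N * m) s)"
      by (subst sum.reindex) (use N in \<open>auto simp: inj_on_def\<close>)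
    also have "\<dots> = (\<Sum>m\<le>k. coeff2 a (N * (k - m) + i) r * coeff2 b m s)"
      by (intro sum.cong refl) (use N in \<open>auto simp: coeff2_stretch diff_mult_distrib2\<close>)
    finally show ?thesis .
  qed
  moreover have "coeff2 (a * stretch N b) (N * k + i) j
      = (\<Sum>l\<le>j. \<Sum>m\<le>N * k + i. coeff2 a (N * k + i - m) l * coeff2 (stretch N b) m (j - l))"
    unfolding coeff2_mult by (intro sum.cong refl sum.reindex_bij_witness[of _ "\<lambda>m. N * k + i - m" "\<lambda>m. N * k + i - m"]) auto
  moreover have "coeff2 (component i a * b) k j
      = (\<Sum>l\<le>j. \<Sum>m\<le>k. coeff2 a (N * (k - m) + i) l * coeff2 b m (j - l))"
    unfolding coeff2_mult
    by (intro sum.cong refl sum.reindex_bij_witness[of _ "\<lambda>m. k - m" "\<lambda>m. k - m"]) (auto simp: component_def)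
  ultimately show "coeff2 (component i (a * stretch N b)) k j = coeff2 (component i a * b) k j"
    by (simp add: component_def)
qed

lemma component_xpow:
  assumes "i < N" "r < N"
  shows "component i (xx ^ r) = (if i = r then 1 else 0)"
proof (rule ps2_eqI)
  fix k j
  have "N * k + i = r \<longleftrightarrow> k = 0 \<and> i = r"
    using assms by (cases k) auto
  moreover have "coeff2 (xx ^ r) n j = (if n = r \<and> j = 0 then 1 else 0)" for n
    using coeff2_xpow_mult[of r 1 n j] by auto
  ultimately show "coeff2 (component i (xx ^ r)) k j = coeff2 (if i = r then 1 else 0) k j"
    by (auto simp: component_def)
qed

lemma component_decompose: "a = (\<Sum>i<N. xx ^ i * stretch N (component i a))"
proof (rule ps2_eqI)
  fix n j
  have "coeff2 (\<Sum>i<N. xx ^ i * stretch N (component i a)) n j = (\<Sum>i<N. if i = n mod N then coeff2 a n j else 0)"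
    unfolding coeff2_sum
  proof (intro sum.cong refl)
    fix i assume i: "i \<in> {..<N}"
    show "coeff2 (xx ^ i * stretch N (component i a)) n j = (if i = n mod N then coeff2 a n j else 0)"
    proof (cases "i = n mod N")
      case True
      then have *: "n - i = N * (n div N)" "\<not> n < i" by (auto simp: minus_mod_eq_mult_div not_less)
      have "N * (n div N) + i = n" using True by simp
      then have "coeff2 (xx ^ i * stretch N (component i a)) n j = coeff2 a n j"
        unfolding coeff2_xpow_mult coeff2_stretch[OF N] * using *(2) N by (simp add: component_def)
      then show ?thesis using True by simp
    next
      case False
      have "\<not> N dvd (n - i)" if "i \<le> n"
      proof
        assume "N dvd (n - i)"
        then obtain k where "n - i = N * k" by (rule dvdE)
        then have "n = i + N * k" using that by simp
        then show False using False i by simp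
      qed
      then show ?thesis using False by (simp add: coeff2_xpow_mult coeff2_stretch N)
    qed
  qed
  also have "\<dots> = coeff2 a n j" using N by simp
  finally show "coeff2 a n j = coeff2 (\<Sum>i<N. xx ^ i * stretch N (component i a)) n j" ..
qed

text \<open>\<open>\<complex>[[s, y]]\<close> is free over \<open>\<complex>[[x, y]]\<close> with basis \<open>1, s, \<dots>, s\<^sup>N\<^sup>-\<^sup>1\<close>; the coordinates are \<open>component i\<close>.\<close>
theorem inum_stretch: "inum (stretch N h) (stretch N k) = enat N * inum h k"
proof -
  define I where "I = idl UNIV h k"
  \<comment> \<open>A filtration that imposes one coordinate condition at a time; every step has the
    same dimension \<open>reldim UNIV I\<close>.\<close>
  define W where "W r = {a. \<forall>i<r. component i a \<in> I}" for r
  have I: "subsp I" unfolding I_def by (rule subsp_idl) simp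
  have component0: "component i 0 = 0" for i by (rule ps2_eqI) (simp add: component_def)
  have W: "subsp (W r)" for r
    using subspD[OF I] by (auto simp: subsp_def W_def component_add component_sc component0)
  have "reldim UNIV (W r) = enat r * reldim UNIV I" if "r \<le> N" for r
    using that
  proof (induction r)
    case 0
    have "W 0 = UNIV" by (simp add: W_def)
    then show ?case by (simp add: reldim_refl zero_enat_def[symmetric])
  next
    case (Suc r)
    have "reldim UNIV (W (Suc r)) = reldim UNIV (W r) + reldim (W r) (W (Suc r))"
      by (rule reldim_add[OF subsp_UNIV W W]) (auto simp: W_def)
    also have "reldim (W r) (W (Suc r)) = reldim UNIV I"
    proof (rule reldim_iso[where \<phi> = "component r"])
      fix w :: ps2
      let ?v = "xx ^ r * stretch N w"
      have cv: "component i ?v = (if i = r then w else 0)" if "i < N" for i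
        using that Suc.prems by (simp add: component_mult_stretch component_xpow)
      show "\<exists>v\<in>W r. w - component r v \<in> I"
        by (rule bexI[of _ ?v]) (use cv Suc.prems subspD(1)[OF I] in \<open>auto simp: W_def\<close>)
    qed (auto simp: component_add component_sc I W[unfolded W_def] W_def less_Suc_eq)
    also have "reldim UNIV (W r) + reldim UNIV I = enat (Suc r) * reldim UNIV I"
      using Suc by (cases "reldim UNIV I") (auto simp: times_enat_def split: if_splits)
    finally show ?case .
  qed
  moreover have "W N = idl UNIV (stretch N h) (stretch N k)"
  proof (intro set_eqI iffI)
    fix a assume "a \<in> idl UNIV (stretch N h) (stretch N k)"
    then obtain b c where "a = b * stretch N h + c * stretch N k" unfolding idl_def by blast
    then have "component i a = component i b * h + component i c * k" if "i < N" for i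
      using that by (simp add: component_add component_mult_stretch)
    then show "a \<in> W N" unfolding W_def I_def by (auto intro: idlI)
  next
    fix a assume a: "a \<in> W N"
    have "(\<Sum>i<N. xx ^ i * stretch N (component i a)) \<in> idl UNIV (stretch N h) (stretch N k)"
    proof (rule subsp_sum[OF subsp_idl])
      fix i assume "i \<in> {..<N}"
      then obtain b c where "component i a = b * h + c * k" using a unfolding W_def I_def idl_def by blast
      then have "xx ^ i * stretch N (component i a) = (xx ^ i * stretch N b) * stretch N h + (xx ^ i * stretch N c) * stretch N k"
        by (simp add: stretch_simps algebra_simps)
      then show "xx ^ i * stretch N (component i a) \<in> idl UNIV (stretch N h) (stretch N k)" by (auto intro: idlI)
    qed simp
    then show "a \<in> idl UNIV (stretch N h) (stretch N k)" using component_decompose[of a] by simp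
  qed
  ultimately show ?thesis unfolding inum_def I_def by (metis order_refl)
qed

end

subsection \<open>The Newton--Puiseux theorem\<close>

lemma map_poly_hom:
  fixes f :: "'a :: comm_ring_1 \<Rightarrow> 'b :: comm_ring_1"
  assumes add: "\<And>a b. f (a + b) = f a + f b" and mult: "\<And>a b. f (a * b) = f a * f b"
  shows "map_poly f (p + q) = map_poly f p + map_poly f q"
    and "map_poly f (p * q) = map_poly f p * map_poly f q"
    and "map_poly f (p \<circ>\<^sub>p q) = map_poly f p \<circ>\<^sub>p map_poly f q"
proof -
  have 0: "f 0 = 0" using add[of 0 0] by simp
  have sum: "f (sum g A) = (\<Sum>x\<in>A. f (g x))" for g :: "nat \<Rightarrow> 'a" and A
    by (induction A rule: infinite_finite_induct) (simp_all add: 0 add)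
  show hom_add: "map_poly f (p + q) = map_poly f p + map_poly f q" for p q
    by (rule poly_eqI) (simp add: coeff_map_poly 0 add)
  show hom_mult: "map_poly f (p * q) = map_poly f p * map_poly f q" for p q
    by (rule poly_eqI) (simp add: coeff_map_poly 0 coeff_mult mult sum)
  show "map_poly f (p \<circ>\<^sub>p q) = map_poly f p \<circ>\<^sub>p map_poly f q"
  proof (induction p)
    case (pCons a p)
    have "map_poly f [:a:] = [:f a:]" by (rule poly_eqI) (simp add: coeff_map_poly 0 coeff_pCons split: nat.splits)
    then show ?case
      using pCons by (simp add: pcompose_pCons hom_add hom_mult map_poly_pCons 0)
  qed simp
qed

definition lin_prod :: "complex fps list \<Rightarrow> complex fps poly" where
  "lin_prod ys = prod_list (map (\<lambda>y. [:- y, 1:]) ys)"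

lemma lin_prod_simps [simp]: "lin_prod [] = 1" "lin_prod (y # ys) = [:- y, 1:] * lin_prod ys"
  "lin_prod (xs @ ys) = lin_prod xs * lin_prod ys"
  by (simp_all add: lin_prod_def)

definition stretch_poly :: "nat \<Rightarrow> complex fps poly \<Rightarrow> complex fps poly" where
  "stretch_poly N = map_poly (\<lambda>a. a oo fps_X ^ N)"

lemma coeff_stretch_poly: "coeff (stretch_poly N p) j = coeff p j oo fps_X ^ N"
  by (simp add: stretch_poly_def coeff_map_poly)

lemma stretch_poly_hom:
  assumes "N > 0"
  shows "stretch_poly N (p + q) = stretch_poly N p + stretch_poly N q" "stretch_poly N (p * q) = stretch_poly N p * stretch_poly N q"
    "stretch_poly N (p \<circ>\<^sub>p q) = stretch_poly N p \<circ>\<^sub>p stretch_poly N q"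
  unfolding stretch_poly_def using assms
  by (intro map_poly_hom; simp add: fps_compose_add_distrib fps_compose_mult_distrib)+

lemma stretch_poly_1 [simp]: "stretch_poly N 1 = 1"
  by (rule poly_eqI) (simp add: coeff_stretch_poly coeff_1)

lemma stretch_poly_linear: "stretch_poly N [:a, b:] = [:a oo fps_X ^ N, b oo fps_X ^ N:]"
  by (rule poly_eqI) (simp add: coeff_stretch_poly coeff_pCons split: nat.splits)

lemma compose_xpow_compose:
  fixes a :: "complex fps"
  assumes "N > 0" "M > 0"
  shows "(a oo fps_X ^ N) oo fps_X ^ M = a oo fps_X ^ (N * M)"
  using assms by (intro fps_ext) (auto simp: compose_xpow_nth div_mult2_eq mult.commute[of N M] dvd_div_iff_mult elim: dvd_trans[rotated])

lemma stretch_poly_stretch_poly: "N > 0 \<Longrightarrow> M > 0 \<Longrightarrow> stretch_poly M (stretch_poly N p) = stretch_poly (N * M) p"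
  by (rule poly_eqI) (simp add: coeff_stretch_poly compose_xpow_compose)

lemma stretch_poly_lin_prod: "N > 0 \<Longrightarrow> stretch_poly N (lin_prod ys) = lin_prod (map (\<lambda>y. y oo fps_X ^ N) ys)"
  by (induction ys) (simp_all add: stretch_poly_hom stretch_poly_linear fps_compose_uminus del: mult_pCons_left)

text \<open>Fractional exponents are avoided: a root in \<open>s\<close> with \<open>x = s^N\<close>
  stands for a Puiseux series in \<open>x\<close>.\<close>

definition puiseux_splits :: "complex fps poly \<Rightarrow> bool" where
  "puiseux_splits p \<longleftrightarrow> (\<exists>N ys. N > 0 \<and> stretch_poly N p = lin_prod ys)"

lemma puiseux_splits_mult:
  assumes "puiseux_splits p" "puiseux_splits q"
  shows "puiseux_splits (p * q)"
proof -
  obtain N ys M zs where *: "N > 0" "stretch_poly N p = lin_prod ys" "M > 0" "stretch_poly M q = lin_prod zs"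
    using assms by (auto simp: puiseux_splits_def)
  have "stretch_poly (N * M) (p * q) = stretch_poly M (stretch_poly N p) * stretch_poly N (stretch_poly M q)"
    using *(1,3) by (simp add: stretch_poly_stretch_poly stretch_poly_hom mult.commute[of M N])
  also have "\<dots> = lin_prod (map (\<lambda>y. y oo fps_X ^ M) ys @ map (\<lambda>y. y oo fps_X ^ N) zs)"
    using * by (simp add: stretch_poly_lin_prod)
  finally show ?thesis
    unfolding puiseux_splits_def using *
    by (intro exI[of _ "N * M"] exI[of _ "map (\<lambda>y. y oo fps_X ^ M) ys @ map (\<lambda>y. y oo fps_X ^ N) zs"]) auto
qed

lemma pcompose_shift_back: "p \<circ>\<^sub>p [:a, 1:] \<circ>\<^sub>p [:- a, 1:] = (p :: 'a :: comm_ring_1 poly)"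
  by (simp add: pcompose_assoc[symmetric] pcompose_pCons)

lemma lin_prod_shift: "lin_prod ys \<circ>\<^sub>p [:- a, 1:] = lin_prod (map (\<lambda>y. y + a) ys)"
  by (induction ys) (simp_all add: pcompose_1 pcompose_mult pcompose_pCons del: mult_pCons_left)

lemma puiseux_splits_shift:
  assumes "puiseux_splits (p \<circ>\<^sub>p [:a, 1:])"
  shows "puiseux_splits p"
proof -
  obtain N ys where N: "N > 0" "stretch_poly N (p \<circ>\<^sub>p [:a, 1:]) = lin_prod ys"
    using assms by (auto simp: puiseux_splits_def)
  define b where "b = a oo fps_X ^ N"
  have "stretch_poly N p \<circ>\<^sub>p [:b, 1:] = lin_prod ys"
    using N by (simp add: stretch_poly_hom stretch_poly_linear b_def)
  then have "stretch_poly N p = lin_prod ys \<circ>\<^sub>p [:- b, 1:]"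
    by (metis pcompose_shift_back)
  then show ?thesis
    unfolding puiseux_splits_def lin_prod_shift using N(1) by blast
qed

lemma lin_prod_neq_0 [simp]: "lin_prod ys \<noteq> 0"
  by (induction ys) (simp_all del: mult_pCons_left)

lemma degree_lin_prod [simp]: "degree (lin_prod ys) = length ys"
proof (induction ys)
  case (Cons y ys)
  then show ?case by (simp add: degree_mult_eq del: mult_pCons_left)
qed simp

lemma lin_prod_scale: "lin_prod (map (\<lambda>y. t * y) ys) \<circ>\<^sub>p [:0, t:] = smult (t ^ length ys) (lin_prod ys)"
proof (induction ys)
  case (Cons y ys)
  have e: "[:- (t * y), 1:] \<circ>\<^sub>p [:0, t:] = smult t [:- y, 1:]"
    by (simp add: pcompose_pCons)
  show ?case
    by (simp only: e list.map lin_prod_simps pcompose_mult Cons.IH mult_smult_left mult_smult_right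
        smult_smult list.size power_Suc2 add_0_right add_Suc_right)
qed (simp add: pcompose_1)

lemma puiseux_splits_scale:
  assumes eq: "p \<circ>\<^sub>p [:0, fps_X ^ k:] = smult (fps_X ^ (k * degree q)) q" and q: "puiseux_splits q"
  shows "puiseux_splits p"
proof -
  obtain N ys where N: "N > 0" "stretch_poly N q = lin_prod ys"
    using q by (auto simp: puiseux_splits_def)
  define t :: "complex fps" where "t = fps_X ^ k oo fps_X ^ N"
  have t: "t = fps_X ^ (k * N)"
    using N(1) unfolding t_def by (intro fps_ext) (auto simp: compose_xpow_nth fps_X_power_nth)
  have len: "length ys = degree q"
  proof -
    have "degree (stretch_poly N q) = degree q"
      unfolding stretch_poly_def using N(1)
      by (cases "q = 0") (auto intro!: map_poly_degree_eq simp: fps_compose_eq_0_iff)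
    then show ?thesis using N(2) by simp
  qed
  have "stretch_poly N (smult (fps_X ^ (k * degree q)) q) = smult (t ^ degree q) (lin_prod ys)"
  proof -
    have "stretch_poly N (smult (fps_X ^ (k * degree q)) q) = smult (fps_X ^ (k * degree q) oo fps_X ^ N) (stretch_poly N q)"
      using N(1) by (intro poly_eqI) (simp add: coeff_stretch_poly fps_compose_mult_distrib)
    moreover have "fps_X ^ (k * degree q) oo fps_X ^ N = t ^ degree q"
      using N(1) by (simp add: power_mult t_def fps_compose_power)
    ultimately show ?thesis using N(2) by simp
  qed
  moreover have "stretch_poly N (p \<circ>\<^sub>p [:0, fps_X ^ k:]) = stretch_poly N p \<circ>\<^sub>p [:0, t:]"
    using N(1) by (simp add: stretch_poly_hom stretch_poly_linear t_def)
  ultimately have comp: "stretch_poly N p \<circ>\<^sub>p [:0, t:] = lin_prod (map (\<lambda>y. t * y) ys) \<circ>\<^sub>p [:0, t:]"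
    unfolding lin_prod_scale len eq by simp
  have "coeff (stretch_poly N p) i = coeff (lin_prod (map (\<lambda>y. t * y) ys)) i" for i
    using arg_cong[OF comp, of "\<lambda>p. coeff p i"] unfolding coeff_pcompose_linear by (simp add: t)
  then have "stretch_poly N p = lin_prod (map (\<lambda>y. t * y) ys)"
    by (rule poly_eqI)
  then show ?thesis
    unfolding puiseux_splits_def using N(1) by blast
qed

lemma puiseux_splits_stretch_poly:
  assumes "M > 0" "puiseux_splits (stretch_poly M p)"
  shows "puiseux_splits p"
  using assms unfolding puiseux_splits_def by (metis stretch_poly_stretch_poly nat_0_less_mult_iff)

text \<open>The two top coefficients under a translation are used twice in
  \<open>newton_puiseux\<close>: to remove the second one, and to locate the root of a perfect
  power.\<close>

lemma coeff_pcompose_shift: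
  fixes p :: "'a :: comm_ring_1 poly"
  assumes "degree p \<le> d"
  shows "coeff (p \<circ>\<^sub>p [:b, 1:]) d = coeff p d"
    and "d > 0 \<Longrightarrow> coeff (p \<circ>\<^sub>p [:b, 1:]) (d - 1) = coeff p (d - 1) + of_nat d * b * coeff p d"
proof -
  have deg: "degree (p \<circ>\<^sub>p [:b, 1:]) \<le> degree p" for p :: "'a poly"
    using degree_pcompose_le[of p "[:b, 1:]"] by simp
  have *: "coeff (p \<circ>\<^sub>p [:b, 1:]) d = coeff p d \<and>
      (d > 0 \<longrightarrow> coeff (p \<circ>\<^sub>p [:b, 1:]) (d - 1) = coeff p (d - 1) + of_nat d * b * coeff p d)"
    using assms
  proof (induction p arbitrary: d)
    case (pCons c q)
    show ?case
    proof (cases d)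
      case 0
      then have "q = 0" using pCons.prems by (auto split: if_splits)
      then show ?thesis using 0 by (simp add: pcompose_pCons)
    next
      case (Suc e)
      have "degree q \<le> e" using pCons.prems Suc by (auto split: if_splits)
      have IH: "coeff (q \<circ>\<^sub>p [:b, 1:]) e = coeff q e"
        "e > 0 \<Longrightarrow> coeff (q \<circ>\<^sub>p [:b, 1:]) (e - 1) = coeff q (e - 1) + of_nat e * b * coeff q e"
        using pCons.IH[OF \<open>degree q \<le> e\<close>] by auto
      have 0: "coeff (q \<circ>\<^sub>p [:b, 1:]) (Suc e) = 0"
        using deg[of q] \<open>degree q \<le> e\<close> by (intro coeff_eq_0) simp
      show ?thesis
        using IH 0 by (cases e) (auto simp: Suc pcompose_pCons coeff_pCons algebra_simps split: nat.splits)
    qed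
  qed simp
  show "coeff (p \<circ>\<^sub>p [:b, 1:]) d = coeff p d"
    and "d > 0 \<Longrightarrow> coeff (p \<circ>\<^sub>p [:b, 1:]) (d - 1) = coeff p (d - 1) + of_nat d * b * coeff p d"
    using * by auto
qed

lemma linear_power_shift:
  "([:- c, 1:] ^ m) \<circ>\<^sub>p [:c, 1:] = (monom 1 m :: 'a :: comm_ring_1 poly)"
proof (induction m)
  case (Suc m)
  have "[:- c, 1:] \<circ>\<^sub>p [:c, 1:] = [:0, 1:]" by (simp add: pcompose_pCons)
  then show ?case
    by (simp only: power_Suc pcompose_mult Suc.IH) (simp add: monom_Suc)
qed (simp add: pcompose_1)

text \<open>Dividing \<open>y^d\<close> by \<open>f\<close> makes \<open>q f\<close> a monic
  polynomial of degree \<open>d\<close>. At \<open>x = 0\<close> its order is at most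
  \<open>d\<close>, while \<open>f\<close> alone already has order \<open>d\<close>; so
  \<open>q\<close> is a unit and the lower coefficients vanish there.\<close>

lemma weierstrass_preparation:
  assumes f: "yreg d f"
  obtains q P where "coeff2 q 0 0 \<noteq> 0" "fps_of_poly P = q * f" "lead_coeff P = 1" "degree P = d"
    "\<And>j. j < d \<Longrightarrow> fps_nth (coeff P j) 0 = 0"
proof -
  obtain q where q: "\<And>j. j \<ge> d \<Longrightarrow> fps_nth (yy ^ d - q * f) j = 0"
    using weierstrass_division[OF f] by metis
  define P where "P = truncate_fps (Suc d) (q * f)"
  have nth: "fps_nth (q * f) j = (if j = d then 1 else 0)" if "j \<ge> d" for j
    using q[OF that] by (auto simp: fps_X_power_nth split: if_splits)
  have P: "fps_of_poly P = q * f"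
    using nth by (intro fps_ext) (auto simp: P_def)
  have cd: "coeff P d = 1" using nth[of d] by (simp add: P_def)
  have "degree P = d"
    by (rule antisym) (use cd in \<open>auto simp: P_def coeff_truncate_fps intro!: degree_le le_degree\<close>)
  have f0: "ev0 f \<noteq> 0" "subdegree (ev0 f) = d" using f by (auto simp: yreg_iff_ev0)
  have W: "ev0 (q * f) = ev0 q * ev0 f" by (rule ev0_simps)
  have "fps_nth (ev0 (q * f)) d = 1" using nth[of d] by (simp add: coeff2_def)
  then have nz: "ev0 (q * f) \<noteq> 0" by (metis fps_zero_nth zero_neq_one)
  then have sub: "subdegree (ev0 (q * f)) = subdegree (ev0 q) + d"
    using W f0 by auto
  moreover have "subdegree (ev0 (q * f)) \<le> d"
    by (rule subdegree_leI) (use \<open>fps_nth (ev0 (q * f)) d = 1\<close> in simp)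
  ultimately have "subdegree (ev0 q) = 0" by simp
  moreover have "ev0 q \<noteq> 0" using nz W by auto
  ultimately have "coeff2 q 0 0 \<noteq> 0" by (metis ev0_nth nth_subdegree_nonzero)
  moreover have "fps_nth (coeff P j) 0 = 0" if "j < d" for j
  proof -
    have "fps_nth (ev0 (q * f)) j = 0" using that sub by (intro nth_less_subdegree_zero) simp
    then show ?thesis using that by (simp add: P_def coeff2_def)
  qed
  ultimately show ?thesis
    using that[of q P] P cd \<open>degree P = d\<close> by simp
qed

text \<open>A series regular in \<open>y\<close> is not divisible by \<open>x\<close>, so the power
  of \<open>x\<close> and the cofactor are both determined.\<close>

lemma xpow_mult_yreg_eq:
  assumes "xx ^ a * u = xx ^ b * v" "yreg m u" "yreg n v"
  shows "m = n"
proof -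
  have le: "a \<le> b" if "xx ^ a * u = xx ^ b * v" "yreg n v" for a b u v n
  proof (rule ccontr)
    assume "\<not> a \<le> b"
    then have "coeff2 (xx ^ b * v) b n = 0"
      unfolding that(1)[symmetric] by (simp add: coeff2_xpow_mult)
    then show False using that(2) by (simp add: coeff2_xpow_mult yreg_def)
  qed
  have "a = b" using le[OF assms(1,3)] le[OF assms(1)[symmetric] assms(2)] by simp
  then have "u = v" using assms(1) by simp
  then show ?thesis using assms(2,3) by (auto simp: yreg_iff_ev0)
qed

text \<open>Hensel's lemma for the factor \<open>y\<^sup>m\<close>: the Weierstrass polynomial of \<open>Q\<close> divides \<open>Q\<close> as a polynomial,
  since the remainder of the polynomial division has too small a \<open>y\<close>-order to be divisible by \<open>Q\<close>.\<close>
lemma hensel_factor: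
  fixes Q :: "complex fps poly"
  assumes Q: "lead_coeff Q = 1" and low: "\<And>j. j < m \<Longrightarrow> fps_nth (coeff Q j) 0 = 0"
    and m: "fps_nth (coeff Q m) 0 \<noteq> 0"
  obtains W V where "Q = W * V" "lead_coeff W = 1" "degree W = m" "lead_coeff V = 1" "degree Q = m + degree V"
proof -
  define F where "F = fps_of_poly Q"
  have F: "yreg m F" using low m by (auto simp: yreg_def F_def coeff2_def)
  obtain q W where W: "fps_of_poly W = q * F" "lead_coeff W = 1" "degree W = m"
    by (rule weierstrass_preparation[OF F])
  have "W \<noteq> 0" using W(2) by auto
  \<comment> \<open>Since \<open>W\<close> is monic, pseudo-division is ordinary division with
    remainder.\<close>
  obtain V \<rho> where V: "pseudo_divmod Q W = (V, \<rho>)" by fastforce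
  have QV: "Q = W * V + \<rho>" and deg: "\<rho> = 0 \<or> degree \<rho> < m"
    using pseudo_divmod[OF \<open>W \<noteq> 0\<close> V] W by auto
  have "\<rho> = 0"
  proof (rule ccontr)
    assume "\<rho> \<noteq> 0"
    define r where "r = fps_of_poly \<rho>"
    have "F = fps_of_poly W * fps_of_poly V + r"
      unfolding r_def F_def by (subst QV) (simp add: fps_of_poly_mult fps_of_poly_add)
    then have "F = q * F * fps_of_poly V + r"
      by (simp only: W(1))
    then have rF: "r = F * (1 - q * fps_of_poly V)"
      by (simp add: algebra_simps)
    have "r \<noteq> 0" using \<open>\<rho> \<noteq> 0\<close> using fps_of_poly_eq_iff[of \<rho> 0] by (simp add: r_def)
    then obtain k r1 e where r1: "r = xx ^ k * r1" "yreg e r1"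
      "\<And>j. fps_nth r j = 0 \<Longrightarrow> fps_nth r1 j = 0"
      using xx_part by metis
    have "1 - q * fps_of_poly V \<noteq> 0" using \<open>r \<noteq> 0\<close> rF by auto
    then obtain k' z e' where z: "1 - q * fps_of_poly V = xx ^ k' * z" "yreg e' z"
      by (rule xx_part)
    have "xx ^ k' * (F * z) = xx ^ k * r1"
      using rF r1(1) z(1) by (simp add: mult_ac)
    then have "m + e' = e"
      by (rule xpow_mult_yreg_eq[OF _ yreg_mult[OF F z(2)] r1(2)])
    moreover have "e < m"
    proof (rule ccontr)
      assume "\<not> e < m"
      then have "fps_nth r e = 0"
        using deg \<open>\<rho> \<noteq> 0\<close> by (simp add: r_def coeff_eq_0)
      then show False using r1(2,3) by (simp add: yreg_def coeff2_def)
    qed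
    ultimately show False by simp
  qed
  then have QWV: "Q = W * V" using QV by simp
  have "lead_coeff V = 1" using Q W(2) unfolding QWV lead_coeff_mult by simp
  moreover have "degree Q = m + degree V"
    using \<open>lead_coeff V = 1\<close> \<open>W \<noteq> 0\<close> W(3) unfolding QWV by (subst degree_mult_eq) auto
  ultimately show ?thesis using QWV W that by blast
qed

lemma fps_poly_of_coeffs:
  obtains q :: "complex fps poly" where "\<And>j. coeff q j = (if j \<le> d then b j else 0)"
  by (rule that[of "truncate_fps (Suc d) (Abs_fps b)"]) (auto simp: coeff_truncate_fps)

text \<open>After a translation and a weighted rescaling, the reduction \<open>q0\<close> at
  \<open>x = 0\<close> has two distinct roots; Hensel's lemma then gives a proper factorization, to
  which induction on the degree applies.\<close>

theorem newton_puiseux: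
  fixes p :: "complex fps poly"
  assumes "lead_coeff p = 1"
  shows "puiseux_splits p"
  using assms
proof (induction "degree p" arbitrary: p rule: less_induct)
  case less
  define d where "d = degree p"
  show ?case
  proof (cases "d = 0")
    case True
    then have "p = 1" using less.prems by (metis d_def degree_eq_zeroE lead_coeff_pCons(2) pCons_one)
    then show ?thesis by (auto simp: puiseux_splits_def intro!: exI[of _ 1] exI[of _ "[]"])
  next
    case False
    \<comment> \<open>The Tschirnhaus translation, which removes the coefficient of degree
      \<open>d - 1\<close>.\<close>
    define a where "a = - (fps_const (inverse (of_nat d)) * coeff p (d - 1))"
    define p1 where "p1 = p \<circ>\<^sub>p [:a, 1:]"
    have pd: "coeff p d = 1" using less.prems by (simp add: d_def)
    have p1: "degree p1 = d" "coeff p1 d = 1" "coeff p1 (d - 1) = 0"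
    proof -
      show "degree p1 = d" by (simp add: p1_def degree_pcompose d_def)
      show "coeff p1 d = 1" using coeff_pcompose_shift(1)[of p d a] pd by (simp add: p1_def d_def)
      have "of_nat d * a = - coeff p (d - 1)"
        using False unfolding a_def fps_of_nat[symmetric] mult_minus_right mult.assoc[symmetric] fps_const_mult
        by simp
      then show "coeff p1 (d - 1) = 0"
        using coeff_pcompose_shift(2)[of p d a] pd False by (simp add: p1_def d_def)
    qed
    have "puiseux_splits p1"
    proof (cases "\<forall>j<d. coeff p1 j = 0")
      case True
      have "p1 = monom 1 d"
        using True p1 by (intro poly_eqI) (metis coeff_monom le_degree linorder_neqE_nat not_le)
      also have "\<dots> = lin_prod (replicate d 0)"
        by (simp add: lin_prod_def monom_altdef prod_list_replicate)
      finally have "stretch_poly 1 p1 = lin_prod (map (\<lambda>y. y oo fps_X ^ 1) (replicate d 0))"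
        using stretch_poly_lin_prod[of 1 "replicate d 0"] by (metis zero_less_one)
      then show ?thesis unfolding puiseux_splits_def by (metis zero_less_one)
    next
      case False
      \<comment> \<open>Every \<open>d - j\<close> divides \<open>d!\<close>, so after substituting
        \<open>x^M\<close> the slopes \<open>s j\<close> of the Newton polygon are integers.\<close>
      define M where "M = (fact d :: nat)"
      have "M > 0" by (simp add: M_def)
      define p2 where "p2 = stretch_poly M p1"
      define A where "A = {j. j < d \<and> coeff p1 j \<noteq> 0}"
      define s where "s j = subdegree (coeff p1 j) * (M div (d - j))" for j
      have A: "finite A" "A \<noteq> {}" using False by (auto simp: A_def)
      \<comment> \<open>The minimal slope, so that the coefficients can be rescaled to power series
        \<open>b j\<close>, among which \<open>b j0\<close> is a unit.\<close>
      define k where "k = Min (s ` A)"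
      have "k \<in> s ` A" unfolding k_def using A by (intro Min_in) auto
      then obtain j0 where j0: "j0 \<in> A" "k = s j0" by blast
      have kle: "k \<le> s j" if "j \<in> A" for j unfolding k_def using A that by (intro Min_le) auto
      have sub: "subdegree (coeff p2 j) = s j * (d - j)" "coeff p2 j \<noteq> 0" if "j \<in> A" for j
      proof -
        have "d - j dvd M" unfolding M_def using that by (intro dvd_fact) (auto simp: A_def)
        moreover have nz: "coeff p1 j \<noteq> 0" using that by (simp add: A_def)
        ultimately show "subdegree (coeff p2 j) = s j * (d - j)"
          using \<open>M > 0\<close> by (simp add: p2_def coeff_stretch_poly s_def mult.assoc)
        show "coeff p2 j \<noteq> 0"
          using nz \<open>M > 0\<close> by (simp add: p2_def coeff_stretch_poly fps_compose_eq_0_iff)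
      qed
      define b where "b j = fps_shift (k * (d - j)) (coeff p2 j)" for j
      have b: "coeff p2 j = fps_X ^ (k * (d - j)) * b j" if "j \<le> d" for j
      proof (cases "coeff p2 j = 0")
        case False
        then have "k * (d - j) \<le> subdegree (coeff p2 j)"
        proof (cases "j \<in> A")
          case True
          then show ?thesis using sub kle by simp
        next
          case False
          then have "j = d \<or> coeff p1 j = 0" using that by (auto simp: A_def)
          then show ?thesis using \<open>coeff p2 j \<noteq> 0\<close> by (auto simp: p2_def coeff_stretch_poly)
        qed
        then show ?thesis
          unfolding b_def by (simp add: fps_conv_fps_X_power_mult_fps_shift)
      qed (simp add: b_def)
      obtain q where q: "\<And>j. coeff q j = (if j \<le> d then b j else 0)"
        using fps_poly_of_coeffs by blast
      have p2d: "degree p2 \<le> d"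
        by (rule degree_le) (use p1(1) in \<open>auto simp: p2_def coeff_stretch_poly coeff_eq_0\<close>)
      have qd: "coeff q d = 1" by (simp add: q b_def p2_def coeff_stretch_poly p1(2))
      have dq: "degree q = d"
        by (rule antisym) (use qd in \<open>auto simp: q intro!: degree_le le_degree\<close>)
      have scale: "p2 \<circ>\<^sub>p [:0, fps_X ^ k:] = smult (fps_X ^ (k * degree q)) q"
      proof (rule poly_eqI)
        fix j
        show "coeff (p2 \<circ>\<^sub>p [:0, fps_X ^ k:]) j = coeff (smult (fps_X ^ (k * degree q)) q) j"
        proof (cases "j \<le> d")
          case True
          then have "k * j + k * (d - j) = k * d" by (simp flip: add_mult_distrib2)
          then show ?thesis
            using True b[OF True]
            by (simp add: coeff_pcompose_linear dq q power_mult[symmetric] mult.assoc[symmetric] power_add[symmetric])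
        next
          case False
          then show ?thesis using p2d by (simp add: coeff_pcompose_linear dq q coeff_eq_0)
        qed
      qed
      define q0 where "q0 = map_poly (\<lambda>a. fps_nth a 0) q"
      have q0c: "coeff q0 j = fps_nth (coeff q j) 0" for j by (simp add: q0_def coeff_map_poly)
      have q0d: "degree q0 = d"
      proof (rule antisym)
        show "degree q0 \<le> d" by (rule degree_le) (simp add: q0c q)
        show "d \<le> degree q0" by (rule le_degree) (simp add: q0c qd)
      qed
      have "q0 \<noteq> 0" using q0d \<open>d \<noteq> 0\<close> by auto
      obtain c where c: "poly q0 c = 0"
        using alg_closed_imp_poly_has_root[of q0] q0d \<open>d \<noteq> 0\<close> by auto
      define m where "m = order c q0"
      obtain R where R: "q0 = [:- c, 1:] ^ m * R" "\<not> [:- c, 1:] dvd R"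
        using order_decomp[OF \<open>q0 \<noteq> 0\<close>, of c] by (auto simp: m_def)
      have "m > 0" using c \<open>q0 \<noteq> 0\<close> by (auto simp: m_def order_root)
      have "R \<noteq> 0" using R \<open>q0 \<noteq> 0\<close> by auto
      have deg_m: "d = m + degree R"
        using \<open>R \<noteq> 0\<close> unfolding q0d[symmetric] R(1) by (subst degree_mult_eq) (auto simp: degree_power_eq)
      \<comment> \<open>Otherwise \<open>q0\<close> is a multiple of \<open>(y - c)^d\<close>. Its
        vanishing coefficient in degree \<open>d - 1\<close> forces \<open>c = 0\<close>, contrary
        to the nonzero coefficient at \<open>j0\<close>.\<close>
      have "m < d"
      proof (rule ccontr)
        assume "\<not> m < d"
        then have "m = d" "degree R = 0" using deg_m by auto
        then obtain t where t: "R = [:t:]" by (metis degree_eq_zeroE)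
        have "q0 \<circ>\<^sub>p [:c, 1:] = monom t d"
        proof -
          show ?thesis unfolding R(1) t \<open>m = d\<close>
            by (simp add: pcompose_mult pcompose_smult linear_power_shift smult_monom)
        qed
        then have 1: "coeff (q0 \<circ>\<^sub>p [:c, 1:]) (d - 1) = 0" using \<open>d \<noteq> 0\<close> by simp
        have "coeff p2 (d - 1) = 0" unfolding p2_def coeff_stretch_poly p1(3) by simp
        then have "coeff q0 (d - 1) = 0" by (simp add: q0c q b_def)
        moreover have "coeff q0 d = 1" by (simp add: q0c qd)
        ultimately have "of_nat d * c = 0"
          using 1 coeff_pcompose_shift(2)[of q0 d c] q0d \<open>d \<noteq> 0\<close> by simp
        then have "c = 0" using \<open>d \<noteq> 0\<close> by simp
        then have "q0 = monom t d" using \<open>q0 \<circ>\<^sub>p [:c, 1:] = monom t d\<close> by simp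
        then have "coeff q0 j0 = 0" using j0(1) by (auto simp: A_def)
        moreover have "coeff q0 j0 \<noteq> 0"
        proof -
          have "j0 \<le> d" using j0(1) by (simp add: A_def)
          then show ?thesis
            using sub[OF j0(1)] j0(2) by (simp add: q0c q b_def) (metis nth_subdegree_nonzero)
        qed
        ultimately show False by simp
      qed
      \<comment> \<open>Moving the root \<open>c\<close> to 0 turns the factor to be lifted into
        \<open>y^m\<close>.\<close>
      define Q where "Q = q \<circ>\<^sub>p [:fps_const c, 1:]"
      have "map_poly (\<lambda>a. fps_nth a 0) Q = q0 \<circ>\<^sub>p [:c, 1:]"
        unfolding Q_def q0_def by (subst map_poly_hom) (auto simp: map_poly_pCons)
      then have Q0: "fps_nth (coeff Q j) 0 = coeff (q0 \<circ>\<^sub>p [:c, 1:]) j" for j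
        by (metis coeff_map_poly fps_zero_nth)
      have q0m: "q0 \<circ>\<^sub>p [:c, 1:] = monom 1 m * (R \<circ>\<^sub>p [:c, 1:])"
        unfolding R(1) by (simp only: pcompose_mult linear_power_shift)
      have Q_lead: "lead_coeff Q = 1" and Q_deg: "degree Q = d"
        using coeff_pcompose_shift(1)[of q d "fps_const c"] qd dq by (auto simp: Q_def degree_pcompose)
      have "fps_nth (coeff Q j) 0 = 0" if "j < m" for j
        using that by (simp add: Q0 q0m coeff_monom_mult)
      moreover have "fps_nth (coeff Q m) 0 \<noteq> 0"
        using R(2) by (simp add: Q0 q0m coeff_monom_mult pcompose_coeff_0 poly_eq_0_iff_dvd)
      ultimately obtain W V where WV: "Q = W * V" "lead_coeff W = 1" "degree W = m"
          "lead_coeff V = 1" "degree Q = m + degree V"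
        using hensel_factor[OF Q_lead] by metis
      have "puiseux_splits W" using less.hyps[of W] WV \<open>m < d\<close> by (simp add: d_def)
      moreover have "puiseux_splits V"
        using less.hyps[of V] WV \<open>m > 0\<close> Q_deg by (simp add: d_def)
      ultimately have "puiseux_splits Q" unfolding WV(1) by (rule puiseux_splits_mult)
      then have "puiseux_splits q" unfolding Q_def by (rule puiseux_splits_shift)
      then have "puiseux_splits p2" by (rule puiseux_splits_scale[OF scale])
      then show ?thesis unfolding p2_def by (rule puiseux_splits_stretch_poly[OF \<open>M > 0\<close>])
    qed
    then show ?thesis unfolding p1_def by (rule puiseux_splits_shift)
  qed
qed

subsection \<open>Branches\<close>

text \<open>A branch is encoded by the evaluation of power series along a parametrized curve
  \<open>s \<mapsto> (e x, e y)\<close>; only its homomorphism properties and the chain rule are kept.\<close>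
definition branch :: "(ps2 \<Rightarrow> complex fps) \<Rightarrow> bool" where
  "branch e \<longleftrightarrow> (\<forall>a b. e (a + b) = e a + e b) \<and> (\<forall>a b. e (a * b) = e a * e b) \<and>
     (\<forall>c. e (sc c) = fps_const c) \<and> (\<forall>h. fps_nth (e h) 0 = coeff2 h 0 0) \<and>
     (\<forall>h. fps_deriv (e h) = e (dx h) * fps_deriv (e xx) + e (dy h) * fps_deriv (e yy)) \<and>
     (e xx \<noteq> 0 \<or> e yy \<noteq> 0)"

lemma branchD:
  assumes "branch e"
  shows "e (a + b) = e a + e b" "e (a * b) = e a * e b" "e (sc c) = fps_const c"
    "fps_nth (e h) 0 = coeff2 h 0 0"
    "fps_deriv (e h) = e (dx h) * fps_deriv (e xx) + e (dy h) * fps_deriv (e yy)"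
    "e xx \<noteq> 0 \<or> e yy \<noteq> 0" "e 0 = 0" "e 1 = 1" "e (- a) = - e a" "e (a - b) = e a - e b"
    "e (a ^ n) = e a ^ n"
proof -
  show add: "e (a + b) = e a + e b" and mult: "e (a * b) = e a * e b" and sc: "e (sc c) = fps_const c"
    and "fps_nth (e h) 0 = coeff2 h 0 0"
    "fps_deriv (e h) = e (dx h) * fps_deriv (e xx) + e (dy h) * fps_deriv (e yy)"
    "e xx \<noteq> 0 \<or> e yy \<noteq> 0" for a b c h
    using assms unfolding branch_def by blast+
  show e0: "e 0 = 0" and e1: "e 1 = 1" using sc[of 0] sc[of 1] by auto
  show minus: "e (- a) = - e a" for a
    using add[of a "- a"] e0 by (simp add: eq_neg_iff_add_eq_0 add.commute)
  show "e (a - b) = e a - e b" using add[of a "- b"] minus[of b] by simp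
  show "e (a ^ n) = e a ^ n" by (induction n) (simp_all add: e1 mult)
qed

lemma branch_ev0: "branch ev0"
  unfolding branch_def by (simp add: ev0_simps)

lemma branch_evy:
  assumes N: "N > 0" and Y: "fps_nth Y 0 = 0"
  shows "branch (\<lambda>h. evy Y (stretch N h))"
proof -
  have xx: "evy Y (stretch N xx) = fps_X ^ N"
    using N by (simp add: xx_def stretch_simps evy_const[OF Y] fps_X_fps_compose_startby0)
  have yy: "evy Y (stretch N yy) = Y"
    using N by (simp add: stretch_simps evy_yy[OF Y])
  have "fps_nth (evy Y (stretch N h)) 0 = coeff2 h 0 0" for h
    using N by (simp add: evy_nth_0[OF Y] coeff2_stretch)
  moreover have "fps_deriv (evy Y (stretch N h))
      = evy Y (stretch N (dx h)) * fps_deriv (evy Y (stretch N xx)) + evy Y (stretch N (dy h)) * fps_deriv (evy Y (stretch N yy))" for h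
    unfolding xx yy by (simp add: evy_deriv[OF Y] dx_stretch[OF N] dy_stretch[OF N] evy_mult[OF Y] evy_const[OF Y])
  moreover have "evy Y (sc c) = fps_const c" for c
    by (simp add: sc_def evy_const[OF Y])
  ultimately show ?thesis
    unfolding branch_def using N xx by (simp add: stretch_simps evy_add[OF Y] evy_mult[OF Y])
qed

lemma ford_simps:
  "ford 0 = \<infinity>" "ford (a * b) = ford a + ford b" "ford 1 = 0"
  by (auto simp: ford_def zero_enat_def)

lemma fps_of_poly_lin_prod: "fps_of_poly (lin_prod ys) = prod_list (map (\<lambda>y. yy - fps_const y) ys)"
  by (induction ys) (simp_all add: fps_of_poly_mult fps_of_poly_pCons del: mult_pCons_left)

lemma stretch_fps_of_poly: "stretch N (fps_of_poly P) = fps_of_poly (stretch_poly N P)"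
  by (rule fps_ext) (simp add: stretch_def coeff_stretch_poly)

lemma puiseux_factorization:
  assumes f: "yreg d f"
  obtains N u ys where "N > 0" "coeff2 u 0 0 \<noteq> 0" "length ys = d" "\<forall>y\<in>set ys. fps_nth y 0 = 0"
    "stretch N f = u * prod_list (map (\<lambda>y. yy - fps_const y) ys)"
proof -
  obtain q P where q: "coeff2 q 0 0 \<noteq> 0" "fps_of_poly P = q * f" "lead_coeff P = 1" "degree P = d"
    "\<And>j. j < d \<Longrightarrow> fps_nth (coeff P j) 0 = 0"
    using weierstrass_preparation[OF f] by metis
  obtain N ys where N: "N > 0" "stretch_poly N P = lin_prod ys"
    using newton_puiseux[OF q(3)] by (auto simp: puiseux_splits_def)
  obtain v where v: "q * v = 1" using ps2_inverse[OF q(1)] by metis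
  have "stretch N f = stretch N v * stretch N (q * f)"
    using v by (simp add: stretch_simps(3)[OF N(1), symmetric] mult.assoc[symmetric] mult.commute[of v])
  also have "stretch N (q * f) = prod_list (map (\<lambda>y. yy - fps_const y) ys)"
    unfolding q(2)[symmetric] stretch_fps_of_poly N(2) fps_of_poly_lin_prod ..
  finally have eq: "stretch N f = stretch N v * prod_list (map (\<lambda>y. yy - fps_const y) ys)" .
  have "coeff2 q 0 0 * coeff2 v 0 0 = coeff2 (q * v) 0 0" by simp
  then have "coeff2 v 0 0 \<noteq> 0" unfolding v by auto
  then have unit: "coeff2 (stretch N v) 0 0 \<noteq> 0" using N(1) by (simp add: coeff2_stretch)
  have len: "length ys = d"
  proof -
    have "degree (stretch_poly N P) = degree P"
      unfolding stretch_poly_def using N(1)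
      by (cases "P = 0") (auto intro!: map_poly_degree_eq simp: fps_compose_eq_0_iff)
    then show ?thesis using N(2) q(4) by simp
  qed
  \<comment> \<open>At \<open>x = 0\<close> the Weierstrass polynomial reduces to
    \<open>y^d\<close>, whose only root is 0.\<close>
  have zero: "fps_nth y 0 = 0" if "y \<in> set ys" for y
  proof -
    have "d > 0" using len that by (cases ys) auto
    let ?g = "\<lambda>a :: complex fps. fps_nth a 0"
    have "map_poly ?g (stretch_poly N P) = monom 1 d"
    proof (rule poly_eqI)
      fix j
      have "coeff P d = 1" using q(3,4) by simp
      then show "coeff (map_poly ?g (stretch_poly N P)) j = coeff (monom 1 d) j"
        using q(4,5) by (cases j d rule: linorder_cases) (auto simp: coeff_map_poly coeff_stretch_poly coeff_eq_0)
    qed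
    then have "poly (map_poly ?g (lin_prod ys)) (?g y) = ?g y ^ d"
      unfolding N(2) by (simp add: poly_monom)
    moreover have "poly (map_poly ?g (lin_prod ys)) (?g y) = 0"
      using that
    proof (induction ys)
      case (Cons z zs)
      have "map_poly ?g (lin_prod (z # zs)) = map_poly ?g [:- z, 1:] * map_poly ?g (lin_prod zs)"
        unfolding lin_prod_simps by (rule map_poly_hom) simp_all
      then show ?case using Cons by (auto simp: map_poly_pCons)
    qed simp
    ultimately show ?thesis using \<open>d > 0\<close> by simp
  qed
  show ?thesis
    by (rule that[OF N(1) unit len _ eq]) (use zero in auto)
qed

lemma inum_prod_list:
  "inum h (prod_list (map (\<lambda>y. yy - fps_const y) ys)) = (\<Sum>y\<leftarrow>ys. inum h (yy - fps_const y))"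
  by (induction ys) (simp_all add: inum_unit inum_mult)

lemma enat_mult_replicate: "(\<Sum>e\<leftarrow>replicate n f. g e) = enat n * (g f :: enat)"
proof (induction n)
  case (Suc n)
  then show ?case by (cases "g f") (auto simp: times_enat_def split: if_splits)
qed (simp add: zero_enat_def[symmetric])

text \<open>\<open>C\<close> is a power of \<open>x\<close> times a series that becomes a unit times
  a product of graphs under \<open>x = s^N\<close>. Multiplicities are expressed by repetition in
  the list, and the factor \<open>N\<close> comes from \<open>inum_stretch\<close>.\<close>

theorem branch_formula:
  assumes "C \<noteq> 0"
  obtains N n :: nat and e where "N > 0" "\<forall>k<n. branch (e k)" "\<forall>k<n. e k C = 0"
    "\<forall>h. enat N * inum h C = (\<Sum>k<n. ford (e k h))"
proof -
  obtain m C1 d where C1: "C = xx ^ m * C1" "yreg d C1"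
    using xx_part[OF assms] by metis
  obtain N u ys where N: "N > 0" and u: "coeff2 u 0 0 \<noteq> 0" and ys: "\<forall>y\<in>set ys. fps_nth y 0 = 0"
    and eq: "stretch N C1 = u * prod_list (map (\<lambda>y. yy - fps_const y) ys)"
    using puiseux_factorization[OF C1(2)] by metis
  \<comment> \<open>The order along \<open>x = 0\<close> is measured without stretching, hence
    \<open>N * m\<close> copies instead of \<open>m\<close>.\<close>
  define es where "es = replicate (N * m) ev0 @ map (\<lambda>y h. evy y (stretch N h)) ys"
  have br: "branch e" "e C = 0" if "e \<in> set es" for e
  proof -
    have *: "(e = ev0 \<and> m > 0) \<or> (\<exists>y\<in>set ys. e = (\<lambda>h. evy y (stretch N h)))"
      using that by (auto simp: es_def split: if_splits)
    then show "branch e" using branch_ev0 branch_evy[OF N] ys by auto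
    have "evy y (stretch N C) = 0" if "y \<in> set ys" for y
    proof -
      have Y: "fps_nth y 0 = 0" using ys that by auto
      have "yy - fps_const y dvd prod_list (map (\<lambda>y. yy - fps_const y) ys)"
        using that by (induction ys) auto
      then obtain w where "prod_list (map (\<lambda>y. yy - fps_const y) ys) = (yy - fps_const y) * w" by (rule dvdE)
      then have "stretch N C = (yy - fps_const y) * (w * u * stretch N (xx ^ m)) + fps_const 0"
        by (simp add: C1(1) stretch_simps[OF N] eq mult_ac)
      then show ?thesis by (rule evy_unique[OF Y])
    qed
    moreover have "ev0 C = 0" if "m > 0"
      using that by (cases m) (simp_all add: C1(1) ev0_simps)
    ultimately show "e C = 0" using * by auto
  qed
  have formula: "enat N * inum h C = (\<Sum>e\<leftarrow>es. ford (e h))" for h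
  proof -
    have "enat N * inum h C = enat N * (enat m * inum h xx) + enat N * inum h C1"
      by (simp add: C1(1) inum_mult inum_power distrib_left)
    also have "enat N * inum h C1 = inum (stretch N h) (stretch N C1)"
      by (simp add: inum_stretch[OF N])
    also have "\<dots> = (\<Sum>y\<leftarrow>ys. inum (stretch N h) (yy - fps_const y))"
      by (simp add: eq inum_mult_unit[OF u] inum_prod_list)
    also have "\<dots> = (\<Sum>y\<leftarrow>ys. ford (evy y (stretch N h)))"
      using ys by (intro arg_cong[where f = sum_list] map_cong refl inum_graph) auto
    also have "enat N * (enat m * inum h xx) = (\<Sum>e\<leftarrow>replicate (N * m) ev0. ford (e h))"
      by (simp add: enat_mult_replicate[where n = "N * m" and g = "\<lambda>e. ford (e h)"] inum_xx mult.assoc[symmetric] del: map_replicate)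
    finally show ?thesis by (simp add: es_def o_def del: map_replicate)
  qed
  show ?thesis
  proof (rule that[of N "length es" "\<lambda>k. es ! k"])
    show "\<forall>h. enat N * inum h C = (\<Sum>k<length es. ford ((es ! k) h))"
      unfolding formula by (simp add: sum_list_sum_nth atLeast0LessThan)
  qed (use N br in auto)
qed

text \<open>Finiteness puts powers of \<open>x\<close> and \<open>y\<close> into the ideal; a branch
  on which the ideal vanishes would send both \<open>x\<close> and \<open>y\<close> to 0.\<close>

lemma branch_not_both_0:
  assumes e: "branch e" and fin: "inum h k \<noteq> \<infinity>" and "e h = 0" "e k = 0"
  shows False
proof -
  obtain p where p: "xx ^ p \<in> idl UNIV h k" "yy ^ p \<in> idl UNIV h k"
    using finite_dim_imp_powers[of UNIV h k] fin by (auto simp: inum_def)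
  have "e w = 0" if "w \<in> idl UNIV h k" for w
    using that assms by (auto simp: idl_def branchD[OF e])
  from this[OF p(1)] this[OF p(2)] show False
    using branchD(6)[OF e] by (simp add: branchD(11)[OF e])
qed

text \<open>If the Jacobian vanishes, \<open>g\<close> is constant along a branch of
  \<open>f\<close>, hence zero there, against the finiteness of i(f, g). The gradient of
  \<open>f\<close> vanishes along a multiple branch, so the power \<open>p ^ (m - 1)\<close> has to
  be divided out first.\<close>

lemma jacobian_neq_0:
  assumes fin: "inum f g \<noteq> \<infinity>" and f: "yreg d f" "coeff2 f 0 0 = 0" and g0: "coeff2 g 0 0 = 0"
  shows "dx f * dy g - dy f * dx g \<noteq> 0"
proof
  assume J: "dx f * dy g - dy f * dx g = 0"
  obtain N u ys where N: "N > 0" and u: "coeff2 u 0 0 \<noteq> 0" and ys: "length ys = d" "\<forall>y\<in>set ys. fps_nth y 0 = 0"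
    and eq: "stretch N f = u * prod_list (map (\<lambda>y. yy - fps_const y) ys)"
    using puiseux_factorization[OF f(1)] by metis
  have "d > 0" using f by (cases d) (auto simp: yreg_def)
  then obtain Y ys' where Yys: "ys = Y # ys'" using ys by (cases ys) auto
  then have Y: "fps_nth Y 0 = 0" using ys by auto
  define p where "p = yy - fps_const Y"
  define F where "F = stretch N f"
  define G where "G = stretch N g"
  have "coeff2 G 0 0 = 0" using g0 N by (simp add: G_def coeff2_stretch)
  have p0: "coeff2 p 0 0 = 0" using Y by (simp add: p_def coeff2_def)
  have "inum F G \<noteq> \<infinity>"
    unfolding F_def G_def inum_stretch[OF N] using fin by auto
  then obtain M where M: "inum F G = enat M" by auto
  \<comment> \<open>Each factor \<open>p\<close> contributes at least one to i(F, G), so the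
    multiplicity of \<open>p\<close> in \<open>F\<close> is bounded.\<close>
  have bound: "m \<le> M" if dvd: "p ^ m dvd F" for m
  proof -
    obtain w where "F = p ^ m * w" using dvd by (rule dvdE)
    then have "inum F G = enat m * inum p G + inum w G"
      by (simp add: inum_mult_left inum_commute[of _ G] inum_power inum_mult)
    moreover have "enat m * 1 \<le> enat m * inum p G"
      using inum_ge_1[OF p0 \<open>coeff2 G 0 0 = 0\<close>] by (rule mult_left_mono) simp
    ultimately have "enat m \<le> enat M" using M by (metis add_increasing2 mult.right_neutral zero_le)
    then show ?thesis by simp
  qed
  define m where "m = (GREATEST m. p ^ m dvd F)"
  have m: "p ^ m dvd F" and max: "\<And>k. p ^ k dvd F \<Longrightarrow> k \<le> m"
    unfolding m_def using bound
    by (auto intro: GreatestI_nat[of "\<lambda>m. p ^ m dvd F" 0 M] Greatest_le_nat[of "\<lambda>m. p ^ m dvd F" _ M])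
  obtain q where q: "F = p ^ m * q" using m by (rule dvdE)
  have "p dvd F" unfolding F_def eq Yys p_def by simp
  then have "m \<ge> 1" using max[of 1] by simp
  then obtain l where l: "m = Suc l" by (cases m) auto
  have evp: "evy Y p = 0" by (rule evy_unique[OF Y, of _ 1]) (simp add: p_def)
  have qY: "evy Y q \<noteq> 0"
  proof
    assume "evy Y q = 0"
    then obtain r where "q = p * r" using evy_division[OF Y, of q] by (auto simp: p_def)
    then have "p ^ Suc m dvd F" using q by (simp add: mult_ac)
    then show False using max[of "Suc m"] by simp
  qed
  have dF: "dx F = p ^ l * (of_nat m * q * dx p + p * dx q)" "dy F = p ^ l * (of_nat m * q * dy p + p * dy q)"
  proof -
    have dpow: "D (p ^ k) = of_nat k * p ^ (k - 1) * D p"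
      if D: "\<And>a b. D (a * b) = D a * b + a * D b" for D and k
    proof (induction k)
      case 0
      have "D 1 = D 1 + D 1" using D[of 1 1] by simp
      then show ?case by simp
    next
      case (Suc k)
      then show ?case by (cases k) (simp_all add: D algebra_simps)
    qed
    show "dx F = p ^ l * (of_nat m * q * dx p + p * dx q)"
      using dpow[of dx m] dx_simps(4) by (simp add: q dx_simps(4) l algebra_simps)
    show "dy F = p ^ l * (of_nat m * q * dy p + p * dy q)"
      using dpow[of dy m] dy_simps(4) by (simp add: q dy_simps(4) l algebra_simps)
  qed
  have "dx F * dy G - dy F * dx G = 0"
  proof -
    have "dx F * dy G - dy F * dx G
        = stretch N (dx f * dy g - dy f * dx g) * fps_const (fps_deriv (fps_X ^ N))"
      by (simp add: F_def G_def dx_stretch[OF N] dy_stretch[OF N] stretch_simps[OF N] algebra_simps)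
    then show ?thesis by (simp add: J stretch_simps[OF N])
  qed
  then have "p ^ l * ((of_nat m * q * dx p + p * dx q) * dy G - (of_nat m * q * dy p + p * dy q) * dx G) = 0"
    unfolding dF by (simp add: algebra_simps)
  moreover have "p \<noteq> 0"
    using arg_cong[of p 0 "\<lambda>h. coeff2 h 0 1"] by (auto simp: p_def coeff2_def)
  ultimately have "(of_nat m * q * dx p + p * dx q) * dy G - (of_nat m * q * dy p + p * dy q) * dx G = 0"
    by simp
  \<comment> \<open>Modulo \<open>p\<close> only the terms that differentiate the power
    \<open>p ^ m\<close> survive.\<close>
  then have "sc (of_nat m) * q * (dx p * dy G - dy p * dx G) = p * (- (dx q * dy G - dy q * dx G))"
    by (simp add: sc_def fps_of_nat algebra_simps)
  then have "evy Y (sc (of_nat m) * q * (dx p * dy G - dy p * dx G)) = evy Y (p * (- (dx q * dy G - dy q * dx G)))"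
    by (simp only:)
  then have zero_prod: "fps_const (of_nat m) * evy Y q * evy Y (dx p * dy G - dy p * dx G) = 0"
    by (simp only: evy_mult[OF Y] evp sc_def evy_const[OF Y]) simp
  then have z: "evy Y (dx p * dy G - dy p * dx G) = 0"
  proof -
    have "complex_of_nat m \<noteq> 0" using l by (simp del: of_nat_Suc)
    then show ?thesis using qY zero_prod by simp
  qed
  \<comment> \<open>Since \<open>p = y - Y\<close>, on the graph its Jacobian with \<open>G\<close>
    is minus the derivative of \<open>G\<close> along the graph.\<close>
  have "dx p * dy G - dy p * dx G = (sc (-1)) * (dy G * fps_const (fps_deriv Y) + dx G)"
    by (simp add: p_def dx_simps dy_simps sc_minus algebra_simps del: fps_const_neg)
  then have "evy Y (dy G * fps_const (fps_deriv Y) + dx G) = 0"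
    using z by (simp add: evy_mult[OF Y] sc_def evy_const[OF Y])
  then have "fps_deriv (evy Y G) = 0"
    by (simp add: evy_deriv[OF Y] evy_add[OF Y] evy_mult[OF Y] evy_const[OF Y] add.commute)
  then have "evy Y G = fps_const (fps_nth (evy Y G) 0)"
    by (simp add: fps_deriv_eq_0_iff)
  then have "evy Y G = 0"
    using \<open>coeff2 G 0 0 = 0\<close> by (simp add: evy_nth_0[OF Y])
  moreover have "evy Y F = 0"
    using evp by (simp add: q l evy_mult[OF Y])
  ultimately show False
    using branch_not_both_0[OF branch_evy[OF N Y] fin] by (simp add: F_def G_def)
qed

subsection \<open>Milnor numbers along polar curves\<close>

definition mu :: "ps2 \<Rightarrow> enat" where
  "mu h = inum (dx h) (dy h)"

lemma milnor_eq_mu: "h \<in> Cxy \<Longrightarrow> milnor h = mu h"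
  using intnum_eq_inum[of "dx h" "dy h"] by (simp add: milnor_def intnum_def mu_def Cxy_dx Cxy_dy)

definition dirder :: "complex \<Rightarrow> ps2 \<Rightarrow> ps2" where
  "dirder a h = dx h + sc a * dy h"

text \<open>The line \<open>y = a x\<close>, to which the derivation \<open>dirder a\<close> is
  tangent.\<close>

definition line :: "complex \<Rightarrow> ps2" where
  "line a = yy + sc a * (- xx)"

definition jac :: "ps2 \<Rightarrow> ps2 \<Rightarrow> ps2" where
  "jac f g = dx f * dy g - dy f * dx g"

lemma ford_deriv: "fps_nth a 0 = 0 \<Longrightarrow> ford a = ford (fps_deriv a) + 1"
proof (cases "a = 0")
  case False
  assume a0: "fps_nth a 0 = 0"
  obtain n where n: "subdegree a = Suc n"
    using False a0 by (metis not0_implies_Suc nth_subdegree_nonzero)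
  have "fps_nth a (Suc n) \<noteq> 0" using False n by (metis nth_subdegree_nonzero)
  then have nz: "fps_nth (fps_deriv a) n \<noteq> 0" by (simp del: of_nat_Suc)
  then have "subdegree (fps_deriv a) = n"
    using n by (intro subdegreeI) (auto intro: nth_less_subdegree_zero)
  moreover have "fps_deriv a \<noteq> 0" using nz by (metis fps_zero_nth)
  ultimately show ?thesis using False n by (simp add: ford_def one_enat_def)
qed (simp add: ford_def)

lemma enat_mult_cancel: "N > 0 \<Longrightarrow> enat N * x = enat N * y \<Longrightarrow> x = y"
  by (cases x; cases y) (auto simp: times_enat_def split: if_splits)

lemma sum_enat_eq_infinity:
  fixes f :: "'a \<Rightarrow> enat"
  assumes "finite A" "sum f A = \<infinity>"
  shows "\<exists>k\<in>A. f k = \<infinity>"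
  using assms by (induction A rule: finite_induct) (auto simp: plus_eq_infty_iff_enat)

lemma dx_xx [simp]: "dx xx = 1" and dy_xx [simp]: "dy xx = 0" and dx_yy [simp]: "dx yy = 0" and dy_yy [simp]: "dy yy = 1"
  by (simp_all add: xx_def dx_simps dy_simps)

lemma line_00 [simp]: "coeff2 (line a) 0 0 = 0"
  by (simp add: line_def)

text \<open>On the line the derivation is the derivative in \<open>x\<close>, which lowers a
  positive order by one.\<close>

lemma inum_line:
  assumes "coeff2 h 0 0 = 0"
  shows "inum h (line a) = inum (dirder a h) (line a) + 1"
proof -
  define Y where "Y = fps_const a * fps_X"
  have Y: "fps_nth Y 0 = 0" by (simp add: Y_def)
  have l: "line a = yy - fps_const Y"
    by (simp add: line_def Y_def sc_def xx_def)
  have dY: "fps_deriv Y = fps_const a" by (simp add: Y_def)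
  have "fps_deriv (evy Y h) = evy Y (dirder a h)"
    by (simp add: evy_deriv[OF Y] dirder_def evy_add[OF Y] evy_mult[OF Y] sc_def evy_const[OF Y] dY mult.commute)
  then show ?thesis
    unfolding l inum_graph[OF Y] using ford_deriv[of "evy Y h"] evy_nth_0[OF Y, of h] assms by simp
qed

lemma branch_line:
  assumes e: "branch e"
  shows "ford (e (line a)) = ford (fps_deriv (e yy) - fps_const a * fps_deriv (e xx)) + 1"
proof -
  have "e (line a) = e yy - fps_const a * e xx"
    by (simp add: line_def branchD[OF e])
  then show ?thesis
    using ford_deriv[of "e (line a)"] by (simp add: branchD(4)[OF e])
qed

text \<open>Along the polar curve D(h) = 0 one has dh = h_y (dy - a dx), so the order of
  \<open>h\<close> is that of h_y plus that of \<open>y - a x\<close>; moreover i(h_y, D(h)) is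
  \<mu>(h).\<close>

lemma inum_dirder:
  assumes h0: "coeff2 h 0 0 = 0" and fin: "inum h (line a) \<noteq> \<infinity>"
  shows "inum h (dirder a h) + 1 = mu h + inum h (line a)"
proof -
  let ?D = "dirder a h"
  have "?D \<noteq> 0"
    using fin inum_line[OF h0, of a] inum_0_right[of "line a"] by (auto simp: inum_commute[of 0])
  then obtain N n :: nat and e where N: "N > 0" and e: "\<forall>k<n. branch (e k)" "\<forall>k<n. e k ?D = 0"
    and sum: "\<forall>h. enat N * inum h ?D = (\<Sum>k<n. ford (e k h))"
    by (rule branch_formula)
  have "ford (e k h) = ford (e k (dy h)) + ford (e k (line a))" if k: "k < n" for k
  proof -
    note b = branchD[OF e(1)[rule_format, OF k]]
    have "e k (dx h) = - (fps_const a * e k (dy h))"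
      using e(2)[rule_format, OF k] by (simp add: dirder_def b eq_neg_iff_add_eq_0)
    then have "fps_deriv (e k h) = e k (dy h) * (fps_deriv (e k yy) - fps_const a * fps_deriv (e k xx))"
      using b(5)[of h] by (simp add: algebra_simps)
    then show ?thesis
      using ford_deriv[of "e k h"] h0 by (simp add: b(4) branch_line[OF e(1)[rule_format, OF k]] ford_simps add.assoc)
  qed
  then have "enat N * inum h ?D = enat N * (inum (dy h) ?D + inum (line a) ?D)"
    by (simp add: sum[rule_format] distrib_left sum.distrib)
  then have "inum h ?D = inum (dy h) ?D + inum (line a) ?D"
    by (rule enat_mult_cancel[OF N])
  moreover have "inum (dy h) ?D = mu h"
    unfolding mu_def dirder_def by (simp add: inum_add_multiple inum_commute[of "dy h"])
  ultimately show ?thesis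
    using inum_line[OF h0, of a] by (simp add: inum_commute[of "line a"] add.assoc)
qed

text \<open>An infinite value means that \<open>p + a q\<close> vanishes on a branch of
  \<open>C\<close>, and two such \<open>a\<close> on the same branch would make \<open>p\<close> and
  \<open>q\<close> vanish there together.\<close>

lemma finite_bad_parameters:
  assumes C: "C \<noteq> 0" and fin: "inum p q \<noteq> \<infinity>"
  shows "finite {a. inum C (p + sc a * q) = \<infinity>}"
proof -
  obtain N n :: nat and e where N: "N > 0" and e: "\<forall>k<n. branch (e k)" "\<forall>k<n. e k C = 0"
    and sum: "\<forall>h. enat N * inum h C = (\<Sum>k<n. ford (e k h))"
    by (rule branch_formula[OF C])
  have "{a. inum C (p + sc a * q) = \<infinity>} \<subseteq> (\<Union>k<n. {a. e k (p + sc a * q) = 0})"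
  proof
    fix a assume "a \<in> {a. inum C (p + sc a * q) = \<infinity>}"
    then have "(\<Sum>k<n. ford (e k (p + sc a * q))) = \<infinity>"
      using N by (simp add: inum_commute[of C] sum[rule_format, symmetric])
    then obtain k where "k < n" "ford (e k (p + sc a * q)) = \<infinity>"
      using sum_enat_eq_infinity[of "{..<n}"] by auto
    then show "a \<in> (\<Union>k<n. {a. e k (p + sc a * q) = 0})"
      by (auto simp: ford_def split: if_splits)
  qed
  moreover have "finite {a. e k (p + sc a * q) = 0}" if k: "k < n" for k
  proof -
    note b = branchD[OF e(1)[rule_format, OF k]]
    have "a = a'" if a: "e k (p + sc a * q) = 0" and a': "e k (p + sc a' * q) = 0" for a a'
    proof (rule ccontr)
      assume "a \<noteq> a'"
      have 1: "e k p + fps_const a * e k q = 0" "e k p + fps_const a' * e k q = 0"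
        using a a' by (simp_all add: b)
      have "fps_const (a - a') * e k q = (e k p + fps_const a * e k q) - (e k p + fps_const a' * e k q)"
        by (simp add: left_diff_distrib flip: fps_const_sub)
      also have "\<dots> = 0" unfolding 1 by simp
      finally have "fps_const (a - a') * e k q = 0" .
      then have "e k q = 0" using \<open>a \<noteq> a'\<close> by simp
      then show False
        using branch_not_both_0[OF e(1)[rule_format, OF k] fin] 1 by simp
    qed
    then have "{a. e k (p + sc a * q) = 0} \<subseteq> {THE a. e k (p + sc a * q) = 0}"
      by (auto intro: the_equality[symmetric])
    then show ?thesis by (rule finite_subset) simp
  qed
  ultimately show ?thesis
    by (meson finite_UN_I finite_lessThan finite_subset lessThan_iff)
qed

lemma finite_bad_lines:
  assumes "h \<noteq> 0"
  shows "finite {a. inum h (line a) = \<infinity>}"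
proof -
  have "inum yy (- xx) = inum yy (sc (-1) * xx)" by (simp add: sc_minus)
  also have "\<dots> = 1" by (subst inum_mult_unit) (simp_all add: inum_commute[of yy xx] inum_xx_yy)
  finally show ?thesis
    unfolding line_def using assms by (intro finite_bad_parameters) auto
qed

lemma inum_neq_infinity_imp_neq_0: "inum h k \<noteq> \<infinity> \<Longrightarrow> coeff2 k 0 0 = 0 \<Longrightarrow> h \<noteq> 0"
  using inum_0_right[of k] by (auto simp: inum_commute[of 0])

text \<open>On a branch of \<open>f\<close> the identity J (dy - a dx) = dg D(f) compares the orders
  of J and \<open>y - a x\<close> with those of \<open>g\<close> and D(f);
  \<open>inum_dirder\<close> then evaluates i(f, D(f)).\<close>

theorem inum_jacobian:
  assumes f0: "coeff2 f 0 0 = 0" and g0: "coeff2 g 0 0 = 0" and fin: "inum f g \<noteq> \<infinity>"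
  shows "inum f (jac f g) + 1 = mu f + inum f g"
proof -
  have "f \<noteq> 0" using inum_neq_infinity_imp_neq_0[OF fin g0] .
  obtain a where a: "inum f (line a) \<noteq> \<infinity>"
    using ex_new_if_finite[OF infinite_UNIV_char_0 finite_bad_lines[OF \<open>f \<noteq> 0\<close>]] by auto
  obtain N n :: nat and e where N: "N > 0" and e: "\<forall>k<n. branch (e k)" "\<forall>k<n. e k f = 0"
    and sum: "\<forall>h. enat N * inum h f = (\<Sum>k<n. ford (e k h))"
    by (rule branch_formula[OF \<open>f \<noteq> 0\<close>])
  let ?D = "dirder a f"
  have "ford (e k (jac f g)) + ford (e k (line a)) = ford (e k g) + ford (e k ?D)" if k: "k < n" for k
  proof -
    note b = branchD[OF e(1)[rule_format, OF k]]
    have key: "(fx * gy - fy * gx) * (Y - A * X) = (gx * X + gy * Y) * (fx + A * fy)"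
      if "fx * X + fy * Y = 0" for fx fy gx gy X Y A :: "complex fps"
    proof -
      have "(fx * gy - fy * gx) * (Y - A * X) - (gx * X + gy * Y) * (fx + A * fy)
          = - (fx * X + fy * Y) * (gx + A * gy)"
        by (simp add: algebra_simps)
      then show ?thesis using that by simp
    qed
    have "e k (jac f g) * (fps_deriv (e k yy) - fps_const a * fps_deriv (e k xx)) = fps_deriv (e k g) * e k ?D"
      using key[of "e k (dx f)" "fps_deriv (e k xx)" "e k (dy f)" "fps_deriv (e k yy)" "e k (dy g)" "e k (dx g)" "fps_const a"]
        b(5)[of f] b(5)[of g] e(2)[rule_format, OF k]
      by (simp add: jac_def dirder_def b(1,2,3,10))
    from arg_cong[OF this, of ford] show ?thesis
      using ford_deriv[of "e k g"] g0 by (simp add: b(4) branch_line[OF e(1)[rule_format, OF k]] ford_simps add.assoc add.commute add.left_commute)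
  qed
  then have "enat N * (inum (jac f g) f + inum (line a) f) = enat N * (inum g f + inum ?D f)"
    by (simp add: sum[rule_format] distrib_left sum.distrib[symmetric])
  then have "inum (jac f g) f + inum (line a) f = inum g f + inum ?D f"
    by (rule enat_mult_cancel[OF N])
  then have 1: "inum f (jac f g) + inum f (line a) = inum f g + inum f ?D"
    by (simp add: inum_commute)
  note 2 = inum_dirder[OF f0 a]
  obtain l where l: "inum f (line a) = enat l" using a by auto
  have "enat l + (inum f (jac f g) + 1) = inum f g + (inum f ?D + 1)"
    using 1 by (simp add: l add_ac)
  also have "\<dots> = enat l + (mu f + inum f g)"
    unfolding 2 l by (simp add: add_ac)
  finally show ?thesis by (simp add: enat_add_left_cancel)
qed

lemma dirder_mult: "dirder a (f * g) = dirder a f * g + f * dirder a g"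
  by (simp add: dirder_def dx_simps dy_simps algebra_simps)

text \<open>\<open>inum_dirder\<close> is applied to \<open>f\<close>, \<open>g\<close> and
  \<open>f * g\<close> with one common direction \<open>a\<close>; modulo \<open>f\<close> the
  product rule leaves D(f) g, and modulo \<open>g\<close> it leaves f D(g).\<close>

theorem mu_mult:
  assumes f0: "coeff2 f 0 0 = 0" and g0: "coeff2 g 0 0 = 0" and fin: "inum f g \<noteq> \<infinity>"
  shows "mu (f * g) + 1 = mu f + mu g + inum f g + inum f g"
proof -
  have "f \<noteq> 0" "g \<noteq> 0"
    using inum_neq_infinity_imp_neq_0[OF fin g0] inum_neq_infinity_imp_neq_0[of g f] fin f0
    by (auto simp: inum_commute[of g])
  then have "finite ({a. inum f (line a) = \<infinity>} \<union> {a. inum g (line a) = \<infinity>})"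
    by (simp add: finite_bad_lines)
  then obtain a where "a \<notin> {a. inum f (line a) = \<infinity>} \<union> {a. inum g (line a) = \<infinity>}"
    using ex_new_if_finite[OF infinite_UNIV_char_0] by blast
  then have a: "inum f (line a) \<noteq> \<infinity>" "inum g (line a) \<noteq> \<infinity>" by auto
  have fg: "inum (f * g) (line a) = inum f (line a) + inum g (line a)"
    by (rule inum_mult_left)
  obtain l m where lm: "inum f (line a) = enat l" "inum g (line a) = enat m" using a by auto
  have 1: "inum f (dirder a f) + 1 = mu f + enat l" using inum_dirder[OF f0 a(1)] lm by simp
  have 2: "inum g (dirder a g) + 1 = mu g + enat m" using inum_dirder[OF g0 a(2)] lm by simp
  have 3: "inum (f * g) (dirder a (f * g)) + 1 = mu (f * g) + enat (l + m)"
    using inum_dirder[of "f * g" a] f0 fg lm by simp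
  have "inum f (dirder a (f * g)) = inum f (dirder a f) + inum f g"
  proof -
    have "dirder a (f * g) = dirder a f * g + dirder a g * f"
      by (simp add: dirder_mult mult.commute)
    then show ?thesis by (simp only: inum_add_multiple inum_mult)
  qed
  moreover have "inum g (dirder a (f * g)) = inum g (dirder a g) + inum f g"
  proof -
    have "dirder a (f * g) = dirder a g * f + dirder a f * g"
      by (simp add: dirder_mult mult.commute add.commute)
    then show ?thesis by (simp only: inum_add_multiple inum_mult inum_commute[of g f])
  qed
  ultimately have 4: "inum (f * g) (dirder a (f * g)) = inum f (dirder a f) + inum f g + (inum g (dirder a g) + inum f g)"
    by (simp add: inum_mult_left)
  have "enat (l + m) + (mu (f * g) + 1) = (inum f (dirder a f) + 1) + (inum g (dirder a g) + 1) + inum f g + inum f g"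
    using 3 unfolding 4 by (metis (no_types, lifting) add.assoc add.commute)
  also have "\<dots> = enat (l + m) + (mu f + mu g + inum f g + inum f g)"
    unfolding 1 2 by (simp add: add_ac flip: plus_enat_simps(1))
  finally show ?thesis by (simp add: enat_add_left_cancel)
qed

subsection \<open>Pencils along a branch\<close>

text \<open>In terms of \<open>q = H / G\<close>, which vanishes at 0, the Wronskian is
  \<open>- G^2 q'\<close>. For equal orders of \<open>G\<close> and \<open>H\<close> the leading
  terms would cancel.\<close>

lemma ford_wronskian:
  assumes G: "ford G = enat m" and G0: "fps_nth G 0 = 0" and H: "\<And>i. i \<le> m \<Longrightarrow> fps_nth H i = 0"
  shows "ford (H * fps_deriv G - G * fps_deriv H) + 1 = ford G + ford H"
proof -
  have G_nz: "G \<noteq> 0" and m: "subdegree G = m" using G by (auto simp: ford_def split: if_splits)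
  have "G dvd H"
  proof (cases "H = 0")
    case False
    then have "m \<le> subdegree H" using H by (intro subdegree_geI) auto
    then show ?thesis using G_nz m False by (simp add: fps_dvd_iff)
  qed simp
  then obtain q where q: "H = G * q" by (rule dvdE)
  have q0: "fps_nth q 0 = 0"
  proof (rule ccontr)
    assume "fps_nth q 0 \<noteq> 0"
    moreover from this have "q \<noteq> 0" by auto
    ultimately have "H \<noteq> 0" "subdegree H = m" using G_nz m by (auto simp: q)
    then show False using H[of m] nth_subdegree_nonzero[of H] by simp
  qed
  have "H * fps_deriv G - G * fps_deriv H = (- 1) * (G * G * fps_deriv q)"
    by (simp add: q algebra_simps)
  then have "ford (H * fps_deriv G - G * fps_deriv H) = ford (-1) + (ford G + ford G + ford (fps_deriv q))"
    by (simp only: ford_simps)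
  moreover have "ford (-1) = 0" by (simp add: ford_def zero_enat_def)
  ultimately show ?thesis
    using ford_deriv[OF q0] by (simp add: q ford_simps add_ac)
qed

lemma ford_eqI: "(\<And>i. i < m \<Longrightarrow> fps_nth F i = 0) \<Longrightarrow> fps_nth F m \<noteq> 0 \<Longrightarrow> ford F = enat m"
  by (auto simp: ford_def intro: subdegreeI)

lemma ford_ge: "(\<And>i. i < m \<Longrightarrow> fps_nth F i = 0) \<Longrightarrow> enat m \<le> ford F"
  by (auto simp: ford_def intro: subdegree_geI)

lemma ford_const_mult: "c \<noteq> 0 \<Longrightarrow> ford (fps_const c * F) = ford F"
  by (simp add: ford_simps) (simp add: ford_def zero_enat_def[symmetric])

text \<open>Along a branch, exactly one member of the pencil has an order exceeding the generic order \<open>m\<close>.\<close>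
lemma pencil_orders:
  fixes F g :: "complex fps"
  assumes low: "\<And>i. i < m \<Longrightarrow> fps_nth F i = 0" "\<And>i. i < m \<Longrightarrow> fps_nth g i = 0"
    and T: "finite T" "\<And>t. fps_nth F m + t * fps_nth g m = 0 \<Longrightarrow> t \<in> T"
    and t1: "t1 \<notin> T"
    and nz: "fps_nth F m \<noteq> 0 \<or> fps_nth g m \<noteq> 0"
  obtains H c where "H = g - fps_const c * (F + fps_const t1 * g)" "\<And>i. i \<le> m \<Longrightarrow> fps_nth H i = 0"
    "ford H = enat m + (\<Sum>t\<in>T. ford (F + fps_const t * g) - enat m) + (ford g - enat m)"
    "ford (F + fps_const t1 * g) = enat m"
proof -
  define G where "G = F + fps_const t1 * g"
  have Gm: "fps_nth G m \<noteq> 0" using T(2)[of t1] t1 by (auto simp: G_def)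
  have Glow: "fps_nth G i = 0" if "i < m" for i using low that by (simp add: G_def)
  \<comment> \<open>Chosen to cancel the coefficient of degree \<open>m\<close> in \<open>H\<close>,
    which makes \<open>H\<close> a scalar multiple of the exceptional member, possibly
    \<open>g\<close> itself.\<close>
  define c where "c = fps_nth g m / fps_nth G m"
  define H where "H = g - fps_const c * G"
  have Hlow: "fps_nth H i = 0" if "i \<le> m" for i
    using that low Glow Gm by (cases "i = m") (auto simp: H_def c_def)
  have gen: "ford (F + fps_const t * g) - enat m = 0" if "fps_nth F m + t * fps_nth g m \<noteq> 0" for t
  proof -
    have "ford (F + fps_const t * g) = enat m" using low that by (intro ford_eqI) auto
    then show ?thesis by (simp add: zero_enat_def)
  qed
  \<comment> \<open>Only one excess term on the right is nonzero: the exceptional member is either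
    \<open>g\<close>, the point [0:1], or \<open>F + s g\<close> with \<open>s\<close> in
    \<open>T\<close>.\<close>
  have "ford H = enat m + (\<Sum>t\<in>T. ford (F + fps_const t * g) - enat m) + (ford g - enat m)"
  proof (cases "fps_nth g m = 0")
    case True
    then have "H = g" by (simp add: H_def c_def)
    have "(\<Sum>t\<in>T. ford (F + fps_const t * g) - enat m) = 0"
      using True nz by (intro sum.neutral ballI gen) auto
    moreover have "enat m \<le> ford g" using low by (intro ford_ge) auto
    ultimately show ?thesis using \<open>H = g\<close> by (cases "ford g") auto
  next
    case False
    define s where "s = - fps_nth F m / fps_nth g m"
    have s: "fps_nth F m + t * fps_nth g m = 0 \<longleftrightarrow> t = s" for t
      using False by (auto simp: s_def field_simps eq_neg_iff_add_eq_0)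
    then have sT: "s \<in> T" using T(2) by blast
    have "(\<Sum>t\<in>T. ford (F + fps_const t * g) - enat m) = (\<Sum>t\<in>{s}. ford (F + fps_const t * g) - enat m)"
      using sT T(1) s by (intro sum.mono_neutral_right) (auto intro!: gen)
    moreover have "ford g = enat m" using low False by (intro ford_eqI) auto
    moreover have "ford (F + fps_const s * g) = ford H"
    proof -
      have "c \<noteq> 0" using False Gm by (simp add: c_def)
      have "s - t1 = - inverse c"
        using False Gm by (simp add: s_def c_def G_def field_simps)
      then have s': "s = t1 - inverse c" by (simp add: algebra_simps)
      have "F + fps_const s * g = G - fps_const (inverse c) * g"
        unfolding s' G_def fps_const_sub[symmetric] by (simp add: algebra_simps del: fps_const_sub)
      also have "\<dots> = fps_const (- inverse c) * H"
      proof -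
        have "fps_const (inverse c) * (fps_const c * G) = G"
          using \<open>c \<noteq> 0\<close> by (simp add: mult.assoc[symmetric])
        then show ?thesis
          unfolding H_def fps_const_neg[symmetric] mult_minus_left right_diff_distrib by simp
      qed
      finally show ?thesis using \<open>c \<noteq> 0\<close> by (metis ford_const_mult inverse_nonzero_iff_nonzero neg_equal_0_iff_equal)
    qed
    moreover have "enat m \<le> ford H" using Hlow by (intro ford_ge) auto
    ultimately show ?thesis by (cases "ford H") (auto simp: zero_enat_def[symmetric])
  qed
  moreover have "ford (F + fps_const t1 * g) = enat m"
    using Gm Glow unfolding G_def by (intro ford_eqI) auto
  ultimately show ?thesis using that[of H c] Hlow by (simp add: H_def G_def)
qed

lemma inum_uminus: "inum h (- k) = inum h k"
proof -
  have "inum h (- k) = inum h (sc (-1) * k)" by (simp add: sc_minus)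
  also have "\<dots> = inum h k" by (rule inum_mult_unit) simp
  finally show ?thesis .
qed

lemma jac_pencil: "jac (f + sc t * g) g = jac f g"
  by (simp add: jac_def dx_simps dy_simps algebra_simps)

lemma inum_pencil: "inum (f + sc t * g) g = inum f g"
  by (metis inum_commute inum_add_multiple)

lemma pencil_jacobian:
  assumes f0: "coeff2 f 0 0 = 0" and g0: "coeff2 g 0 0 = 0" and fin: "inum f g \<noteq> \<infinity>"
  shows "inum (f + sc t * g) (jac f g) + 1 = mu (f + sc t * g) + inum f g"
    and "inum g (jac f g) + 1 = mu g + inum f g"
proof -
  show "inum (f + sc t * g) (jac f g) + 1 = mu (f + sc t * g) + inum f g"
    using inum_jacobian[of "f + sc t * g" g] f0 g0 fin by (simp add: jac_pencil inum_pencil)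
  have "jac g f = - jac f g" by (simp add: jac_def algebra_simps)
  then show "inum g (jac f g) + 1 = mu g + inum f g"
    using inum_jacobian[of g f] f0 g0 fin by (simp add: inum_uminus inum_commute[of g f])
qed

text \<open>On a branch of the Jacobian curve the gradients of \<open>G\<close> and \<open>g\<close> are parallel.\<close>
lemma branch_jacobian:
  assumes e: "branch e" and J: "e (jac G g) = 0"
  shows "fps_deriv (e G) * e (dirder a G * g - dirder a g * G)
    = e (dirder a G) * (e g * fps_deriv (e G) - e G * fps_deriv (e g))"
proof -
  have key: "(fx * X + fy * Y) * ((fx + A * fy) * u - (gx + A * gy) * v)
      = (fx + A * fy) * (u * (fx * X + fy * Y) - v * (gx * X + gy * Y))"
    if "fx * gy - fy * gx = 0" for fx fy gx gy X Y A u v :: "complex fps"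
  proof -
    have "(fx * X + fy * Y) * ((fx + A * fy) * u - (gx + A * gy) * v)
        - (fx + A * fy) * (u * (fx * X + fy * Y) - v * (gx * X + gy * Y))
        = (fx * gy - fy * gx) * (Y - A * X) * v"
      by (simp add: algebra_simps)
    then show ?thesis using that by simp
  qed
  have "e (dx G) * e (dy g) - e (dy G) * e (dx g) = 0"
    using J by (simp add: jac_def branchD(2,10)[OF e])
  from key[OF this, of "fps_deriv (e xx)" "fps_deriv (e yy)" "fps_const a" "e g" "e G"]
  show ?thesis
    by (simp add: branchD(5)[OF e, of G] branchD(5)[OF e, of g] dirder_def branchD(1,2,3,10)[OF e])
qed

lemma enat_add_minus: "a \<le> b \<Longrightarrow> a + (b - a) = (b :: enat)"
  by (cases a; cases b) auto

text \<open>Teissier's formula converts the excess of the orders over the generic order, summed over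
  the branches of J, into \<open>N\<close> times the excess of the Milnor number. In the last
  formula this is applied to the order of a Wronskian, which on each branch carries the excess of
  the exceptional member.\<close>

lemma polar_excess:
  assumes f0: "coeff2 f 0 0 = 0" and g0: "coeff2 g 0 0 = 0" and fin: "inum f g \<noteq> \<infinity>"
    and J: "jac f g \<noteq> 0"
  obtains T t1 where "finite T" "0 \<in> T" "t1 \<notin> T" "mu (f + sc t1 * g) \<noteq> \<infinity>"
    "\<forall>t. t \<notin> T \<longrightarrow> mu (f + sc t * g) = mu (f + sc t1 * g)"
    "\<forall>t. mu (f + sc t1 * g) \<le> mu (f + sc t * g)" "mu (f + sc t1 * g) \<le> mu g"
    "\<forall>a G. G = f + sc t1 * g \<longrightarrow> inum (dirder a G * g - dirder a g * G) (jac f g)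
      = inum (dirder a G) (jac f g) + inum G (jac f g)
        + (\<Sum>t\<in>T. mu (f + sc t * g) - mu G) + (mu g - mu G)"
proof -
  obtain N n :: nat and e where N: "N > 0" and e: "\<forall>k<n. branch (e k)" "\<forall>k<n. e k (jac f g) = 0"
    and sum: "\<forall>h. enat N * inum h (jac f g) = (\<Sum>k<n. ford (e k h))"
    by (rule branch_formula[OF J])
  \<comment> \<open>The smaller of the orders of \<open>f\<close> and \<open>g\<close> along the
    branch, hence the order of all members of the pencil but one.\<close>
  define M where "M k = (LEAST i. fps_nth (e k f) i \<noteq> 0 \<or> fps_nth (e k g) i \<noteq> 0)" for k
  have M: "fps_nth (e k f) (M k) \<noteq> 0 \<or> fps_nth (e k g) (M k) \<noteq> 0"
    "\<And>i. i < M k \<Longrightarrow> fps_nth (e k f) i = 0" "\<And>i. i < M k \<Longrightarrow> fps_nth (e k g) i = 0" if k: "k < n" for k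
  proof -
    have "\<exists>i. fps_nth (e k f) i \<noteq> 0 \<or> fps_nth (e k g) i \<noteq> 0"
    proof (rule ccontr)
      assume "\<not> ?thesis"
      then have "e k f = 0" "e k g = 0" by (auto simp: fps_eq_iff)
      then show False using branch_not_both_0[OF e(1)[rule_format, OF k] fin] by blast
    qed
    then show "fps_nth (e k f) (M k) \<noteq> 0 \<or> fps_nth (e k g) (M k) \<noteq> 0"
      unfolding M_def by (rule LeastI_ex)
    show "fps_nth (e k f) i = 0" "fps_nth (e k g) i = 0" if "i < M k" for i
      using not_less_Least[OF that[unfolded M_def]] by auto
  qed
  define bad where "bad k = {t. fps_nth (e k f) (M k) + t * fps_nth (e k g) (M k) = 0}" for k
  have fin_bad: "finite (bad k)" if "k < n" for k
  proof (cases "fps_nth (e k g) (M k) = 0")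
    case True
    then have "bad k = {}" using M(1)[OF that] by (auto simp: bad_def)
    then show ?thesis by simp
  next
    case False
    then have "bad k \<subseteq> {- fps_nth (e k f) (M k) / fps_nth (e k g) (M k)}"
      by (auto simp: bad_def field_simps eq_neg_iff_add_eq_0 add.commute)
    then show ?thesis by (rule finite_subset) simp
  qed
  \<comment> \<open>The value 0 is included even if \<open>f\<close> is generic, so that its term
    can later be split off and used for \<mu>(f); \<open>g\<close>, the point at infinity, is
    treated separately.\<close>
  define T where "T = insert 0 (\<Union>k<n. bad k)"
  have T: "finite T" "0 \<in> T" using fin_bad by (auto simp: T_def)
  obtain t1 where t1: "t1 \<notin> T" using ex_new_if_finite[OF infinite_UNIV_char_0 T(1)] by blast
  define gen where "gen = (\<Sum>k<n. enat (M k))"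
  have gen_fin: "gen \<noteq> \<infinity>" unfolding gen_def using sum_enat_eq_infinity[of "{..<n}"] by auto
  have ek: "e k (f + sc t * g) = e k f + fps_const t * e k g" if "k < n" for k t
    by (simp add: branchD(1,2,3)[OF e(1)[rule_format, OF that]])
  have ge: "enat (M k) \<le> ford (e k (f + sc t * g))" "enat (M k) \<le> ford (e k g)" if k: "k < n" for k t
    using M[OF k] by (auto simp: ek[OF k] intro!: ford_ge)
  have generic: "ford (e k (f + sc t * g)) = enat (M k)" if k: "k < n" and t: "t \<notin> T" for k t
    using M[OF k] t k by (auto simp: ek[OF k] T_def bad_def intro!: ford_eqI)
  have gen_t: "enat N * inum (f + sc t * g) (jac f g) = gen" if "t \<notin> T" for t
    using sum generic[OF _ that] by (simp add: gen_def)
  note pj = pencil_jacobian[OF f0 g0 fin]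
  define G where "G = f + sc t1 * g"
  have G_gen: "enat N * inum G (jac f g) = gen" using gen_t[OF t1] by (simp add: G_def)
  have iG_fin: "inum G (jac f g) \<noteq> \<infinity>"
    using G_gen gen_fin N by (cases "inum G (jac f g)") (auto simp: times_enat_def split: if_splits)
  obtain i where i: "inum f g = enat i" using fin by auto
  obtain j where j: "inum G (jac f g) = enat j" using iG_fin by auto
  have muG: "enat j + 1 = mu G + enat i" using pj(1)[of t1] i j by (simp add: G_def)
  obtain \<mu> where \<mu>: "mu G = enat \<mu>" using muG by (cases "mu G") (auto simp: one_enat_def)
  \<comment> \<open>This includes \<open>mu h = \<infinity>\<close>: both sides of the equation are
    then infinite, while \<mu>(G) and the generic orders stay finite.\<close>
  have excess: "mu G \<le> mu h \<and> (\<Sum>k<n. ford (e k h) - enat (M k)) = enat N * (mu h - mu G)"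
    if h: "inum h (jac f g) + 1 = mu h + inum f g" and hge: "\<And>k. k < n \<Longrightarrow> enat (M k) \<le> ford (e k h)" for h
  proof -
    have "enat N * inum h (jac f g) = (\<Sum>k<n. enat (M k) + (ford (e k h) - enat (M k)))"
      unfolding sum[rule_format] using hge by (intro sum.cong refl) (simp add: enat_add_minus)
    then have eq: "enat N * inum h (jac f g) = enat N * enat j + (\<Sum>k<n. ford (e k h) - enat (M k))"
      using G_gen j by (simp add: sum.distrib gen_def)
    show ?thesis
    proof (cases "inum h (jac f g)")
      case (enat l)
      then obtain m where m: "mu h = enat m" using h i by (cases "mu h") (auto simp: one_enat_def)
      have 1: "l + 1 = m + i" using h enat m i by (simp add: one_enat_def)
      have 2: "j + 1 = \<mu> + i" using muG \<mu> by (simp add: one_enat_def)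
      obtain z where z: "(\<Sum>k<n. ford (e k h) - enat (M k)) = enat z"
        using eq enat by (cases "\<Sum>k<n. ford (e k h) - enat (M k)") auto
      have 3: "N * l = N * j + z" using eq z enat by simp
      then have "j \<le> l" using N by (metis le_add1 nat_mult_le_cancel_disj neq0_conv)
      then have "z = N * (l - j)" using 3 by (simp add: diff_mult_distrib2)
      moreover have "l - j = m - \<mu>" "\<mu> \<le> m" using 1 2 \<open>j \<le> l\<close> by linarith+
      ultimately show ?thesis using z m \<mu> by simp
    next
      case infinity
      then have "mu h = \<infinity>" using h i by (cases "mu h") (auto simp: one_enat_def)
      moreover have "(\<Sum>k<n. ford (e k h) - enat (M k)) = \<infinity>"
        using eq infinity N by (cases "\<Sum>k<n. ford (e k h) - enat (M k)") (auto simp: times_enat_def split: if_splits)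
      ultimately show ?thesis using \<mu> N by (simp add: times_enat_def)
    qed
  qed
  have ex_t: "mu G \<le> mu (f + sc t * g) \<and> (\<Sum>k<n. ford (e k (f + sc t * g)) - enat (M k)) = enat N * (mu (f + sc t * g) - mu G)" for t
    by (rule excess[OF pj(1) ge(1)])
  have ex_g: "mu G \<le> mu g \<and> (\<Sum>k<n. ford (e k g) - enat (M k)) = enat N * (mu g - mu G)"
    by (rule excess[OF pj(2) ge(2)])
  have "mu (f + sc t * g) = mu G" if "t \<notin> T" for t
  proof -
    have "inum (f + sc t * g) (jac f g) = inum G (jac f g)"
      using gen_t[OF that] G_gen enat_mult_cancel[OF N] by metis
    then have "mu (f + sc t * g) + enat i = mu G + enat i"
      using pj(1)[of t] pj(1)[of t1] i by (simp add: G_def)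
    then show ?thesis using \<mu> by (cases "mu (f + sc t * g)") auto
  qed
  moreover have "inum (dirder a G * g - dirder a g * G) (jac f g)
      = inum (dirder a G) (jac f g) + inum G (jac f g)
        + (\<Sum>t\<in>T. mu (f + sc t * g) - mu G) + (mu g - mu G)" for a
  proof -
    let ?A = "dirder a G * g - dirder a g * G"
    have loc: "ford (e k ?A) = ford (e k (dirder a G)) + (enat (M k)
        + (\<Sum>t\<in>T. ford (e k (f + sc t * g)) - enat (M k)) + (ford (e k g) - enat (M k)))" if k: "k < n" for k
    proof -
      note b = branchD[OF e(1)[rule_format, OF k]]
      obtain H c where H: "H = e k g - fps_const c * (e k f + fps_const t1 * e k g)"
        "\<And>i. i \<le> M k \<Longrightarrow> fps_nth H i = 0"
        "ford H = enat (M k) + (\<Sum>t\<in>T. ford (e k f + fps_const t * e k g) - enat (M k)) + (ford (e k g) - enat (M k))"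
        "ford (e k f + fps_const t1 * e k g) = enat (M k)"
        by (rule pencil_orders[of "M k" "e k f" "e k g" T t1]) (use M[OF k] T t1 k in \<open>auto simp: T_def bad_def\<close>)
      have eG: "e k G = e k f + fps_const t1 * e k g" by (simp add: G_def ek[OF k])
      have G0: "fps_nth (e k G) 0 = 0" using f0 g0 by (simp add: b(4) G_def)
      have fG: "ford (e k G) = enat (M k)" by (simp add: eG H(4))
      have "e k (jac G g) = 0" using e(2) k by (simp add: G_def jac_pencil)
      then have "fps_deriv (e k G) * e k ?A = e k (dirder a G) * (e k g * fps_deriv (e k G) - e k G * fps_deriv (e k g))"
        by (rule branch_jacobian[OF e(1)[rule_format, OF k]])
      \<comment> \<open>The Wronskian does not change when a constant multiple of \<open>G\<close>
        is subtracted from \<open>g\<close>.\<close>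
      also have "e k g * fps_deriv (e k G) - e k G * fps_deriv (e k g) = H * fps_deriv (e k G) - e k G * fps_deriv H"
        unfolding H(1) eG[symmetric] by (simp add: algebra_simps)
      finally have eq: "ford (fps_deriv (e k G)) + ford (e k ?A)
          = ford (e k (dirder a G)) + ford (H * fps_deriv (e k G) - e k G * fps_deriv H)"
        by (metis ford_simps(2))
      have wronskian: "ford (H * fps_deriv (e k G) - e k G * fps_deriv H) + 1 = ford (e k G) + ford H"
        by (rule ford_wronskian[OF fG G0]) (rule H(2))
      have "(ford (fps_deriv (e k G)) + 1) + ford (e k ?A)
          = ford (e k (dirder a G)) + (ford (H * fps_deriv (e k G) - e k G * fps_deriv H) + 1)"
      proof -
        have "(a + 1) + b = c + (d + 1)" if "a + b = c + d" for a b c d :: enat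
        proof -
          have "(a + 1) + b = (a + b) + 1" by (simp add: add_ac)
          also have "\<dots> = c + (d + 1)" unfolding that by (simp add: add_ac)
          finally show ?thesis .
        qed
        from this[OF eq] show ?thesis .
      qed
      then have "enat (M k) + ford (e k ?A) = ford (e k (dirder a G)) + (enat (M k) + ford H)"
        unfolding ford_deriv[OF G0, symmetric] wronskian fG .
      then have "enat (M k) + ford (e k ?A) = enat (M k) + (ford (e k (dirder a G)) + ford H)"
        by (simp add: add_ac)
      \<comment> \<open>Only the finite order \<open>M k\<close> of \<open>G\<close> is cancelled;
        \<open>ford H\<close> may be infinite.\<close>
      then have "ford (e k ?A) = ford (e k (dirder a G)) + ford H"
        by (simp only: enat_add_left_cancel) simp
      then show ?thesis unfolding H(3) by (simp add: ek[OF k])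
    qed
    have "enat N * inum ?A (jac f g) = (\<Sum>k<n. ford (e k (dirder a G))) + (gen
        + (\<Sum>k<n. \<Sum>t\<in>T. ford (e k (f + sc t * g)) - enat (M k)) + (\<Sum>k<n. ford (e k g) - enat (M k)))"
      unfolding sum[rule_format] gen_def sum.distrib[symmetric] using loc by (intro sum.cong) auto
    also have "(\<Sum>k<n. \<Sum>t\<in>T. ford (e k (f + sc t * g)) - enat (M k)) = enat N * (\<Sum>t\<in>T. mu (f + sc t * g) - mu G)"
      using ex_t by (subst sum.swap) (simp add: sum_distrib_left)
    also have "(\<Sum>k<n. ford (e k g) - enat (M k)) = enat N * (mu g - mu G)"
      using ex_g by blast
    also have "(\<Sum>k<n. ford (e k (dirder a G))) = enat N * inum (dirder a G) (jac f g)"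
      using sum by simp
    finally have "enat N * inum ?A (jac f g) = enat N * (inum (dirder a G) (jac f g) + inum G (jac f g)
        + (\<Sum>t\<in>T. mu (f + sc t * g) - mu G) + (mu g - mu G))"
      unfolding G_gen[symmetric] by (simp add: distrib_left add.assoc)
    then show ?thesis by (rule enat_mult_cancel[OF N])
  qed
  ultimately show ?thesis
    using that[of T t1] T t1 ex_t ex_g \<mu> unfolding G_def by simp
qed

theorem inum_pair:
  assumes f0: "coeff2 f 0 0 = 0" and g0: "coeff2 g 0 0 = 0" and fin: "inum f g \<noteq> \<infinity>"
    and J: "jac f g \<noteq> 0"
  obtains T t1 where "finite T" "0 \<in> T" "mu (f + sc t1 * g) \<noteq> \<infinity>"
    "\<forall>t. t \<notin> T \<longrightarrow> mu (f + sc t * g) = mu (f + sc t1 * g)"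
    "inum (dx f * g - dx g * f) (dy f * g - dy g * f)
      = mu (f * g) + (\<Sum>t\<in>T - {0}. mu (f + sc t * g) - mu (f + sc t1 * g))"
proof -
  obtain T t1 where T: "finite T" "0 \<in> T" "t1 \<notin> T" and muG_fin: "mu (f + sc t1 * g) \<noteq> \<infinity>"
    and gen: "\<forall>t. t \<notin> T \<longrightarrow> mu (f + sc t * g) = mu (f + sc t1 * g)"
    and le: "\<forall>t. mu (f + sc t1 * g) \<le> mu (f + sc t * g)" "mu (f + sc t1 * g) \<le> mu g"
    and polar: "\<forall>a G. G = f + sc t1 * g \<longrightarrow> inum (dirder a G * g - dirder a g * G) (jac f g)
      = inum (dirder a G) (jac f g) + inum G (jac f g)
        + (\<Sum>t\<in>T. mu (f + sc t * g) - mu G) + (mu g - mu G)"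
    by (rule polar_excess[OF f0 g0 fin J])
  define G where "G = f + sc t1 * g"
  have G0: "coeff2 G 0 0 = 0" using f0 g0 by (simp add: G_def)
  have iGg: "inum G g = inum f g" by (simp add: G_def inum_pencil)
  have "G \<noteq> 0" by (rule inum_neq_infinity_imp_neq_0[OF _ g0]) (simp add: iGg fin)
  \<comment> \<open>Since \<mu>(G) is finite, D(G) shares a branch with J for finitely many
    directions only. Avoiding them makes i(D(G), D(g)) finite, which is cancelled below.\<close>
  have "finite ({a. inum (jac f g) (dx G + sc a * dy G) = \<infinity>} \<union> {a. inum G (line a) = \<infinity>})"
    using muG_fin finite_bad_lines[OF \<open>G \<noteq> 0\<close>] finite_bad_parameters[OF J, of "dx G" "dy G"]
    by (simp add: mu_def G_def)
  then obtain a where "a \<notin> {a. inum (jac f g) (dx G + sc a * dy G) = \<infinity>} \<union> {a. inum G (line a) = \<infinity>}"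
    using ex_new_if_finite[OF infinite_UNIV_char_0] by blast
  then have a: "inum (dirder a G) (jac f g) \<noteq> \<infinity>" "inum G (line a) \<noteq> \<infinity>"
    by (auto simp: dirder_def inum_commute[of _ "jac f g"])
  define A where "A = dirder a G * g - dirder a g * G"
  define B where "B = dy f * g - dy g * f"
  have Jg: "jac f g = jac G g" by (simp add: G_def jac_pencil)
  have B: "B = dy G * g - dy g * G" by (simp add: B_def G_def dy_simps algebra_simps)
  have A: "A = (dx f * g - dx g * f) + sc a * B"
    by (simp add: A_def B_def G_def dirder_def dx_simps dy_simps algebra_simps)
  \<comment> \<open>\<open>A\<close> differs from the first generator of the pair by a multiple of
    the second.\<close>
  have e1: "inum (dx f * g - dx g * f) B = inum A B"
    unfolding A by (metis inum_commute inum_add_multiple)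
  have e2: "inum A (B * dirder a G) = inum A (G * jac f g)"
  proof -
    have "B * dirder a G = - (G * jac f g) + dy G * A"
      unfolding Jg unfolding B A_def jac_def dirder_def by (simp add: algebra_simps)
    then show ?thesis by (simp only: inum_add_multiple inum_uminus)
  qed
  have e3: "inum A (dirder a G) = inum (dirder a G) (dirder a g) + inum (dirder a G) G"
  proof -
    have eq: "A = - (dirder a g * G) + g * dirder a G" by (simp add: A_def algebra_simps)
    show ?thesis
      unfolding inum_commute[of A "dirder a G"] by (simp only: eq inum_add_multiple inum_uminus inum_mult)
  qed
  have e4: "inum A G = inum G (dirder a G) + inum G g"
  proof -
    have eq: "A = dirder a G * g + (- dirder a g) * G" by (simp add: A_def)
    show ?thesis
      unfolding inum_commute[of A G] by (simp only: eq inum_add_multiple inum_mult)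
  qed
  \<comment> \<open>Expressed through D(G) and D(g), the Jacobian is - G_y D(g) modulo D(G), and
    i(D(G), G_y) is \<mu>(G).\<close>
  have e5: "inum (dirder a G) (jac f g) = mu G + inum (dirder a G) (dirder a g)"
  proof -
    have "jac f g = - (dy G * dirder a g) + dy g * dirder a G"
      unfolding Jg unfolding jac_def dirder_def by (simp add: algebra_simps)
    then have "inum (dirder a G) (jac f g) = inum (dirder a G) (dy G) + inum (dirder a G) (dirder a g)"
      by (simp only: inum_add_multiple inum_uminus inum_mult)
    also have "inum (dirder a G) (dy G) = mu G"
      unfolding mu_def dirder_def by (metis inum_commute inum_add_multiple)
    finally show ?thesis .
  qed
  have e6: "inum G (jac f g) + 1 = mu G + inum f g"
    using inum_jacobian[OF G0 g0] fin by (simp add: iGg Jg)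
  have e7: "inum G (dirder a G) + 1 = mu G + inum G (line a)" by (rule inum_dirder[OF G0 a(2)])
  have e8: "mu (f * g) + 1 = mu f + mu g + inum f g + inum f g" by (rule mu_mult[OF f0 g0 fin])
  define X where "X = (\<Sum>t\<in>T - {0}. mu (f + sc t * g) - mu G)"
  have e9: "(\<Sum>t\<in>T. mu (f + sc t * g) - mu G) = (mu f - mu G) + X"
    unfolding X_def using T(1,2) by (subst sum.remove[of T 0]) auto
  have e10: "inum A (jac f g) = inum (dirder a G) (jac f g) + inum G (jac f g) + ((mu f - mu G) + X) + (mu g - mu G)"
    using polar[rule_format, OF G_def, of a] e9 by (simp add: A_def)
  have lef: "mu G \<le> mu f" and leg: "mu G \<le> mu g" using le(1)[rule_format, of 0] le(2) by (simp_all add: G_def)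
  obtain i where i: "inum f g = enat i" using fin by auto
  obtain m where m: "mu G = enat m" using muG_fin by (auto simp: G_def)
  obtain p where p: "inum (dirder a G) (dirder a g) = enat p" using a(1) unfolding e5 by (cases "inum (dirder a G) (dirder a g)") auto
  obtain l where l: "inum G (line a) = enat l" using a(2) by auto
  obtain r where r: "inum G (dirder a G) = enat r" using e7 l m by (cases "inum G (dirder a G)") auto
  obtain j where j: "inum G (jac f g) = enat j" using e6 m i by (cases "inum G (jac f g)") auto
  have "inum A B + inum A (dirder a G) = inum A G + inum A (jac f g)"
    using e2 by (simp add: inum_mult)
  then have "inum A B + enat (p + r) = enat (r + i) + (enat (m + p) + enat j + ((mu f - mu G) + X) + (mu g - mu G))"
    unfolding e3 e4 e10 e5 by (simp add: p r j m i iGg inum_commute[of "dirder a G" G])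
  then have "inum A B = enat (i + m + j) + ((mu f - mu G) + X) + (mu g - mu G)"
    by (cases "inum A B"; cases "mu f - mu G"; cases X; cases "mu g - mu G") auto
  moreover have "j + 1 = m + i" using e6 j m i by (simp add: one_enat_def)
  \<comment> \<open>Adding 1 allows i(G, J) + 1 to be replaced by \<mu>(G) + i(f, g) without
    subtraction; the two copies of \<mu>(G) then restore \<mu>(f) and \<mu>(g) from their
    jumps.\<close>
  ultimately have "inum A B + 1 = enat (i + i) + (mu G + (mu f - mu G)) + (mu G + (mu g - mu G)) + X"
    by (cases "mu f - mu G"; cases X; cases "mu g - mu G") (auto simp: m one_enat_def)
  also have "\<dots> = mu (f * g) + 1 + X"
    unfolding e8 enat_add_minus[OF lef] enat_add_minus[OF leg] i by (simp add: add_ac)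
  finally have "inum A B = mu (f * g) + X"
    by (cases "inum A B"; cases "mu (f * g)"; cases X) (auto simp: one_enat_def)
  then have "inum (dx f * g - dx g * f) (dy f * g - dy g * f) = mu (f * g) + X"
    using e1 by (simp add: B_def)
  from that[OF T(1,2) muG_fin gen this[unfolded X_def G_def]] show ?thesis .
qed

theorem theorem4p6:
  fixes f g :: ps2
  assumes "f \<in> Cxy" and "g \<in> Cxy"
    and "coeff2 f 0 0 = 0" and "coeff2 g 0 0 = 0"
    and "coprime2 f g"
  shows "milnor_pair f g = milnor (f * g) +
           (\<Sum>t\<in>bif_star f g. milnor (f + sc t * g) - mu_gen f g)"
proof -
  have fin: "inum f g \<noteq> \<infinity>" and reg: "(\<exists>d. yreg d f) \<or> (\<exists>d. yreg d g)"
    using coprime_imp_inum_finite assms by blast+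
  have J: "jac f g \<noteq> 0"
    using reg
  proof
    assume "\<exists>d. yreg d f"
    then show ?thesis using jacobian_neq_0[OF fin] assms(3,4) by (auto simp: jac_def)
  next
    assume "\<exists>d. yreg d g"
    then have "jac g f \<noteq> 0"
      using jacobian_neq_0[of g f] fin assms(3,4) by (auto simp: jac_def inum_commute[of g])
    then show ?thesis by (auto simp: jac_def algebra_simps)
  qed
  obtain T t1 where T: "finite T" "0 \<in> T" and fin1: "mu (f + sc t1 * g) \<noteq> \<infinity>"
    and gen: "\<forall>t. t \<notin> T \<longrightarrow> mu (f + sc t * g) = mu (f + sc t1 * g)"
    and main: "inum (dx f * g - dx g * f) (dy f * g - dy g * f)
      = mu (f * g) + (\<Sum>t\<in>T - {0}. mu (f + sc t * g) - mu (f + sc t1 * g))"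
    by (rule inum_pair[OF assms(3,4) fin J])
  have mil: "milnor (f + sc t * g) = mu (f + sc t * g)" for t
    using assms(1,2) by (intro milnor_eq_mu) (auto intro: Cxy_intros)
  have mug: "mu_gen f g = mu (f + sc t1 * g)"
    unfolding mu_gen_def mil
  proof (rule the_equality)
    show fin_gen: "finite {t. mu (f + sc t * g) \<noteq> mu (f + sc t1 * g)}"
      by (rule finite_subset[OF _ T(1)]) (use gen in blast)
    fix m assume "finite {t. mu (f + sc t * g) \<noteq> m}"
    with fin_gen have "finite ({t. mu (f + sc t * g) \<noteq> m} \<union> {t. mu (f + sc t * g) \<noteq> mu (f + sc t1 * g)})"
      by blast
    then obtain t where "t \<notin> {t. mu (f + sc t * g) \<noteq> m} \<union> {t. mu (f + sc t * g) \<noteq> mu (f + sc t1 * g)}"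
      using ex_new_if_finite[OF infinite_UNIV_char_0] by blast
    then show "m = mu (f + sc t1 * g)" by auto
  qed
  have "(\<Sum>t\<in>bif_star f g. milnor (f + sc t * g) - mu_gen f g)
      = (\<Sum>t\<in>T - {0}. mu (f + sc t * g) - mu (f + sc t1 * g))"
    unfolding mil mug
  \<comment> \<open>\<open>T\<close> may be larger than the bifurcation set. The surplus terms
    vanish because the generic value is finite; in \<open>enat\<close> the difference
    \<open>\<infinity> - \<infinity>\<close> is not 0.\<close>
  proof (rule sum.mono_neutral_left)
    show "bif_star f g \<subseteq> T - {0}" using gen by (auto simp: bif_star_def mil mug)
    show "\<forall>t\<in>T - {0} - bif_star f g. mu (f + sc t * g) - mu (f + sc t1 * g) = 0"
      using fin1 by (auto simp: bif_star_def mil mug zero_enat_def)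
  qed (use T in simp)
  moreover have "milnor_pair f g = inum (dx f * g - dx g * f) (dy f * g - dy g * f)"
    unfolding milnor_pair_def using assms(1,2) by (intro intnum_eq_inum) (auto intro!: Cxy_intros)
  moreover have "milnor (f * g) = mu (f * g)"
    using assms(1,2) by (intro milnor_eq_mu Cxy_mult)
  ultimately show ?thesis using main by simp
qed

end
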